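(* Let $D$ be a weakly locally finite division ring with center $F$. Then every finitely generated subnormal subgroup of $D^*$ is contained in $F$.
   Context: A division ring $D$ is weakly locally finite if for every finite subset $S\subseteq D$, the division subring generated by $S$ is finite dimensional over its own center. $D^*$ denotes the multiplicative group of $D$. *)

theory Defs
  imports "HOL-Algebra.Algebra"
begin

definition center_of :: "'a::division_ring set \<Rightarrow> 'a set" where
  "center_of K = {z \<in> K. \<forall>x\<in>K. z * x = x * z}"

definition is_division_subring :: "'a::division_ring set \<Rightarrow> bool" where
  "is_division_subring K \<longleftrightarrow> 0 \<in> K \<and> 1 \<in> K \<and>
     (\<forall>x\<in>K. \<forall>y\<in>K. x + y \<in> K \<and> x * y \<in> K) \<and>
     (\<forall>x\<in>K. - x \<in> K \<and> inverse x \<in> K)"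

definition div_subring_gen :: "'a::division_ring set \<Rightarrow> 'a set" where
  "div_subring_gen S = \<Inter>{K. is_division_subring K \<and> S \<subseteq> K}"

definition fin_dim_over_center :: "'a::division_ring set \<Rightarrow> bool" where
  "fin_dim_over_center K \<longleftrightarrow>
     (\<exists>B. finite B \<and> B \<subseteq> K \<and>
        K = {\<Sum>b\<in>B. c b * b | c. \<forall>b\<in>B. c b \<in> center_of K})"

definition weakly_locally_finite :: "'a::division_ring itself \<Rightarrow> bool" where
  "weakly_locally_finite _ \<longleftrightarrow>
     (\<forall>S::'a set. finite S \<longrightarrow> fin_dim_over_center (div_subring_gen S))"

definition units_grp :: "'a::division_ring monoid" where
  "units_grp = \<lparr>carrier = {x. x \<noteq> 0}, monoid.mult = (*), one = 1\<rparr>"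

definition subnormal :: "('a, 'b) monoid_scheme \<Rightarrow> 'a set \<Rightarrow> bool" where
  "subnormal G H \<longleftrightarrow>
     (\<exists>N n. N 0 = H \<and> N n = carrier G \<and>
        (\<forall>i<n. subgroup (N (Suc i)) G \<and> normal (N i) (G\<lparr>carrier := N (Suc i)\<rparr>)))"

definition finitely_generated_subgroup :: "('a, 'b) monoid_scheme \<Rightarrow> 'a set \<Rightarrow> bool" where
  "finitely_generated_subgroup G H \<longleftrightarrow>
     subgroup H G \<and> (\<exists>S. finite S \<and> S \<subseteq> carrier G \<and> H = generate G S)"

end

theory Submission
  imports Defs
begin

text \<open>Let \<open>a\<close> not commute with \<open>h \<in> H\<close>, and let \<open>D\<close> be the division subring generated by \<open>a\<close> and the
  generators of \<open>H\<close>; it is finite dimensional over its center \<open>Z\<close>. Put \<open>y\<^sub>0 = x\<close> and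
  \<open>y\<^sub>k\<^sub>+\<^sub>1 = y\<^sub>k h y\<^sub>k\<^sup>-\<^sup>1\<close>; by subnormality \<open>y\<^sub>m \<in> H\<close> for a fixed \<open>m\<close> and all \<open>x \<noteq> 0\<close>.

  Suppose \<open>Z\<close> is algebraic over a subring \<open>B\<close> with a multiplicative absolute value that is at least \<open>1\<close>
  on nonzero elements: \<open>B\<close> is either the integers, or \<open>k[\<theta>]\<close> with \<open>2 ^ deg\<close>, where \<open>k\<close> is a maximal subring
  of \<open>Z\<close> over which \<open>\<theta>\<close> is transcendental. Then \<open>H\<close> lies in \<open>M[1/e]\<close> for a \<open>B\<close>-lattice \<open>M\<close>. For
  \<open>x = a + t\<close> with suitable \<open>t \<in> B\<close> of growing absolute value, the denominator of \<open>y\<^sub>m\<close> is a fixed power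
  of \<open>e\<close> times something coprime to \<open>e\<close>, hence is bounded, whereas \<open>y\<^sub>m\<close> converges to \<open>h\<close>. So
  \<open>y\<^sub>m = h\<close> for large \<open>t\<close>, and the coefficient of \<open>1/t\<close> shows that the \<open>m\<close>-th power of \<open>ad h\<close> kills \<open>a\<close>.
  A nilpotent \<open>ad h \<noteq> 0\<close> yields \<open>b\<close> with \<open>bh - hb = 1\<close>, which is impossible in characteristic \<open>0\<close> because
  the \<open>m\<close>-th power of \<open>ad h\<close> maps \<open>b ^ m\<close> to \<open>m!\<close>. In characteristic \<open>p\<close>, conjugation by \<open>h\<close> shifts
  \<open>bh\<close> by \<open>1\<close>, and \<open>y\<^sub>m = h\<close> produces a nontrivial \<open>p\<close>-th root of unity.

  If no such \<open>B\<close> exists, then \<open>Z\<close> is algebraic over a finite prime field, so \<open>a\<close> and \<open>h\<close> lie in a finite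
  subring and commute by Wedderburn's little theorem.\<close>

subsection \<open>Spans over a subring and integral elements\<close>

definition sring :: "'a::division_ring set \<Rightarrow> bool" where
  "sring B \<longleftrightarrow> 0 \<in> B \<and> 1 \<in> B \<and> (\<forall>x\<in>B. \<forall>y\<in>B. x + y \<in> B \<and> x * y \<in> B) \<and> (\<forall>x\<in>B. - x \<in> B)"

lemma sringD:
  assumes "sring B"
  shows "0 \<in> B" "1 \<in> B" "x \<in> B \<Longrightarrow> y \<in> B \<Longrightarrow> x + y \<in> B" "x \<in> B \<Longrightarrow> y \<in> B \<Longrightarrow> x * y \<in> B"
    "x \<in> B \<Longrightarrow> - x \<in> B" "x \<in> B \<Longrightarrow> y \<in> B \<Longrightarrow> x - y \<in> B"
  using assms unfolding sring_def by (auto, metis add_uminus_conv_diff)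

lemma sring_power: "sring B \<Longrightarrow> x \<in> B \<Longrightarrow> x ^ n \<in> B"
  by (induction n) (auto intro: sringD)

lemma sring_sum: "sring B \<Longrightarrow> (\<And>i. i \<in> I \<Longrightarrow> f i \<in> B) \<Longrightarrow> sum f I \<in> B"
  by (induction I rule: infinite_finite_induct) (auto intro: sringD)

text \<open>Left combinations built one term at a time, so that closure properties follow by rule
  induction for arbitrary \<open>T\<close>. \<open>lspan_finite\<close> recovers a coefficient
  function when \<open>T\<close> is finite.\<close>

inductive_set lspan :: "'a::division_ring set \<Rightarrow> 'a set \<Rightarrow> 'a set" for B T where
  zero: "0 \<in> lspan B T"
| step: "x \<in> lspan B T \<Longrightarrow> b \<in> B \<Longrightarrow> t \<in> T \<Longrightarrow> x + b * t \<in> lspan B T"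

lemma lspan_add:
  assumes "x \<in> lspan B T" "y \<in> lspan B T" shows "x + y \<in> lspan B T"
  using assms(2,1)
proof (induction y rule: lspan.induct)
  case (step y b t)
  then show ?case using lspan.step[of "x + y" B T b t] by (simp add: add.assoc)
qed simp

lemma lspan_scale:
  assumes "sring B" "b \<in> B" "x \<in> lspan B T" shows "b * x \<in> lspan B T"
  using assms(3)
proof (induction x rule: lspan.induct)
  case (step x c t)
  have "b * x + (b * c) * t \<in> lspan B T"
    using step sringD(4)[OF assms(1,2)] by (blast intro: lspan.step)
  then show ?case by (simp add: distrib_left mult.assoc)
qed (auto intro: lspan.intros)

lemma lspan_minus: "sring B \<Longrightarrow> x \<in> lspan B T \<Longrightarrow> - x \<in> lspan B T"
  using lspan_scale[of B "-1" x T] sringD(2,5)[of B] by (metis mult_minus1)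

lemma lspan_diff: "sring B \<Longrightarrow> x \<in> lspan B T \<Longrightarrow> y \<in> lspan B T \<Longrightarrow> x - y \<in> lspan B T"
  using lspan_add lspan_minus by (metis add_uminus_conv_diff)

lemma lspan_base: "sring B \<Longrightarrow> t \<in> T \<Longrightarrow> t \<in> lspan B T"
  using lspan.step[OF lspan.zero, of 1 B t T] sringD(2)[of B] by simp

lemma lspan_sum: "(\<And>i. i \<in> I \<Longrightarrow> f i \<in> lspan B T) \<Longrightarrow> sum f I \<in> lspan B T"
  by (induction I rule: infinite_finite_induct) (auto intro: lspan.zero lspan_add)

lemma lspan_least:
  assumes "0 \<in> V" "\<And>x y. x \<in> V \<Longrightarrow> y \<in> V \<Longrightarrow> x + y \<in> V" "\<And>b t. b \<in> B \<Longrightarrow> t \<in> T \<Longrightarrow> b * t \<in> V"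
  shows "lspan B T \<subseteq> V"
proof
  fix x assume "x \<in> lspan B T" then show "x \<in> V" by induction (auto intro: assms)
qed

lemma lspan_mono: "T \<subseteq> T' \<Longrightarrow> lspan B T \<subseteq> lspan B T'"
  using lspan_least[of "lspan B T'" B T] lspan.step[OF lspan.zero, of _ B _ T'] lspan.zero lspan_add
  by (metis add_0 subsetD)

lemma lspan_finite:
  assumes "sring B" "finite T" "x \<in> lspan B T"
  obtains c where "\<And>t. t \<in> T \<Longrightarrow> c t \<in> B" "x = (\<Sum>t\<in>T. c t * t)"
proof -
  from assms(3) have "\<exists>c. (\<forall>t\<in>T. c t \<in> B) \<and> x = (\<Sum>t\<in>T. c t * t)"
  proof induction
    case zero
    show ?case by (rule exI[of _ "\<lambda>_. 0"]) (use assms in \<open>auto intro: sringD\<close>)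
  next
    case (step x b t)
    then obtain c where c: "\<forall>t\<in>T. c t \<in> B" "x = (\<Sum>t\<in>T. c t * t)" by blast
    have "(\<Sum>s\<in>T. (c(t := c t + b)) s * s) = (\<Sum>s\<in>T. c s * s + (if s = t then b * t else 0))"
      by (rule sum.cong) (auto simp: distrib_right)
    also have "\<dots> = x + b * t"
      using step(3) assms(2) by (simp add: sum.distrib c(2))
    finally show ?case
      by (intro exI[of _ "c(t := c t + b)"]) (use c step assms(1) in \<open>auto intro: sringD\<close>)
  qed
  then show ?thesis using that by blast
qed

lemma lspan_sumI: "(\<And>t. t \<in> T \<Longrightarrow> c t \<in> B) \<Longrightarrow> (\<Sum>t\<in>T. c t * t) \<in> lspan B T"
  using lspan.step[OF lspan.zero, of _ B _ T] by (intro lspan_sum) auto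

lemma finite_lspan:
  assumes "sring B" "finite B" "finite T" shows "finite (lspan B T)"
proof -
  have "lspan B T \<subseteq> (\<lambda>c. \<Sum>t\<in>T. c t * t) ` (T \<rightarrow>\<^sub>E B)"
  proof
    fix x assume "x \<in> lspan B T"
    then obtain c where c: "\<And>t. t \<in> T \<Longrightarrow> c t \<in> B" "x = (\<Sum>t\<in>T. c t * t)"
      using lspan_finite[OF assms(1,3)] by blast
    then show "x \<in> (\<lambda>c. \<Sum>t\<in>T. c t * t) ` (T \<rightarrow>\<^sub>E B)"
      by (intro image_eqI[of _ _ "restrict c T"]) (auto intro: sum.cong)
  qed
  then show ?thesis by (rule finite_subset) (use assms in \<open>simp add: finite_PiE\<close>)
qed

section \<open>Algebraic and integral elements\<close>

definition alg_over :: "'a::division_ring set \<Rightarrow> 'a \<Rightarrow> bool" where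
  "alg_over B z \<longleftrightarrow> (\<exists>n c. (\<forall>i\<le>n. c i \<in> B) \<and> c n \<noteq> 0 \<and> (\<Sum>i\<le>n. c i * z ^ i) = 0)"

text \<open>Degree \<open>d = 0\<close> is harmless: it would assert \<open>1 = 0\<close>.\<close>

definition int_over :: "'a::division_ring set \<Rightarrow> 'a \<Rightarrow> bool" where
  "int_over B z \<longleftrightarrow> (\<exists>d c. (\<forall>i<d. c i \<in> B) \<and> z ^ d = (\<Sum>i<d. c i * z ^ i))"

text \<open>Truncating at the largest index with a nonzero coefficient gives the nonzero leading
  coefficient that \<open>alg_over\<close> demands.\<close>

lemma alg_overI:
  assumes "\<And>i. i \<le> n \<Longrightarrow> c i \<in> B" "k \<le> n" "c k \<noteq> 0" "(\<Sum>i\<le>n. c i * z ^ i) = 0"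
  shows "alg_over B z"
proof -
  define m where "m = (GREATEST i. i \<le> n \<and> c i \<noteq> 0)"
  have m: "m \<le> n \<and> c m \<noteq> 0"
    unfolding m_def by (rule GreatestI_nat[of "\<lambda>i. i \<le> n \<and> c i \<noteq> 0" k n]) (use assms in auto)
  have z: "c i = 0" if "m < i" "i \<le> n" for i
  proof (rule ccontr)
    assume "c i \<noteq> 0"
    then have "i \<le> m" unfolding m_def
      using that by (intro Greatest_le_nat[of "\<lambda>i. i \<le> n \<and> c i \<noteq> 0" i n]) auto
    then show False using that by simp
  qed
  have "(\<Sum>i\<le>m. c i * z ^ i) = (\<Sum>i\<le>n. c i * z ^ i)"
    by (rule sum.mono_neutral_left) (use m z in auto)
  then show ?thesis unfolding alg_over_def
    using m assms(1) by (intro exI[of _ m] exI[of _ c]) (auto simp: assms(4))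
qed

text \<open>Multiplying a relation with leading coefficient \<open>c n\<close> by
  \<open>c n ^ (n - 1)\<close> makes it monic in \<open>c n * z\<close>; so \<open>b\<close> is the
  leading coefficient.\<close>

lemma alg_int:
  assumes B: "sring B" and comm: "\<And>x y. x \<in> B \<Longrightarrow> y \<in> B \<Longrightarrow> x * y = y * x"
    and zc: "\<And>x. x \<in> B \<Longrightarrow> x * z = z * x" and "alg_over B z"
  obtains b where "b \<in> B" "b \<noteq> 0" "int_over B (b * z)"
proof -
  obtain n c where c: "\<And>i. i \<le> n \<Longrightarrow> c i \<in> B" "c n \<noteq> 0" "(\<Sum>i\<le>n. c i * z ^ i) = 0"
    using assms(4) unfolding alg_over_def by blast
  have n: "n \<noteq> 0"
  proof
    assume "n = 0" then show False using c by simp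
  qed
  define b where "b = c n"
  have bB: "b \<in> B" using c b_def by simp
  have pw: "(b * z) ^ i = b ^ i * z ^ i" for i
  proof (induction i)
    case (Suc i)
    have "z * b ^ i = b ^ i * z"
      using power_commuting_commutes[of b z i] zc[OF bB] by simp
    then show ?case using Suc by (simp add: mult.assoc[symmetric]) (simp add: mult.assoc)
  qed simp
  have cb: "c i * b ^ j = b ^ j * c i" if "i \<le> n" for i j
    using that c bB comm sring_power[OF B] by blast
  have "0 = b ^ (n - 1) * (\<Sum>i\<le>n. c i * z ^ i)" using c by simp
  also have "\<dots> = (\<Sum>i\<le>n. b ^ (n - 1) * c i * z ^ i)"
    by (simp add: sum_distrib_left mult.assoc)
  also have "\<dots> = (\<Sum>i<n. b ^ (n - 1) * c i * z ^ i) + b ^ (n - 1) * c n * z ^ n"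
    by (simp flip: lessThan_Suc_atMost)
  also have "b ^ (n - 1) * c n = b ^ n"
    using n unfolding b_def by (metis Suc_pred' neq0_conv power_Suc2)
  also have "b ^ n * z ^ n = (b * z) ^ n" by (simp add: pw)
  also have "(\<Sum>i<n. b ^ (n - 1) * c i * z ^ i) = (\<Sum>i<n. (b ^ (n - 1 - i) * c i) * (b * z) ^ i)"
  proof (rule sum.cong)
    fix i assume "i \<in> {..<n}"
    then have i: "i < n" "n - 1 = (n - 1 - i) + i" by auto
    have "b ^ (n - 1) * c i = b ^ (n - 1 - i) * b ^ i * c i"
      using i by (metis power_add)
    also have "\<dots> = b ^ (n - 1 - i) * c i * b ^ i"
      using cb[of i i] i by (simp add: mult.assoc)
    finally show "b ^ (n - 1) * c i * z ^ i = (b ^ (n - 1 - i) * c i) * (b * z) ^ i"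
      by (simp add: pw mult.assoc)
  qed simp
  finally have "(b * z) ^ n = - (\<Sum>i<n. (b ^ (n - 1 - i) * c i) * (b * z) ^ i)"
    by (metis add_eq_0_iff)
  also have "\<dots> = (\<Sum>i<n. (- (b ^ (n - 1 - i) * c i)) * (b * z) ^ i)"
    by (simp add: sum_negf)
  finally have "(b * z) ^ n = (\<Sum>i<n. (- (b ^ (n - 1 - i) * c i)) * (b * z) ^ i)" .
  moreover have "\<forall>i<n. - (b ^ (n - 1 - i) * c i) \<in> B"
    using sringD(4,5)[OF B] sring_power[OF B bB] c(1) by (simp add: less_imp_le)
  ultimately have "int_over B (b * z)" unfolding int_over_def
    by (intro exI[of _ n] exI[of _ "\<lambda>i. - (b ^ (n - 1 - i) * c i)"] conjI)
  then show ?thesis using that[OF bB] c(2) unfolding b_def by blast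
qed

text \<open>The elements \<open>t * w ^ j\<close> with \<open>j\<close> below the degree of the
  monic relation generate a ring, because \<open>w ^ d\<close> reduces to lower powers of
  \<open>w\<close>.\<close>

lemma adjoin_integral:
  assumes K: "sring K" and comm: "\<And>x y. x \<in> K \<Longrightarrow> y \<in> K \<Longrightarrow> x * y = y * x"
    and B: "sring B" "B \<subseteq> K" and T: "finite T" "T \<subseteq> K" and L: "sring (lspan B T)"
    and w: "w \<in> K" "int_over B w"
  obtains T' where "finite T'" "T' \<subseteq> K" "sring (lspan B T')" "lspan B T \<subseteq> lspan B T'" "w \<in> lspan B T'"
proof -
  obtain d c where c: "\<And>i. i < d \<Longrightarrow> c i \<in> B" "w ^ d = (\<Sum>i<d. c i * w ^ i)"
    using w(2) unfolding int_over_def by blast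
  have d: "d > 0"
  proof (rule ccontr)
    assume "\<not> d > 0" then show False using c by simp
  qed
  define T' where "T' = (\<lambda>(t,j). t * w ^ j) ` (T \<times> {..<d})"
  let ?M = "lspan B T'"
  have LK: "lspan B T \<subseteq> K"
    by (rule lspan_least) (use K B T in \<open>auto intro: sringD\<close>)
  have wK: "w ^ j \<in> K" for j using K w sring_power by blast
  have T'K: "T' \<subseteq> K" unfolding T'_def using K T wK by (auto intro: sringD)
  have MK: "?M \<subseteq> K"
    by (rule lspan_least) (use K B T'K in \<open>auto intro: sringD\<close>)
  have 1: "l * w ^ j \<in> ?M" if "l \<in> lspan B T" "j < d" for l j
    using that
  proof (induction l rule: lspan.induct)
    case (step x b t)
    then have "t * w ^ j \<in> T'" unfolding T'_def by force
    then have "x * w ^ j + b * (t * w ^ j) \<in> ?M" using step by (intro lspan.step) auto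
    then show ?case by (simp add: distrib_right mult.assoc)
  qed (auto intro: lspan.zero)
  \<comment> \<open>The old span contains \<open>1\<close>, hence all of \<open>B\<close>, and so
    absorbs the coefficients of the relation for \<open>w\<close>.\<close>
  have BL: "b \<in> lspan B T" if "b \<in> B" for b
    using lspan_scale[OF B(1) that sringD(2)[OF L]] by simp
  have 2: "x * w \<in> ?M" if "x \<in> ?M" for x
    using that
  proof (induction x rule: lspan.induct)
    case (step x b t)
    from step(3) obtain s j where s: "s \<in> T" "j < d" "t = s * w ^ j" unfolding T'_def by auto
    have sL: "s \<in> lspan B T" using lspan_base[OF B(1) s(1)] .
    have "t * w \<in> ?M"
    proof (cases "Suc j < d")
      case True
      then show ?thesis using 1[OF sL True] s by (simp add: mult.assoc power_Suc2 del: power_Suc)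
    next
      case False
      then have "Suc j = d" using s by simp
      then have "t * w = s * w ^ d" using s by (simp add: mult.assoc power_Suc2[symmetric] del: power_Suc)
      also have "\<dots> = (\<Sum>i<d. s * c i * w ^ i)"
        by (simp add: c(2) sum_distrib_left mult.assoc)
      also have "\<dots> \<in> ?M"
        by (intro lspan_sum 1) (use sL BL c(1) L in \<open>auto intro: sringD\<close>)
      finally show ?thesis .
    qed
    then have "x * w + b * (t * w) \<in> ?M"
      using step B by (auto intro: lspan_add lspan_scale)
    then show ?case by (simp add: distrib_right mult.assoc)
  qed (auto intro: lspan.zero)
  have 3: "x * w ^ j \<in> ?M" if "x \<in> ?M" for x j
    by (induction j) (use 2 that in \<open>auto simp: power_Suc2 mult.assoc[symmetric] simp del: power_Suc\<close>)
  have 4: "l * x \<in> ?M" if "l \<in> lspan B T" "x \<in> ?M" for l x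
    using that(2)
  proof (induction x rule: lspan.induct)
    case (step x b t)
    from step(3) obtain s j where s: "s \<in> T" "j < d" "t = s * w ^ j" unfolding T'_def by auto
    have "l * b * s \<in> lspan B T"
      using that(1) BL[OF step(2)] lspan_base[OF B(1) s(1)] L by (auto intro: sringD)
    then have "l * b * s * w ^ j \<in> ?M" using 1 s by blast
    then have "l * x + l * b * s * w ^ j \<in> ?M" using step by (auto intro: lspan_add)
    then show ?case by (simp add: distrib_left mult.assoc s)
  qed (auto intro: lspan.zero)
  have 5: "x * y \<in> ?M" if "x \<in> ?M" "y \<in> ?M" for x y
    using that(1)
  proof (induction x rule: lspan.induct)
    case (step x b t)
    from step(3) obtain s j where s: "s \<in> T" "j < d" "t = s * w ^ j" unfolding T'_def by auto
    have "b * s \<in> lspan B T" 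
      using lspan_scale[OF B(1) step(2) lspan_base[OF B(1) s(1)]] .
    then have "(b * s) * (y * w ^ j) \<in> ?M" using 4 3 that by blast
    moreover have "(b * s) * (y * w ^ j) = b * t * y"
      using comm[of y "w ^ j"] MK that wK s by (auto simp: mult.assoc)
    ultimately show ?case using step by (auto simp: distrib_right intro: lspan_add)
  qed (auto intro: lspan.zero)
  have inc: "lspan B T \<subseteq> ?M" using 1[of _ 0] d by auto
  have "sring ?M" unfolding sring_def
    using 5 inc sringD(2)[OF L] by (auto intro: lspan.zero lspan_add lspan_minus[OF B(1)])
  moreover have "w \<in> ?M" using 2[of 1] inc sringD(2)[OF L] by auto
  moreover have "finite T'" unfolding T'_def using T by simp
  ultimately show ?thesis using that T'K inc by blast
qed

text \<open>Elements of \<open>Z\<close> are adjoined one at a time, each scaled to be integral; the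
  scalars multiply up to the common denominator \<open>b\<close>.\<close>

lemma algebraic_order:
  assumes K: "sring K" and comm: "\<And>x y. x \<in> K \<Longrightarrow> y \<in> K \<Longrightarrow> x * y = y * x"
    and B: "sring B" "B \<subseteq> K" and alg: "\<And>z. z \<in> K \<Longrightarrow> alg_over B z"
    and Z: "finite Z" "Z \<subseteq> K"
  shows "\<exists>T b. finite T \<and> T \<subseteq> K \<and> sring (lspan B T) \<and> b \<in> B \<and> b \<noteq> 0 \<and> (\<forall>z\<in>Z. b * z \<in> lspan B T)"
  using Z
proof (induction Z rule: finite_induct)
  case empty
  have "lspan B {1} = B"
  proof
    show "lspan B {1} \<subseteq> B" by (rule lspan_least) (use B in \<open>auto intro: sringD\<close>)
    show "B \<subseteq> lspan B {1}" using lspan.step[OF lspan.zero, of _ B 1 "{1}"] by auto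
  qed
  then show ?case using B K sringD(2)[OF B(1)] sringD(2)[OF K]
    by (intro exI[of _ "{1}"] exI[of _ 1]) auto
next
  case (insert z Z)
  then obtain T b where T: "finite T" "T \<subseteq> K" "sring (lspan B T)" "b \<in> B" "b \<noteq> 0" "\<forall>z\<in>Z. b * z \<in> lspan B T"
    by auto
  have zK: "z \<in> K" using insert by simp
  obtain b' where b': "b' \<in> B" "b' \<noteq> 0" "int_over B (b' * z)"
    by (rule alg_int[OF B(1) _ _ alg[OF zK]]) (use B(2) zK in \<open>auto intro: comm\<close>)
  have "b' * z \<in> K" using b' B zK K by (auto intro: sringD)
  then obtain T' where T': "finite T'" "T' \<subseteq> K" "sring (lspan B T')" "lspan B T \<subseteq> lspan B T'" "b' * z \<in> lspan B T'"
    using adjoin_integral[OF K comm B T(1-3) _ b'(3)] by metis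
  have "b' * b * y \<in> lspan B T'" if "y \<in> Z" for y
    using T(6) that T'(4) lspan_scale[OF B(1) b'(1)] by (metis mult.assoc subsetD)
  moreover have "b' * b * z \<in> lspan B T'"
    using lspan_scale[OF B(1) T(4) T'(5)] comm[of b b'] B(2) T(4) b'(1) by (metis mult.assoc subsetD)
  ultimately show ?case using T' b' T(4,5) B(1)
    by (intro exI[of _ T'] exI[of _ "b' * b"]) (auto intro: sringD)
qed

section \<open>Linear dependence and common denominators\<close>

lemma lspan_insertE:
  assumes B: "sring B" and "x \<in> lspan B (insert t T)"
  obtains c r where "c \<in> B" "r \<in> lspan B T" "x = c * t + r"
proof -
  from assms(2) have "\<exists>c r. c \<in> B \<and> r \<in> lspan B T \<and> x = c * t + r"
  proof (induction x rule: lspan.induct)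
    case zero
    show ?case using lspan.zero sringD(1)[OF B] by (intro exI[of _ 0]) auto
  next
    case (step x b s)
    then obtain c r where cr: "c \<in> B" "r \<in> lspan B T" "x = c * t + r" by blast
    show ?case
    proof (cases "s = t")
      case True
      then have "x + b * s = (c + b) * t + r" by (simp add: cr distrib_right)
      then show ?thesis using cr step(2) sringD(3)[OF B] by blast
    next
      case False
      then have "s \<in> T" using step by simp
      then have "r + b * s \<in> lspan B T" using cr(2) step(2) by (rule_tac lspan.step)
      then show ?thesis using cr by (intro exI[of _ c] exI[of _ "r + b * s"]) (simp add: add.assoc)
    qed
  qed
  then show ?thesis using that by blast
qed

text \<open>Fraction-free Gaussian elimination: \<open>B\<close> need not be a field, so pivots are
  cross-multiplied instead of divided out.\<close>

lemma steinitz: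
  assumes B: "sring B" and comm: "\<And>x y. x \<in> B \<Longrightarrow> y \<in> B \<Longrightarrow> x * y = y * x"
    and "finite T" "finite J" "card T < card J" "\<And>i. i \<in> J \<Longrightarrow> v i \<in> lspan B T"
  shows "\<exists>d. (\<forall>i\<in>J. d i \<in> B) \<and> (\<exists>i\<in>J. d i \<noteq> 0) \<and> (\<Sum>i\<in>J. d i * v i) = 0"
  using assms(3-)
proof (induction T arbitrary: J v rule: finite_induct)
  case empty
  have "lspan B {} \<subseteq> {0}" by (rule lspan_least) auto
  then have "v i = 0" if "i \<in> J" for i using empty that by blast
  moreover have "J \<noteq> {}" using empty by auto
  ultimately show ?case using sringD(2)[OF B] by (intro exI[of _ "\<lambda>_. 1"]) auto
next
  case (insert t T)
  have "\<exists>c r. c \<in> B \<and> r \<in> lspan B T \<and> v i = c * t + r" if "i \<in> J" for i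
    using lspan_insertE[OF B insert(6)[OF that]] by metis
  then obtain c r where cr: "\<And>i. i \<in> J \<Longrightarrow> c i \<in> B" "\<And>i. i \<in> J \<Longrightarrow> r i \<in> lspan B T"
    "\<And>i. i \<in> J \<Longrightarrow> v i = c i * t + r i"
    by metis
  show ?case
  proof (cases "\<forall>i\<in>J. c i = 0")
    case True
    then show ?thesis using insert cr by (intro insert.IH) auto
  next
    case False
    then obtain k where k: "k \<in> J" "c k \<noteq> 0" by blast
    define J' where "J' = J - {k}"
    \<comment> \<open>The \<open>t\<close>-components cancel by commutativity of
      \<open>B\<close>.\<close>
    define w where "w i = c k * v i - c i * v k" for i
    have "w i \<in> lspan B T" if "i \<in> J'" for i
    proof -
      have iJ: "i \<in> J" using that J'_def by simp
      have "w i = c k * r i - c i * r k + (c k * c i - c i * c k) * t"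
        unfolding w_def cr(3)[OF iJ] cr(3)[OF k(1)] by (simp add: algebra_simps)
      also have "\<dots> = c k * r i - c i * r k"
        using comm[OF cr(1)[OF k(1)] cr(1)[OF iJ]] by simp
      finally show ?thesis
        using lspan_diff[OF B lspan_scale[OF B cr(1)[OF k(1)] cr(2)[OF iJ]]
          lspan_scale[OF B cr(1)[OF iJ] cr(2)[OF k(1)]]] by simp
    qed
    moreover have "finite J'" "card T < card J'"
      using insert k unfolding J'_def by auto
    ultimately obtain d where d: "\<forall>i\<in>J'. d i \<in> B" "\<exists>i\<in>J'. d i \<noteq> 0" "(\<Sum>i\<in>J'. d i * w i) = 0"
      using insert.IH[of J' w] by blast
    \<comment> \<open>Expanding each \<open>w i\<close> in the relation collects all multiples of
      \<open>v k\<close> in one coefficient; the others are scaled by the pivot \<open>c k\<close>,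
      so a nonzero one survives.\<close>
    define d' where "d' i = (if i = k then - (\<Sum>j\<in>J'. d j * c j) else d i * c k)" for i
    have "(\<Sum>i\<in>J. d' i * v i) = d' k * v k + (\<Sum>i\<in>J'. d' i * v i)"
      unfolding J'_def using insert k by (simp add: sum.remove)
    also have "(\<Sum>i\<in>J'. d' i * v i) = (\<Sum>i\<in>J'. d i * c k * v i)"
      by (rule sum.cong) (auto simp: d'_def J'_def)
    also have "d' k * v k + \<dots> = (\<Sum>i\<in>J'. d i * w i)"
      by (simp add: d'_def w_def sum_distrib_right right_diff_distrib sum_subtractf mult.assoc)
    finally have "(\<Sum>i\<in>J. d' i * v i) = 0" using d by simp
    moreover have "d' i \<in> B" if "i \<in> J" for i
    proof (cases "i = k")
      case True
      have "(\<Sum>j\<in>J'. d j * c j) \<in> B"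
        by (rule sring_sum[OF B], rule sringD(4)[OF B]) (use d cr J'_def in auto)
      then show ?thesis using True sringD(5)[OF B] by (simp add: d'_def)
    next
      case False
      then show ?thesis using that d cr(1)[OF k(1)] sringD(4)[OF B] by (simp add: d'_def J'_def)
    qed
    moreover have "\<exists>i\<in>J. d' i \<noteq> 0" using d k unfolding d'_def J'_def by auto
    ultimately show ?thesis by (intro exI[of _ d']) auto
  qed
qed

lemma common_multiplier:
  assumes B: "sring B" and comm: "\<And>x y. x \<in> B \<Longrightarrow> y \<in> B \<Longrightarrow> x * y = y * x"
    and "finite G" "\<And>g. g \<in> G \<Longrightarrow> \<exists>b\<in>B. b \<noteq> 0 \<and> b * g \<in> M"
    and M: "\<And>b x. b \<in> B \<Longrightarrow> x \<in> M \<Longrightarrow> b * x \<in> M"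
  shows "\<exists>b\<in>B. b \<noteq> 0 \<and> (\<forall>g\<in>G. b * g \<in> M)"
  using assms(3,4)
proof (induction G rule: finite_induct)
  case empty
  then show ?case using sringD(2)[OF B] by (intro bexI[of _ 1]) auto
next
  case (insert g G)
  then obtain b where b: "b \<in> B" "b \<noteq> 0" "\<forall>g\<in>G. b * g \<in> M" by auto
  obtain b' where b': "b' \<in> B" "b' \<noteq> 0" "b' * g \<in> M" using insert.prems[of g] by auto
  have "b' * b * y \<in> M" if "y \<in> insert g G" for y
  proof (cases "y = g")
    case True
    have "b * (b' * g) \<in> M" using M b' b by blast
    then show ?thesis using True comm[OF b(1) b'(1)] by (simp add: mult.assoc[symmetric])
  next
    case False
    then have "b' * (b * y) \<in> M" using M b' b that by blast
    then show ?thesis by (simp add: mult.assoc)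
  qed
  then show ?case using b b' sringD(4)[OF B] by (intro bexI[of _ "b' * b"]) auto
qed

section \<open>Orders in finite dimensional division subrings\<close>

lemma division_subring_sring: "is_division_subring D \<Longrightarrow> sring D"
  unfolding is_division_subring_def sring_def by blast

lemma center_commute: "z \<in> center_of D \<Longrightarrow> x \<in> D \<Longrightarrow> z * x = x * z"
  unfolding center_of_def by blast

lemma sring_center:
  assumes D: "sring D" shows "sring (center_of D)"
proof -
  have ZD: "x \<in> D" if "x \<in> center_of D" for x using that unfolding center_of_def by blast
  have I: "x \<in> center_of D" if "x \<in> D" "\<And>w. w \<in> D \<Longrightarrow> x * w = w * x" for x
    using that unfolding center_of_def by blast
  show ?thesis unfolding sring_def
  proof (intro conjI ballI)
    show "0 \<in> center_of D" by (rule I) (simp_all add: sringD(1)[OF D])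
    show "1 \<in> center_of D" by (rule I) (simp_all add: sringD(2)[OF D])
    fix x assume x: "x \<in> center_of D"
    show "- x \<in> center_of D"
      by (rule I) (simp_all add: sringD(5)[OF D] ZD x center_commute[OF x])
    fix y assume y: "y \<in> center_of D"
    show "x + y \<in> center_of D"
      by (rule I) (simp_all add: sringD(3)[OF D] ZD x y center_commute[OF x] center_commute[OF y] algebra_simps)
    show "x * y \<in> center_of D"
    proof (rule I)
      show "x * y \<in> D" using sringD(4)[OF D] ZD x y by simp
      show "x * y * w = w * (x * y)" if "w \<in> D" for w
        using center_commute[OF x that] center_commute[OF y that] by (metis mult.assoc)
    qed
  qed
qed

text \<open>The finitely many central coordinates of \<open>G\<close> and of products of basis
  elements acquire a common denominator \<open>e\<close> in an order of the center. Scaling the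
  basis by \<open>e\<close> then makes the structure constants integral.\<close>

lemma exists_order:
  assumes D: "sring D" and Bas: "finite Bas" "Bas \<subseteq> D"
    and span: "D = {\<Sum>b\<in>Bas. c b * b | c. \<forall>b\<in>Bas. c b \<in> center_of D}"
    and B: "sring B" "B \<subseteq> center_of D" and alg: "\<And>z. z \<in> center_of D \<Longrightarrow> alg_over B z"
    and G: "finite G" "G \<subseteq> D"
  shows "\<exists>T e. finite T \<and> T \<subseteq> D \<and> (\<forall>x\<in>lspan B T. \<forall>y\<in>lspan B T. x * y \<in> lspan B T) \<and>
    e \<in> B \<and> e \<noteq> 0 \<and> (\<forall>g\<in>G. e * g \<in> lspan B T)"
proof -
  let ?Z = "center_of D"
  have Zc: "z * x = x * z" if "z \<in> ?Z" "x \<in> D" for z x using center_commute that by blast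
  have ZD: "?Z \<subseteq> D" unfolding center_of_def by blast
  have Zcomm: "x * y = y * x" if "x \<in> ?Z" "y \<in> ?Z" for x y using that ZD Zc by blast
  have "\<forall>x\<in>D. \<exists>c. (\<forall>b\<in>Bas. c b \<in> ?Z) \<and> x = (\<Sum>b\<in>Bas. c b * b)"
    using span by blast
  then obtain co where co: "\<And>x b. x \<in> D \<Longrightarrow> b \<in> Bas \<Longrightarrow> co x b \<in> ?Z"
    "\<And>x. x \<in> D \<Longrightarrow> x = (\<Sum>b\<in>Bas. co x b * b)"
    by metis
  \<comment> \<open>Products of basis elements are included, so that the structure constants are
    cleared along with the coordinates of \<open>G\<close>.\<close>
  define G' where "G' = G \<union> (\<lambda>(a,b). a * b) ` (Bas \<times> Bas)"
  have G': "finite G'" "G' \<subseteq> D" unfolding G'_def using G Bas D by (auto intro: sringD)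
  define Zs where "Zs = (\<lambda>(g,b). co g b) ` (G' \<times> Bas)"
  have Zs: "finite Zs" "Zs \<subseteq> ?Z" unfolding Zs_def using G' Bas co(1) by auto
  obtain T0 e where T0: "finite T0" "T0 \<subseteq> ?Z" "sring (lspan B T0)"
    and e: "e \<in> B" "e \<noteq> 0" "\<forall>z\<in>Zs. e * z \<in> lspan B T0"
    using algebraic_order[OF sring_center[OF D] Zcomm B alg Zs] by blast
  have eZ: "e \<in> ?Z" using e B by blast
  let ?L = "lspan B T0"
  have LZ: "?L \<subseteq> ?Z"
    by (rule lspan_least) (use sring_center[OF D] B T0 in \<open>auto intro: sringD\<close>)
  have BL: "b \<in> ?L" if "b \<in> B" for b
    using lspan_scale[OF B(1) that sringD(2)[OF T0(3)]] by simp
  define T where "T = (\<lambda>(s,b). s * (e * b)) ` (T0 \<times> Bas)"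
  let ?M = "lspan B T"
  have T: "finite T" "T \<subseteq> D" unfolding T_def using T0 Bas ZD eZ D by (auto intro!: sringD(4)[OF D])
  have MD: "?M \<subseteq> D"
    by (rule lspan_least) (use D B ZD T in \<open>auto intro: sringD\<close>)
  have 1: "l * (e * b) \<in> ?M" if "l \<in> ?L" "b \<in> Bas" for l b
    using that(1)
  proof (induction l rule: lspan.induct)
    case (step x c t)
    then have "t * (e * b) \<in> T" unfolding T_def using that by force
    then have "x * (e * b) + c * (t * (e * b)) \<in> ?M" using step by (intro lspan.step) auto
    then show ?case by (simp add: distrib_right mult.assoc)
  qed (auto intro: lspan.zero)
  \<comment> \<open>One factor \<open>e\<close> makes each coordinate integral, the other completes
    the basis element to \<open>e * b\<close>; hence the final multiplier is
    \<open>e * e\<close>.\<close>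
  have 2: "e * e * g \<in> ?M" if "g \<in> G'" for g
  proof -
    have gD: "g \<in> D" using that G' by blast
    have "e * e * g = (\<Sum>b\<in>Bas. e * e * (co g b * b))"
      by (subst co(2)[OF gD]) (simp add: sum_distrib_left)
    also have "\<dots> = (\<Sum>b\<in>Bas. (e * co g b) * (e * b))"
    proof (rule sum.cong)
      fix b assume "b \<in> Bas"
      then have "e * co g b = co g b * e" using Zcomm eZ co(1) gD by blast
      then show "e * e * (co g b * b) = (e * co g b) * (e * b)" by (metis mult.assoc)
    qed simp
    also have "\<dots> \<in> ?M"
      by (intro lspan_sum 1) (use e that Zs_def in auto)
    finally show ?thesis .
  qed
  have 3: "l * x \<in> ?M" if "l \<in> ?L" "x \<in> ?M" for l x
    using that(2)
  proof (induction x rule: lspan.induct)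
    case (step x c t)
    from step(3) obtain s b where s: "s \<in> T0" "b \<in> Bas" "t = s * (e * b)" unfolding T_def by auto
    have "l * c * s \<in> ?L"
      using sringD(4)[OF T0(3)] that(1) BL[OF step(2)] lspan_base[OF B(1) s(1)] by blast
    then have "l * x + l * c * s * (e * b) \<in> ?M" using step 1 s by (auto intro: lspan_add)
    then show ?case by (simp add: distrib_left mult.assoc s)
  qed (auto intro: lspan.zero)
  have 4: "(e * b) * y \<in> ?M" if "b \<in> Bas" "y \<in> ?M" for b y
    using that(2)
  proof (induction y rule: lspan.induct)
    case (step x c t)
    from step(3) obtain s b' where s: "s \<in> T0" "b' \<in> Bas" "t = s * (e * b')" unfolding T_def by auto
    have csL: "c * s \<in> ?L"
      using sringD(4)[OF T0(3)] BL[OF step(2)] lspan_base[OF B(1) s(1)] by blast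
    have "(e * b) * (c * t) = e * (b * (c * s)) * (e * b')" by (simp add: s mult.assoc)
    also have "b * (c * s) = (c * s) * b" using Zc csL LZ that Bas by (metis subsetD)
    also have "e * ((c * s) * b) * (e * b') = (c * s) * (e * b) * (e * b')"
      using Zcomm[OF eZ, of "c * s"] csL LZ by (metis mult.assoc subsetD)
    also have "\<dots> = (c * s) * (e * e * (b * b'))"
      using Zc[OF eZ, of b] that Bas by (metis mult.assoc subsetD)
    also have "\<dots> \<in> ?M"
      by (intro 3 2 csL) (use that s G'_def in auto)
    finally show ?case using step by (auto simp: distrib_left intro: lspan_add)
  qed (auto intro: lspan.zero)
  have 5: "x * y \<in> ?M" if "x \<in> ?M" "y \<in> ?M" for x y
    using that(1)
  proof (induction x rule: lspan.induct)
    case (step x c t)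
    from step(3) obtain s b where s: "s \<in> T0" "b \<in> Bas" "t = s * (e * b)" unfolding T_def by auto
    have csL: "c * s \<in> ?L"
      using sringD(4)[OF T0(3)] BL[OF step(2)] lspan_base[OF B(1) s(1)] by blast
    have "(c * s) * ((e * b) * y) \<in> ?M" by (intro 3 4 csL s that)
    then show ?case using step by (auto simp: distrib_right s mult.assoc intro: lspan_add)
  qed (auto intro: lspan.zero)
  have "e * e \<in> B" "e * e \<noteq> 0" using sringD(4)[OF B(1)] e by auto
  then show ?thesis using T 5 2 unfolding G'_def
    by (intro exI[of _ T] exI[of _ "e * e"]) auto
qed

subsection \<open>Norms on lattices\<close>

text \<open>\<open>N_ge1\<close> makes \<open>B\<close> discrete, which later turns convergence with
  bounded denominators into eventual equality.\<close>

locale valued_ring =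
  fixes B :: "'a::division_ring set" and N :: "'a \<Rightarrow> real"
  assumes B: "sring B"
    and comm: "\<And>x y. x \<in> B \<Longrightarrow> y \<in> B \<Longrightarrow> x * y = y * x"
    and N_mult: "\<And>x y. x \<in> B \<Longrightarrow> y \<in> B \<Longrightarrow> N (x * y) = N x * N y"
    and N_add: "\<And>x y. x \<in> B \<Longrightarrow> y \<in> B \<Longrightarrow> N (x + y) \<le> N x + N y"
    and N_zero: "N 0 = 0"
    and N_ge1: "\<And>x. x \<in> B \<Longrightarrow> x \<noteq> 0 \<Longrightarrow> N x \<ge> 1"
begin

lemma N_nonneg: "x \<in> B \<Longrightarrow> N x \<ge> 0"
  using N_ge1[of x] N_zero by (cases "x = 0") auto

lemma N_pos: "x \<in> B \<Longrightarrow> x \<noteq> 0 \<Longrightarrow> N x > 0"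
  using N_ge1[of x] by auto

lemma N_one: "N 1 = 1"
  using N_mult[of 1 1] sringD(2)[OF B] N_ge1[of 1] by simp

lemma N_power: "x \<in> B \<Longrightarrow> N (x ^ n) = N x ^ n"
  by (induction n) (auto simp: N_one N_mult sring_power[OF B])

definition indep :: "'a set \<Rightarrow> bool" where
  "indep T \<longleftrightarrow> (\<forall>c. (\<forall>t\<in>T. c t \<in> B) \<longrightarrow> (\<Sum>t\<in>T. c t * t) = 0 \<longrightarrow> (\<forall>t\<in>T. c t = 0))"

text \<open>For a maximal independent set of generators, each remaining generator satisfies a
  relation in which its own coefficient is nonzero; these coefficients have a common nonzero
  multiple.\<close>

lemma exists_max_indep:
  assumes T: "finite T"
  obtains T0 e where "T0 \<subseteq> T" "indep T0" "e \<in> B" "e \<noteq> 0" "\<And>x. x \<in> lspan B T \<Longrightarrow> e * x \<in> lspan B T0"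
proof -
  let ?F = "{S. S \<subseteq> T \<and> indep S}"
  have fin: "finite ?F" using T by simp
  have "{} \<in> ?F" by (simp add: indep_def)
  then have "?F \<noteq> {}" by (metis empty_iff)
  then obtain T0 where "T0 \<in> ?F" and max: "\<forall>S\<in>?F. T0 \<subseteq> S \<longrightarrow> T0 = S"
    using finite_has_maximal[OF fin] by metis
  then have T0: "T0 \<subseteq> T" "indep T0" by auto
  have fT0: "finite T0" using T T0 finite_subset by blast
  have "\<exists>b\<in>B. b \<noteq> 0 \<and> b * t \<in> lspan B T0" if t: "t \<in> T" for t
  proof (cases "t \<in> T0")
    case True
    then show ?thesis using lspan_base[OF B] sringD(2)[OF B] by (intro bexI[of _ 1]) auto
  next
    case False
    then have "\<not> indep (insert t T0)" using T0(1) max[rule_format, of "insert t T0"] t by auto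
    then obtain c s where c: "\<forall>t\<in>insert t T0. c t \<in> B" "(\<Sum>t\<in>insert t T0. c t * t) = 0"
      "s \<in> insert t T0" "c s \<noteq> 0" unfolding indep_def by blast
    have eq: "c t * t + (\<Sum>t\<in>T0. c t * t) = 0" using c(2) False fT0 by simp
    have "c t \<noteq> 0"
    proof
      assume 0: "c t = 0"
      then have "\<forall>t\<in>T0. c t = 0" using T0(2) eq c(1) unfolding indep_def by simp
      then show False using c(3,4) 0 by auto
    qed
    moreover have "c t * t = - (\<Sum>t\<in>T0. c t * t)" using eq by (simp add: eq_neg_iff_add_eq_0)
    then have "c t * t \<in> lspan B T0"
      using lspan_minus[OF B lspan_sumI[of T0 c B]] c(1) by simp
    ultimately show ?thesis using c(1) by (intro bexI[of _ "c t"]) auto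
  qed
  from common_multiplier[OF B comm T this]
  have "\<exists>b\<in>B. b \<noteq> 0 \<and> (\<forall>t\<in>T. b * t \<in> lspan B T0)"
    using lspan_scale[OF B] by blast
  then obtain e where e: "e \<in> B" "e \<noteq> 0" "\<And>t. t \<in> T \<Longrightarrow> e * t \<in> lspan B T0" by blast
  have "e * x \<in> lspan B T0" if "x \<in> lspan B T" for x
    using that
  proof (induction x rule: lspan.induct)
    case (step x b t)
    have "b * (e * t) \<in> lspan B T0" using lspan_scale[OF B step(2) e(3)[OF step(3)]] .
    then have "e * (b * t) \<in> lspan B T0" using comm[OF step(2) e(1)] by (metis mult.assoc)
    then show ?case using step(4) by (simp add: distrib_left lspan_add)
  qed (auto intro: lspan.zero)
  then show ?thesis using that T0 e by blast
qed

text \<open>The norm sums \<open>N\<close> over the coordinates of \<open>e * x\<close> in an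
  independent set, so homogeneity and the lower bound \<open>1\<close> come from \<open>N\<close>.
  The constant \<open>C\<close> comes from the finitely many products of basis elements.\<close>

lemma exists_norm:
  assumes T: "finite T" and M: "M = lspan B T"
    and Mm: "\<And>x y. x \<in> M \<Longrightarrow> y \<in> M \<Longrightarrow> x * y \<in> M"
    and cen: "\<And>b x. b \<in> B \<Longrightarrow> x \<in> M \<Longrightarrow> b * x = x * b"
  shows "\<exists>nu C. (\<forall>x\<in>M. \<forall>y\<in>M. nu (x + y) \<le> nu x + nu y) \<and> (\<forall>b\<in>B. \<forall>x\<in>M. nu (b * x) = N b * nu x) \<and>
    (\<forall>x\<in>M. x \<noteq> 0 \<longrightarrow> nu x \<ge> 1) \<and> C > (0::real) \<and> (\<forall>x\<in>M. \<forall>y\<in>M. nu (x * y) \<le> C * nu x * nu y)"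
proof -
  obtain T0 e where T0: "T0 \<subseteq> T" "indep T0" and e: "e \<in> B" "e \<noteq> 0" "\<And>x. x \<in> M \<Longrightarrow> e * x \<in> lspan B T0"
    using exists_max_indep[OF T] M by metis
  have fT0: "finite T0" using T T0 finite_subset by blast
  have T0M: "T0 \<subseteq> M" using T0 M lspan_base[OF B] by blast
  have Ms: "b * x \<in> M" if "b \<in> B" "x \<in> M" for b x using lspan_scale[OF B] that M by blast
  have Ma: "x + y \<in> M" if "x \<in> M" "y \<in> M" for x y using lspan_add that M by blast
  \<comment> \<open>Elements of \<open>M\<close> need not lie in the span of \<open>T0\<close>, but
    their multiples by \<open>e\<close> do; independence makes the coordinates unique.\<close>
  define rep where "rep x c \<longleftrightarrow> (\<forall>t\<in>T0. c t \<in> B) \<and> e * x = (\<Sum>t\<in>T0. c t * t)" for x c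
  have uniq: "c t = c' t" if "rep x c" "rep x c'" "t \<in> T0" for x c c' t
  proof -
    have "(\<Sum>t\<in>T0. (c t - c' t) * t) = 0"
      using that unfolding rep_def by (simp add: left_diff_distrib sum_subtractf)
    moreover have "\<forall>t\<in>T0. c t - c' t \<in> B" using that sringD(6)[OF B] unfolding rep_def by simp
    ultimately have "\<forall>t\<in>T0. c t - c' t = 0" using T0(2)[unfolded indep_def, rule_format, of "\<lambda>t. c t - c' t"] by blast
    then show ?thesis using that(3) by simp
  qed
  have ex: "\<exists>c. rep x c" if x: "x \<in> M" for x
    by (rule lspan_finite[OF B fT0 e(3)[OF x]]) (auto simp: rep_def)
  define nu where "nu x = (\<Sum>t\<in>T0. N ((SOME c. rep x c) t))" for x
  have nu: "nu x = (\<Sum>t\<in>T0. N (c t))" if "rep x c" for x c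
    unfolding nu_def
    by (rule sum.cong) (use uniq[OF someI[of "rep x", OF that] that] in auto)
  have nu_nn: "nu x \<ge> 0" if x: "x \<in> M" for x
  proof -
    obtain c where c: "rep x c" using ex[OF x] by blast
    show ?thesis unfolding nu[OF c] by (rule sum_nonneg) (use c N_nonneg rep_def in auto)
  qed
  have 1: "nu (x + y) \<le> nu x + nu y" if xy: "x \<in> M" "y \<in> M" for x y
  proof -
    obtain c c' where c: "rep x c" "rep y c'" using ex xy by meson
    have r: "rep (x + y) (\<lambda>t. c t + c' t)"
      using c sringD(3)[OF B] unfolding rep_def by (simp add: distrib_left distrib_right sum.distrib)
    show ?thesis unfolding nu[OF c(1)] nu[OF c(2)] nu[OF r] sum.distrib[symmetric]
      by (rule sum_mono, rule N_add) (use c rep_def in auto)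
  qed
  have 2: "nu (b * x) = N b * nu x" if bx: "b \<in> B" "x \<in> M" for b x
  proof -
    obtain c where c: "rep x c" using ex bx by meson
    have "e * (b * x) = b * (e * x)" using comm[OF e(1) bx(1)] by (metis mult.assoc)
    then have r: "rep (b * x) (\<lambda>t. b * c t)"
      using c sringD(4)[OF B bx(1)] unfolding rep_def by (simp add: sum_distrib_left mult.assoc)
    show ?thesis unfolding nu[OF c(1)] nu[OF r] sum_distrib_left
      by (rule sum.cong) (use c rep_def N_mult bx(1) in auto)
  qed
  have 3: "nu x \<ge> 1" if x: "x \<in> M" "x \<noteq> 0" for x
  proof -
    obtain c where c: "rep x c" using ex x by meson
    have "e * x \<noteq> 0" using e x by simp
    then have "\<exists>t\<in>T0. c t * t \<noteq> 0"
      using c sum.neutral[of T0 "\<lambda>t. c t * t"] unfolding rep_def by auto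
    then obtain t where t: "t \<in> T0" "c t \<noteq> 0" by auto
    have cB: "c s \<in> B" if "s \<in> T0" for s using c that unfolding rep_def by blast
    have "1 \<le> N (c t)" using N_ge1[OF cB[OF t(1)] t(2)] .
    also have "\<dots> \<le> (\<Sum>t\<in>T0. N (c t))"
      by (rule member_le_sum[OF t(1) _ fT0]) (use N_nonneg cB in auto)
    finally show ?thesis unfolding nu[OF c] .
  qed
  define C where "C = 1 + (\<Sum>s\<in>T0. \<Sum>t\<in>T0. nu (s * t))"
  have sM: "s * t \<in> M" if "s \<in> T0" "t \<in> T0" for s t using Mm T0M that by blast
  have nu_sum: "nu (sum f S) \<le> (\<Sum>i\<in>S. nu (f i))" if "finite S" "\<And>i. i \<in> S \<Longrightarrow> f i \<in> M" for f and S :: "'a set"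
    using that
  proof (induction S rule: finite_induct)
    case empty
    have "0 \<in> M" using M lspan.zero by blast
    then have "nu 0 = 0" using 2[of 0 0] sringD(1)[OF B] N_zero by simp
    then show ?case by simp
  next
    case (insert i S)
    have "sum f S \<in> M" unfolding M by (rule lspan_sum) (use insert M in auto)
    then show ?case using 1[of "f i" "sum f S"] insert by simp
  qed
  have 4: "nu (x * y) \<le> C * nu x * nu y" if xy: "x \<in> M" "y \<in> M" for x y
  proof -
    obtain c c' where c: "rep x c" "rep y c'" using ex xy by meson
    have cB: "c s \<in> B" "c' s \<in> B" if "s \<in> T0" for s using c that unfolding rep_def by blast+
    have NN: "N (c s) \<le> nu x" "N (c' s) \<le> nu y" if "s \<in> T0" for s
      unfolding nu[OF c(1)] nu[OF c(2)]
      by (rule member_le_sum[OF that _ fT0]; use N_nonneg cB in auto)+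
    have "(e * x) * (e * y) = e * e * (x * y)"
      using cen[OF e(1) xy(1)] by (metis mult.assoc)
    moreover have "(e * x) * (e * y) = (\<Sum>s\<in>T0. \<Sum>t\<in>T0. (c s * c' t) * (s * t))"
    proof -
      have "(e * x) * (e * y) = (\<Sum>s\<in>T0. \<Sum>t\<in>T0. (c s * s) * (c' t * t))"
        using c unfolding rep_def by (simp add: sum_product)
      also have "\<dots> = (\<Sum>s\<in>T0. \<Sum>t\<in>T0. (c s * c' t) * (s * t))"
      proof (intro sum.cong refl)
        fix s t assume st: "s \<in> T0" "t \<in> T0"
        have "c' t * s = s * c' t" using cen cB st T0M by blast
        then show "(c s * s) * (c' t * t) = (c s * c' t) * (s * t)" by (metis mult.assoc)
      qed
      finally show ?thesis .
    qed
    ultimately have eq: "e * e * (x * y) = (\<Sum>s\<in>T0. \<Sum>t\<in>T0. (c s * c' t) * (s * t))" by simp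
    have inM: "(c s * c' t) * (s * t) \<in> M" if "s \<in> T0" "t \<in> T0" for s t
      using Ms sM that cB sringD(4)[OF B] by blast
    have eM: "e * e \<in> B" using sringD(4)[OF B] e by blast
    have ee: "1 \<le> N (e * e)" using N_ge1[OF eM] e by simp
    \<comment> \<open>The coordinates compute \<open>e * e * (x * y)\<close>; the scalar may be
      dropped because \<open>N (e * e)\<close> is at least \<open>1\<close>.\<close>
    have "nu (x * y) \<le> N (e * e) * nu (x * y)"
      using mult_right_mono[OF ee nu_nn[OF Mm[OF xy]]] by simp
    also have "\<dots> = nu (\<Sum>s\<in>T0. \<Sum>t\<in>T0. (c s * c' t) * (s * t))"
      using 2[OF eM Mm[OF xy]] eq by simp
    also have "\<dots> \<le> (\<Sum>s\<in>T0. nu (\<Sum>t\<in>T0. (c s * c' t) * (s * t)))"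
    proof (rule nu_sum[OF fT0])
      fix s assume s: "s \<in> T0"
      show "(\<Sum>t\<in>T0. (c s * c' t) * (s * t)) \<in> M" unfolding M
        by (rule lspan_sum) (use inM[OF s] M in simp)
    qed
    also have "\<dots> \<le> (\<Sum>s\<in>T0. \<Sum>t\<in>T0. nu ((c s * c' t) * (s * t)))"
      by (rule sum_mono, rule nu_sum[OF fT0], rule inM)
    also have "\<dots> \<le> (\<Sum>s\<in>T0. \<Sum>t\<in>T0. nu x * nu y * nu (s * t))"
    proof (intro sum_mono)
      fix s t assume st: "s \<in> T0" "t \<in> T0"
      have "nu ((c s * c' t) * (s * t)) = N (c s) * N (c' t) * nu (s * t)"
        using 2[OF sringD(4)[OF B cB(1)[OF st(1)] cB(2)[OF st(2)]] sM[OF st]] N_mult cB st by simp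
      also have "\<dots> \<le> nu x * nu y * nu (s * t)"
        by (intro mult_mono NN st nu_nn sM N_nonneg cB mult_nonneg_nonneg) (use xy in auto)
      finally show "nu ((c s * c' t) * (s * t)) \<le> nu x * nu y * nu (s * t)" .
    qed
    also have "\<dots> = (C - 1) * nu x * nu y" unfolding C_def
      by (simp add: sum_distrib_left sum_distrib_right mult_ac)
    also have "\<dots> \<le> C * nu x * nu y"
      using mult_nonneg_nonneg[OF nu_nn[OF xy(1)] nu_nn[OF xy(2)]] by (simp add: algebra_simps)
    finally show ?thesis .
  qed
  have "C > 0" unfolding C_def
    using sum_nonneg[of T0 "\<lambda>s. \<Sum>t\<in>T0. nu (s * t)"] sum_nonneg[of T0] nu_nn sM
    by (smt (verit, best))
  then show ?thesis using 1 2 3 4 by (intro exI[of _ nu] exI[of _ C]) simp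
qed

end

subsection \<open>Iterated conjugation and limits\<close>

primrec conj_iter :: "'a::division_ring \<Rightarrow> nat \<Rightarrow> 'a \<Rightarrow> 'a" where
  "conj_iter h 0 x = x"
| "conj_iter h (Suc k) x = conj_iter h k x * h * inverse (conj_iter h k x)"

text \<open>With this sign, \<open>x * h * inverse x - h = ad h x * inverse x\<close> for
  \<open>x \<noteq> 0\<close>.\<close>

definition ad :: "'a::division_ring \<Rightarrow> 'a \<Rightarrow> 'a" where
  "ad h x = x * h - h * x"

lemma conj_iter_nonzero: "h \<noteq> 0 \<Longrightarrow> x \<noteq> 0 \<Longrightarrow> conj_iter h k x \<noteq> 0"
  by (induction k) auto

lemma inverse_conj_iter_Suc:
  assumes "h \<noteq> 0" "x \<noteq> 0"
  shows "inverse (conj_iter h (Suc k) x) = conj_iter h k x * inverse h * inverse (conj_iter h k x)"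
  using conj_iter_nonzero[OF assms, of k] assms by (simp add: nonzero_inverse_mult_distrib mult.assoc)

lemma commute_inverse:
  assumes "x * y = y * (x::'a::division_ring)" shows "x * inverse y = inverse y * x"
proof (cases "y = 0")
  case False
  have "x * inverse y = inverse y * (y * x) * inverse y" using False by (simp add: mult.assoc[symmetric])
  also have "\<dots> = inverse y * x * (y * inverse y)" by (simp only: assms[symmetric] mult.assoc)
  finally show ?thesis using False by simp
qed simp

text \<open>For \<open>g = - (s * \<beta>)\<close> the relation of \<open>\<beta>\<close> becomes
  \<open>P(g) = 0\<close> with \<open>P\<close> monic and all lower coefficients divisible by
  \<open>s\<close>. Since \<open>1 - g\<close> divides \<open>P(1) - P(g)\<close>, it divides
  \<open>P(1)\<close>, which is \<open>1\<close> modulo \<open>s\<close>.\<close>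

lemma one_plus_factor:
  assumes B: "sring B" and comm: "\<And>x y. x \<in> B \<Longrightarrow> y \<in> B \<Longrightarrow> x * y = y * x"
    and c: "\<And>i. i < d \<Longrightarrow> c i \<in> B" "\<beta> ^ d = (\<Sum>i<d. c i * \<beta> ^ i)"
    and s: "s \<in> B" and cen: "\<And>b. b \<in> B \<Longrightarrow> b * \<beta> = \<beta> * b"
  obtains r f where "r \<in> B" "\<And>j. j < d \<Longrightarrow> f j \<in> B" "(1 + s * \<beta>) * (\<Sum>j<d. f j * \<beta> ^ j) = 1 + s * r"
proof -
  define g where "g = - (s * \<beta>)"
  have sm: "- s \<in> B" using sringD(5)[OF B s] .
  have gpow: "g ^ j = (- s) ^ j * \<beta> ^ j" for j
  proof (induction j)
    case (Suc j)
    have "\<beta> * (- s) ^ j = (- s) ^ j * \<beta>" using cen sring_power[OF B sm] by metis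
    then show ?case using Suc by (simp add: g_def mult.assoc) (metis mult.assoc)
  qed simp
  have cg: "b * g = g * b" if "b \<in> B" for b
    using cen[OF that] comm[OF that s] unfolding g_def by (simp add: mult.assoc) (metis mult.assoc)
  define k where "k i = c i * (- s) ^ (d - i)" for i
  have kB: "k i \<in> B" if "i < d" for i
    unfolding k_def using sringD(4)[OF B c(1)[OF that]] sring_power[OF B sm] by blast
  have gd: "g ^ d = (\<Sum>i<d. k i * g ^ i)"
  proof -
    have "g ^ d = (\<Sum>i<d. (- s) ^ d * (c i * \<beta> ^ i))" by (simp add: gpow c(2) sum_distrib_left)
    also have "\<dots> = (\<Sum>i<d. k i * g ^ i)"
    proof (rule sum.cong)
      fix i assume i: "i \<in> {..<d}"
      have "(- s) ^ d * c i = c i * (- s) ^ d" using comm c(1) i sring_power[OF B sm] by auto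
      moreover have "(- s) ^ d = (- s) ^ (d - i) * (- s) ^ i" using i by (simp flip: power_add)
      ultimately show "(- s) ^ d * (c i * \<beta> ^ i) = k i * g ^ i"
        by (simp add: k_def gpow mult.assoc[symmetric])
    qed simp
    finally show ?thesis .
  qed
  have geo: "(1 - g) * (\<Sum>j<n. g ^ j) = 1 - g ^ n" for n
  proof (induction n)
    case (Suc n)
    have "(1 - g) * (\<Sum>j<Suc n. g ^ j) = (1 - g) * (\<Sum>j<n. g ^ j) + (1 - g) * g ^ n"
      by (simp add: distrib_left)
    also have "\<dots> = 1 - g ^ Suc n" by (simp only: Suc) (simp add: left_diff_distrib)
    finally show ?case .
  qed simp
  \<comment> \<open>The coefficients of \<open>(P(1) - P(X)) / (1 - X)\<close>: when each
    \<open>1 - X ^ i\<close> is divided by \<open>1 - X\<close>, the power \<open>X ^ j\<close>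
    occurs exactly for \<open>j < i\<close>.\<close>
  define f' where "f' j = 1 - (\<Sum>i\<in>{i. i < d \<and> j < i}. k i)" for j
  have f'B: "f' j \<in> B" for j
    unfolding f'_def by (intro sringD(6)[OF B] sringD(2)[OF B] sring_sum[OF B]) (use kB in auto)
  have sw: "(\<Sum>i<d. k i * (\<Sum>j<i. g ^ j)) = (\<Sum>j<d. (\<Sum>i\<in>{i. i < d \<and> j < i}. k i) * g ^ j)"
  proof -
    have "(\<Sum>i<d. k i * (\<Sum>j<i. g ^ j)) = (\<Sum>i<d. \<Sum>j\<in>{j. j < d \<and> j < i}. k i * g ^ j)"
      unfolding sum_distrib_left by (intro sum.cong) auto
    also have "\<dots> = (\<Sum>j<d. \<Sum>i\<in>{i. i < d \<and> j < i}. k i * g ^ j)"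
      using sum.swap_restrict[of "{..<d}" "{..<d}" "\<lambda>i j. k i * g ^ j" "\<lambda>i j. j < i"] by simp
    finally show ?thesis by (simp add: sum_distrib_right)
  qed
  have "(1 - g) * (\<Sum>j<d. f' j * g ^ j) = (1 - g) * ((\<Sum>j<d. g ^ j) - (\<Sum>i<d. k i * (\<Sum>j<i. g ^ j)))"
    unfolding sw f'_def by (simp add: left_diff_distrib sum_subtractf)
  also have "\<dots> = (1 - g ^ d) - (\<Sum>i<d. k i * ((1 - g) * (\<Sum>j<i. g ^ j)))"
  proof -
    have "(1 - g) * (k i * y) = k i * ((1 - g) * y)" if "i < d" for i y
      using cg[OF kB[OF that]] by (simp add: left_diff_distrib right_diff_distrib) (metis mult.assoc)
    then have "(\<Sum>i<d. (1 - g) * (k i * (\<Sum>j<i. g ^ j))) = (\<Sum>i<d. k i * ((1 - g) * (\<Sum>j<i. g ^ j)))"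
      by (intro sum.cong) auto
    then have "(1 - g) * (\<Sum>i<d. k i * (\<Sum>j<i. g ^ j)) = (\<Sum>i<d. k i * ((1 - g) * (\<Sum>j<i. g ^ j)))"
      by (simp only: sum_distrib_left[of "1 - g" "\<lambda>i. k i * (\<Sum>j<i. g ^ j)"])
    then show ?thesis by (simp only: right_diff_distrib[of "1 - g"] geo)
  qed
  also have "\<dots> = 1 - (\<Sum>i<d. k i)"
    unfolding geo by (simp add: gd right_diff_distrib sum_subtractf)
  finally have fin: "(1 - g) * (\<Sum>j<d. f' j * g ^ j) = 1 - (\<Sum>i<d. k i)" .
  \<comment> \<open>One factor \<open>- s\<close> is taken out of each \<open>k i\<close>; the
    exponent \<open>d - i\<close> is positive.\<close>
  define r where "r = (\<Sum>i<d. c i * (- s) ^ (d - i - 1))"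
  have "(\<Sum>i<d. k i) = (\<Sum>i<d. - s * (c i * (- s) ^ (d - i - 1)))"
  proof (rule sum.cong)
    fix i assume i: "i \<in> {..<d}"
    then have "(- s) ^ (d - i) = - s * (- s) ^ (d - i - 1)"
      by (metis Suc_diff_Suc diff_Suc_1 lessThan_iff power_Suc)
    moreover have "c i * (- s) = - s * c i" using comm[OF c(1) sm] i by simp
    ultimately show "k i = - s * (c i * (- s) ^ (d - i - 1))" unfolding k_def by (metis mult.assoc)
  qed simp
  then have sumk: "(\<Sum>i<d. k i) = - (s * r)" by (simp add: r_def sum_distrib_left sum_negf)
  have rB: "r \<in> B" unfolding r_def
    by (intro sring_sum[OF B] sringD(4)[OF B] sring_power[OF B sm] c(1)) auto
  have "(1 + s * \<beta>) * (\<Sum>j<d. (f' j * (- s) ^ j) * \<beta> ^ j) = 1 + s * r"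
    using fin unfolding sumk by (simp add: g_def gpow[unfolded g_def] mult.assoc)
  then show ?thesis
    using that[OF rB, of "\<lambda>j. f' j * (- s) ^ j"] f'B sringD(4)[OF B] sring_power[OF B sm] by blast
qed

text \<open>The data supplied by \<open>exists_order\<close> and \<open>exists_norm\<close>. These
  do not put \<open>1\<close> into \<open>M\<close>, so arguments involving \<open>1\<close> take
  place in the localization \<open>Dq\<close>.\<close>

locale normed_order = valued_ring +
  fixes M :: "'a set" and nu :: "'a \<Rightarrow> real" and C :: real
  assumes M_zero: "0 \<in> M" and M_add: "\<And>x y. x \<in> M \<Longrightarrow> y \<in> M \<Longrightarrow> x + y \<in> M"
    and M_mult: "\<And>x y. x \<in> M \<Longrightarrow> y \<in> M \<Longrightarrow> x * y \<in> M"
    and M_scale: "\<And>b x. b \<in> B \<Longrightarrow> x \<in> M \<Longrightarrow> b * x \<in> M"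
    and M_central: "\<And>b x. b \<in> B \<Longrightarrow> x \<in> M \<Longrightarrow> b * x = x * b"
    and nu_add: "\<And>x y. x \<in> M \<Longrightarrow> y \<in> M \<Longrightarrow> nu (x + y) \<le> nu x + nu y"
    and nu_scale: "\<And>b x. b \<in> B \<Longrightarrow> x \<in> M \<Longrightarrow> nu (b * x) = N b * nu x"
    and nu_ge1: "\<And>x. x \<in> M \<Longrightarrow> x \<noteq> 0 \<Longrightarrow> nu x \<ge> 1"
    and C_pos: "C > 0"
    and nu_mult: "\<And>x y. x \<in> M \<Longrightarrow> y \<in> M \<Longrightarrow> nu (x * y) \<le> C * nu x * nu y"
begin

section \<open>Localization of the lattice and its norm\<close>

lemma M_diff: "x \<in> M \<Longrightarrow> y \<in> M \<Longrightarrow> x - y \<in> M"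
  using M_add[of x "-1 * y"] M_scale[of "-1" y] sringD(5)[OF B sringD(2)[OF B]] by simp

text \<open>The localization of \<open>M\<close> at the nonzero elements of \<open>B\<close>,
  realized inside the division ring.\<close>

definition Dq :: "'a set" where
  "Dq = {d. \<exists>b\<in>B. b \<noteq> 0 \<and> b * d \<in> M}"

text \<open>The denominator is arbitrary; \<open>nm_eq\<close> shows that its choice does not matter
  on \<open>Dq\<close>.\<close>

definition nm :: "'a \<Rightarrow> real" where
  "nm d = (let b = (SOME b. b \<in> B \<and> b \<noteq> 0 \<and> b * d \<in> M) in nu (b * d) / N b)"

lemma DqI: "b \<in> B \<Longrightarrow> b \<noteq> 0 \<Longrightarrow> b * d \<in> M \<Longrightarrow> d \<in> Dq"
  unfolding Dq_def by blast

lemma DqE: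
  assumes "d \<in> Dq" obtains b where "b \<in> B" "b \<noteq> 0" "b * d \<in> M"
  using assms unfolding Dq_def by blast

lemma Dq_central: assumes "b \<in> B" "d \<in> Dq" shows "b * d = d * b"
proof -
  obtain c where c: "c \<in> B" "c \<noteq> 0" "c * d \<in> M" using DqE[OF assms(2)] .
  have "c * (b * d) = b * (c * d)" using comm[OF c(1) assms(1)] by (metis mult.assoc)
  also have "\<dots> = c * (d * b)" using M_central[OF assms(1) c(3)] by (simp add: mult.assoc)
  finally show ?thesis using c(2) by simp
qed

lemma nm_eq:
  assumes b: "b \<in> B" "b \<noteq> 0" "b * d \<in> M"
  shows "nm d = nu (b * d) / N b"
proof -
  define c where "c = (SOME b. b \<in> B \<and> b \<noteq> 0 \<and> b * d \<in> M)"
  have c: "c \<in> B \<and> c \<noteq> 0 \<and> c * d \<in> M"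
    unfolding c_def by (rule someI[of _ b]) (use b in simp)
  have "N b * nu (c * d) = nu (b * (c * d))" using nu_scale[of b "c * d"] b c by simp
  also have "b * (c * d) = c * (b * d)" using comm[of b c] b c by (metis mult.assoc)
  also have "nu \<dots> = N c * nu (b * d)" using nu_scale[of c "b * d"] b c by simp
  finally have "nu (c * d) / N c = nu (b * d) / N b"
    using N_pos[of b] N_pos[of c] b c by (simp add: field_simps)
  then show ?thesis unfolding nm_def c_def[symmetric] by (simp add: Let_def)
qed

lemma common_denom:
  assumes "d \<in> Dq" "d' \<in> Dq"
  obtains b where "b \<in> B" "b \<noteq> 0" "b * d \<in> M" "b * d' \<in> M"
proof -
  obtain b c where b: "b \<in> B" "b \<noteq> 0" "b * d \<in> M" and c: "c \<in> B" "c \<noteq> 0" "c * d' \<in> M"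
    using DqE assms by metis
  have "b * c * d = c * (b * d)" using comm[OF b(1) c(1)] by (simp add: mult.assoc[symmetric])
  then have "b * c * d \<in> M" using M_scale[OF c(1) b(3)] by simp
  moreover have "b * c * d' \<in> M" using M_scale[OF b(1) c(3)] by (simp add: mult.assoc)
  moreover have "b * c \<in> B" "b * c \<noteq> 0" using b c sringD(4)[OF B] by auto
  ultimately show ?thesis using that by blast
qed

lemma Dq_M: "x \<in> M \<Longrightarrow> x \<in> Dq"
  using DqI[of 1] sringD(2)[OF B] by simp

lemma nm_M: "x \<in> M \<Longrightarrow> nm x = nu x"
  using nm_eq[of 1 x] sringD(2)[OF B] N_one by simp

lemma Dq_add: assumes "d \<in> Dq" "d' \<in> Dq"
  shows "d + d' \<in> Dq" "nm (d + d') \<le> nm d + nm d'"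
proof -
  obtain b where b: "b \<in> B" "b \<noteq> 0" "b * d \<in> M" "b * d' \<in> M" using common_denom[OF assms] .
  have s: "b * (d + d') \<in> M" using M_add[OF b(3,4)] by (simp add: distrib_left)
  show "d + d' \<in> Dq" using DqI[OF b(1,2) s] .
  show "nm (d + d') \<le> nm d + nm d'"
    unfolding nm_eq[OF b(1,2) s] nm_eq[OF b(1,2,3)] nm_eq[OF b(1,2,4)]
    using nu_add[OF b(3,4)] N_pos[OF b(1,2)]
    by (simp add: distrib_left divide_right_mono flip: add_divide_distrib)
qed

lemma Dq_mult: assumes "d \<in> Dq" "d' \<in> Dq"
  shows "d * d' \<in> Dq" "nm (d * d') \<le> C * nm d * nm d'"
proof -
  obtain b where b: "b \<in> B" "b \<noteq> 0" "b * d \<in> M" "b * d' \<in> M" using common_denom[OF assms] .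
  have eq: "b * b * (d * d') = (b * d) * (b * d')"
    using Dq_central[OF b(1) assms(1)] by (metis mult.assoc)
  have s: "b * b * (d * d') \<in> M" using M_mult[OF b(3,4)] eq by simp
  have bb: "b * b \<in> B" "b * b \<noteq> 0" using b sringD(4)[OF B] by auto
  show "d * d' \<in> Dq" using DqI[OF bb s] .
  show "nm (d * d') \<le> C * nm d * nm d'"
    unfolding nm_eq[OF bb s] nm_eq[OF b(1,2,3)] nm_eq[OF b(1,2,4)] eq
    using nu_mult[OF b(3,4)] N_pos[OF b(1,2)] N_mult[OF b(1,1)]
    by (simp add: divide_right_mono)
qed

lemma Dq_B: "b \<in> B \<Longrightarrow> d \<in> Dq \<Longrightarrow> b * d \<in> Dq" and nm_scale: "b \<in> B \<Longrightarrow> d \<in> Dq \<Longrightarrow> nm (b * d) = N b * nm d"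
proof -
  assume b: "b \<in> B" and d: "d \<in> Dq"
  obtain c where c: "c \<in> B" "c \<noteq> 0" "c * d \<in> M" using DqE[OF d] .
  have eq: "c * (b * d) = b * (c * d)" using comm[OF c(1) b] by (metis mult.assoc)
  then have s: "c * (b * d) \<in> M" using M_scale[OF b c(3)] by simp
  show "b * d \<in> Dq" using DqI[OF c(1,2) s] .
  show "nm (b * d) = N b * nm d"
    unfolding nm_eq[OF c(1,2) s] nm_eq[OF c] unfolding eq using nu_scale[OF b c(3)] by simp
qed

lemma N_minus_one: "N (- 1) = 1"
proof -
  have m: "- 1 \<in> B" using sringD(5)[OF B sringD(2)[OF B]] .
  have "N (-1) * N (-1) = 1" using N_mult[OF m m] N_one by simp
  then show ?thesis using N_nonneg[OF m] by (simp add: power2_eq_square[symmetric] power2_eq_1_iff)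
qed

lemma Dq_minus: "d \<in> Dq \<Longrightarrow> - d \<in> Dq" and nm_minus: "d \<in> Dq \<Longrightarrow> nm (- d) = nm d"
  using Dq_B[of "-1" d] nm_scale[of "-1" d] sringD(5)[OF B sringD(2)[OF B]] N_minus_one by auto

lemma Dq_diff: "d \<in> Dq \<Longrightarrow> d' \<in> Dq \<Longrightarrow> d - d' \<in> Dq"
  using Dq_add(1)[of d "- d'"] Dq_minus by simp

lemma nu_zero: "nu 0 = 0"
  using nu_scale[of 0 0] sringD(1)[OF B] M_zero N_zero by simp

lemma nm_nonneg: assumes "d \<in> Dq" shows "nm d \<ge> 0"
proof -
  obtain c where c: "c \<in> B" "c \<noteq> 0" "c * d \<in> M" using DqE[OF assms] .
  have "nu (c * d) \<ge> 0" using nu_ge1[OF c(3)] nu_zero by (cases "c * d = 0") auto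
  then show ?thesis unfolding nm_eq[OF c] using N_pos[OF c(1,2)] by simp
qed

lemma nm_zeroD: assumes "d \<in> Dq" "nm d = 0" shows "d = 0"
proof -
  obtain c where c: "c \<in> B" "c \<noteq> 0" "c * d \<in> M" using DqE[OF assms(1)] .
  have "nu (c * d) = 0" using assms(2) unfolding nm_eq[OF c] using N_pos[OF c(1,2)] by simp
  then have "c * d = 0" using nu_ge1[OF c(3)] by fastforce
  then show ?thesis using c by simp
qed

lemma nm_zero: "nm 0 = 0"
  using nm_M[OF M_zero] nu_zero by simp

text \<open>Membership in \<open>Dq\<close> is built in because \<open>nm\<close> is meaningful only
  there.\<close>

definition conv :: "(nat \<Rightarrow> 'a) \<Rightarrow> 'a \<Rightarrow> bool" where
  "conv f l \<longleftrightarrow> (\<forall>n. f n \<in> Dq) \<and> l \<in> Dq \<and> (\<lambda>n. nm (f n - l)) \<longlonglongrightarrow> 0"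

lemma convI:
  assumes "\<And>n. f n \<in> Dq" "l \<in> Dq" "\<And>n. nm (f n - l) \<le> g n" "g \<longlonglongrightarrow> 0"
  shows "conv f l"
  unfolding conv_def
proof (intro conjI allI assms(1,2))
  show "(\<lambda>n. nm (f n - l)) \<longlonglongrightarrow> 0"
    by (rule tendsto_sandwich[of "\<lambda>_. 0" _ _ g])
      (use assms nm_nonneg Dq_diff in \<open>auto intro!: always_eventually\<close>)
qed

section \<open>Limits and iterated conjugation\<close>

lemma conv_const: "l \<in> Dq \<Longrightarrow> conv (\<lambda>_. l) l"
  unfolding conv_def by (simp add: nm_zero)

lemma conv_add: assumes "conv f l" "conv g k" shows "conv (\<lambda>n. f n + g n) (l + k)"
proof (rule convI)
  have m: "f n \<in> Dq" "g n \<in> Dq" "l \<in> Dq" "k \<in> Dq" for n using assms unfolding conv_def by auto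
  show "f n + g n \<in> Dq" "l + k \<in> Dq" for n using Dq_add m by auto
  show "nm (f n + g n - (l + k)) \<le> nm (f n - l) + nm (g n - k)" for n
    using Dq_add(2)[of "f n - l" "g n - k"] Dq_diff m by (simp add: algebra_simps)
  show "(\<lambda>n. nm (f n - l) + nm (g n - k)) \<longlonglongrightarrow> 0"
    using assms unfolding conv_def by (auto intro: tendsto_add_zero)
qed

lemma conv_mult: assumes "conv f l" "conv g k" shows "conv (\<lambda>n. f n * g n) (l * k)"
proof (rule convI)
  have m: "f n \<in> Dq" "g n \<in> Dq" "l \<in> Dq" "k \<in> Dq" for n using assms unfolding conv_def by auto
  have md: "f n - l \<in> Dq" "g n - k \<in> Dq" for n using Dq_diff m by auto
  show "f n * g n \<in> Dq" "l * k \<in> Dq" for n using Dq_mult m by auto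
  show "nm (f n * g n - l * k) \<le> C * nm (f n - l) * nm (g n - k) + C * nm (f n - l) * nm k + C * nm l * nm (g n - k)" for n
  proof -
    have "f n * g n - l * k = (f n - l) * (g n - k) + (f n - l) * k + l * (g n - k)"
      by (simp add: algebra_simps)
    then have "nm (f n * g n - l * k) \<le> nm ((f n - l) * (g n - k) + (f n - l) * k) + nm (l * (g n - k))"
      using Dq_add Dq_mult md m by simp
    also have "nm ((f n - l) * (g n - k) + (f n - l) * k) \<le> nm ((f n - l) * (g n - k)) + nm ((f n - l) * k)"
      using Dq_add Dq_mult md m by simp
    finally show ?thesis
      using Dq_mult(2)[OF md(1) md(2), of n n] Dq_mult(2)[OF md(1) m(4), of n] Dq_mult(2)[OF m(3) md(2), of n] by simp
  qed
  have t: "(\<lambda>n. nm (f n - l)) \<longlonglongrightarrow> 0" "(\<lambda>n. nm (g n - k)) \<longlonglongrightarrow> 0" using assms unfolding conv_def by auto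
  show "(\<lambda>n. C * nm (f n - l) * nm (g n - k) + C * nm (f n - l) * nm k + C * nm l * nm (g n - k)) \<longlonglongrightarrow> 0"
  proof -
    have "(\<lambda>n. C * nm (f n - l) * nm (g n - k) + C * nm (f n - l) * nm k + C * nm l * nm (g n - k))
        \<longlonglongrightarrow> C * 0 * 0 + C * 0 * nm k + C * nm l * 0"
      by (intro tendsto_add tendsto_mult tendsto_const t)
    then show ?thesis by simp
  qed
qed

lemma conv_minus: assumes "conv f l" shows "conv (\<lambda>n. - f n) (- l)"
proof (rule convI)
  have m: "f n \<in> Dq" "l \<in> Dq" for n using assms unfolding conv_def by auto
  show "- f n \<in> Dq" "- l \<in> Dq" for n using Dq_minus m by auto
  show "nm (- f n - - l) \<le> nm (f n - l)" for n
    using nm_minus[OF Dq_diff[OF m(1) m(2)], of n] by simp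
  show "(\<lambda>n. nm (f n - l)) \<longlonglongrightarrow> 0" using assms unfolding conv_def by auto
qed

lemma conv_diff: "conv f l \<Longrightarrow> conv g k \<Longrightarrow> conv (\<lambda>n. f n - g n) (l - k)"
  using conv_add[OF _ conv_minus, of f l g k] by simp

lemma conv_eventually_const:
  assumes "conv f l" "\<forall>\<^sub>F n in sequentially. f n = k" shows "k = l"
proof -
  have m: "f n \<in> Dq" "l \<in> Dq" for n using assms unfolding conv_def by auto
  obtain n where "f n = k" using assms(2) unfolding eventually_sequentially by blast
  then have kD: "k \<in> Dq" using m(1)[of n] by simp
  have "(\<lambda>n. nm (f n - l)) \<longlonglongrightarrow> nm (k - l)"
    by (rule tendsto_eventually) (use assms(2) in eventually_elim, simp)
  moreover have "(\<lambda>n. nm (f n - l)) \<longlonglongrightarrow> 0" using assms(1) unfolding conv_def by auto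
  ultimately have "nm (k - l) = 0" using LIMSEQ_unique by blast
  then show ?thesis using nm_zeroD[OF Dq_diff[OF kD m(2)]] by simp
qed

text \<open>For \<open>x = a + t\<close> one has
  \<open>x * g * inverse x = g + ad g a * inverse x\<close>. Afterwards
  \<open>t * (y * h * inverse y - h) = ad h (t * (y - h)) * inverse y\<close>, so each step applies
  \<open>ad h\<close> to the limit of \<open>t * (y - h)\<close> and appends a factor
  \<open>inverse h\<close>.\<close>

lemma conv_conj_iter:
  assumes a: "a \<in> Dq" and h: "h \<in> Dq" "inverse h \<in> Dq" "h \<noteq> 0"
    and t: "\<And>n. t n \<in> B" and x: "\<And>n. a + t n \<noteq> 0"
    and lim: "conv (\<lambda>n. inverse (a + t n)) 0" "conv (\<lambda>n. t n * inverse (a + t n)) 1"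
  shows "conv (\<lambda>n. conj_iter h (Suc k) (a + t n)) h \<and>
    conv (\<lambda>n. inverse (conj_iter h (Suc k) (a + t n))) (inverse h) \<and>
    conv (\<lambda>n. t n * (conj_iter h (Suc k) (a + t n) - h)) ((ad h ^^ Suc k) a * inverse h ^ k)"
proof (induction k)
  case 0
  have conj: "(a + t n) * g * inverse (a + t n) = g + ad g a * inverse (a + t n)" if "g \<in> Dq" for n g
  proof -
    have "(a + t n) * g = g * (a + t n) + ad g a"
      using Dq_central[OF t[of n] that] by (simp add: ad_def algebra_simps)
    then have "(a + t n) * g * inverse (a + t n) = g * ((a + t n) * inverse (a + t n)) + ad g a * inverse (a + t n)"
      by (simp add: distrib_right mult.assoc)
    then show ?thesis using x by simp
  qed
  have adD: "ad g a \<in> Dq" if "g \<in> Dq" for g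
    unfolding ad_def using Dq_diff Dq_mult a that by simp
  have c: "conv (\<lambda>n. (a + t n) * g * inverse (a + t n)) g" if "g \<in> Dq" for g
    using conv_add[OF conv_const[OF that] conv_mult[OF conv_const[OF adD[OF that]] lim(1)]]
    by (simp add: conj[OF that])
  have "conv (\<lambda>n. ad h a * (t n * inverse (a + t n))) (ad h a)"
    using conv_mult[OF conv_const[OF adD[OF h(1)]] lim(2)] by simp
  moreover have "ad h a * (t n * inverse (a + t n)) = t n * ((a + t n) * h * inverse (a + t n) - h)" for n
    using Dq_central[OF t[of n] adD[OF h(1)]] by (simp add: conj[OF h(1)] mult.assoc[symmetric])
  ultimately have "conv (\<lambda>n. t n * ((a + t n) * h * inverse (a + t n) - h)) (ad h a)" by simp
  then show ?case
    using c[OF h(1)] c[OF h(2)] inverse_conj_iter_Suc[OF h(3) x, of 0] by simp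
next
  case (Suc k)
  define y where "y n = conj_iter h (Suc k) (a + t n)" for n
  define z where "z n = inverse (y n)" for n
  define A where "A = (ad h ^^ Suc k) a * inverse h ^ k"
  have IH: "conv y h" "conv z (inverse h)" "conv (\<lambda>n. t n * (y n - h)) A"
    using Suc.IH unfolding y_def z_def A_def by auto
  have y0: "y n \<noteq> 0" for n unfolding y_def by (rule conj_iter_nonzero[OF h(3) x])
  have mem: "y n \<in> Dq" "z n \<in> Dq" for n using IH unfolding conv_def by auto
  have AD: "A \<in> Dq" using IH unfolding conv_def by auto
  have S: "conj_iter h (Suc (Suc k)) (a + t n) = y n * h * z n" for n
    unfolding y_def z_def by simp
  have S': "inverse (conj_iter h (Suc (Suc k)) (a + t n)) = y n * inverse h * z n" for n
    unfolding y_def z_def by (rule inverse_conj_iter_Suc[OF h(3) x])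
  have 1: "conv (\<lambda>n. y n * h * z n) h"
    using conv_mult[OF conv_mult[OF IH(1) conv_const[OF h(1)]] IH(2)] h(3) by (simp add: mult.assoc)
  have 2: "conv (\<lambda>n. y n * inverse h * z n) (inverse h)"
    using conv_mult[OF conv_mult[OF IH(1) conv_const[OF h(2)]] IH(2)] h(3) by simp
  have "conv (\<lambda>n. (t n * (y n - h) * h - h * (t n * (y n - h))) * z n) ((A * h - h * A) * inverse h)"
    by (intro conv_mult conv_diff conv_const h IH)
  moreover have "(t n * (y n - h) * h - h * (t n * (y n - h))) * z n = t n * (y n * h * z n - h)" for n
  proof -
    have "(t n * w * h - h * (t n * w)) * z n = t n * (w * h - h * w) * z n" for w
    proof -
      have "h * (t n * w) = t n * (h * w)"
        using Dq_central[OF t[of n] h(1)] by (simp add: mult.assoc[symmetric])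
      then show ?thesis by (simp add: right_diff_distrib mult.assoc)
    qed
    from this[of "y n - h"]
    have "(t n * (y n - h) * h - h * (t n * (y n - h))) * z n = t n * ((y n - h) * h - h * (y n - h)) * z n" .
    also have "(y n - h) * h - h * (y n - h) = y n * h - h * y n" by (simp add: algebra_simps)
    also have "t n * (y n * h - h * y n) * z n = t n * (y n * h * z n - h * (y n * z n))"
      by (simp add: left_diff_distrib mult.assoc)
    finally show ?thesis using y0 by (simp add: z_def)
  qed
  moreover have "(A * h - h * A) * inverse h = (ad h ^^ Suc (Suc k)) a * inverse h ^ Suc k"
  proof -
    let ?b = "(ad h ^^ Suc k) a"
    have "inverse h ^ k * h = h * inverse h ^ k"
      using commute_inverse[of h h] power_commuting_commutes[of "inverse h" h k] by simp
    then have "A * h - h * A = (?b * h - h * ?b) * inverse h ^ k"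
      unfolding A_def by (simp add: left_diff_distrib mult.assoc)
    also have "?b * h - h * ?b = (ad h ^^ Suc (Suc k)) a" by (simp add: ad_def)
    finally show ?thesis by (simp add: mult.assoc power_Suc2 del: power_Suc funpow.simps)
  qed
  ultimately have 3: "conv (\<lambda>n. t n * (y n * h * z n - h)) ((ad h ^^ Suc (Suc k)) a * inverse h ^ Suc k)"
    by simp
  show ?case unfolding S' unfolding S using 1 2 3 by blast
qed

text \<open>With \<open>z = inverse (a + t)\<close>, the identity \<open>t * z = 1 - a * z\<close>
  gives \<open>(N t - C * nm a) * nm z \<le> nm 1\<close>. So \<open>z\<close> tends to
  \<open>0\<close>, and \<open>t * z\<close> to \<open>1\<close>.\<close>

lemma conv_inverse_shift:
  assumes a: "a \<in> Dq" and one: "1 \<in> Dq"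
    and t: "\<And>n. t n \<in> B" and x: "\<And>n. a + t n \<noteq> 0" "\<And>n. inverse (a + t n) \<in> Dq"
    and lim: "filterlim (\<lambda>n. N (t n)) at_top sequentially"
  shows "conv (\<lambda>n. inverse (a + t n)) 0" "conv (\<lambda>n. t n * inverse (a + t n)) 1"
proof -
  define z where "z n = inverse (a + t n)" for n
  have eq: "t n * z n = 1 - a * z n" for n
  proof -
    have "a * z n + t n * z n = 1" using x(1)[of n] by (simp add: z_def flip: distrib_right)
    then show ?thesis by (metis add_diff_cancel_left')
  qed
  have zD: "z n \<in> Dq" for n using x z_def by simp
  have zero: "0 \<in> Dq" using Dq_M M_zero by blast
  have bound: "(N (t n) - C * nm a) * nm (z n) \<le> nm 1" for n
  proof -
    have "N (t n) * nm (z n) = nm (1 + - (a * z n))"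
      unfolding nm_scale[OF t zD, of n n, symmetric] eq by simp
    also have "\<dots> \<le> nm 1 + nm (- (a * z n))"
      using Dq_add(2)[OF one Dq_minus] Dq_mult(1)[OF a zD] by blast
    also have "\<dots> \<le> nm 1 + C * nm a * nm (z n)"
      using Dq_mult[OF a zD] nm_minus by simp
    finally show ?thesis by (simp add: algebra_simps)
  qed
  have f: "filterlim (\<lambda>n. N (t n) - C * nm a) at_top sequentially"
    using filterlim_tendsto_add_at_top[OF tendsto_const[of "- (C * nm a)"] lim] by simp
  have "(\<lambda>n. nm (z n)) \<longlonglongrightarrow> 0"
  proof (rule tendsto_sandwich)
    show "\<forall>\<^sub>F n in sequentially. 0 \<le> nm (z n)" using nm_nonneg zD by simp
    show "\<forall>\<^sub>F n in sequentially. nm (z n) \<le> nm 1 / (N (t n) - C * nm a)"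
      using filterlim_at_top_dense[THEN iffD1, OF f, rule_format, of 0]
    proof eventually_elim
      case (elim n)
      then show ?case using bound[of n] by (simp add: pos_le_divide_eq mult.commute)
    qed
    show "(\<lambda>n. nm 1 / (N (t n) - C * nm a)) \<longlonglongrightarrow> 0"
      by (rule tendsto_divide_0[OF tendsto_const]) (use f filterlim_at_top_imp_at_infinity in blast)
  qed simp
  then show c: "conv (\<lambda>n. inverse (a + t n)) 0"
    unfolding conv_def z_def[symmetric] using zD zero by simp
  have "conv (\<lambda>n. 1 - a * z n) (1 - a * 0)"
    using conv_diff[OF conv_const[OF one] conv_mult[OF conv_const[OF a] c]] unfolding z_def .
  then show "conv (\<lambda>n. t n * inverse (a + t n)) 1"
    unfolding z_def[symmetric] eq by simp
qed

text \<open>An iterate is a word in \<open>x\<close>, \<open>h\<close> and their inverses, whose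
  length bounds the exponent of the denominator. \<open>L\<close> is chosen before \<open>x\<close>
  and \<open>\<kappa>\<close>, so the exponent is uniform along a sequence of
  \<open>x\<close>.\<close>

lemma conj_iter_word:
  assumes "h \<noteq> 0" "\<And>x. x \<in> S \<Longrightarrow> x \<noteq> 0"
  shows "\<exists>L\<ge>1. \<forall>x\<in>S. \<forall>\<kappa>\<in>B. \<kappa> \<noteq> 0 \<longrightarrow> \<kappa> * x \<in> M \<longrightarrow> \<kappa> * inverse x \<in> M \<longrightarrow> \<kappa> * h \<in> M \<longrightarrow> \<kappa> * inverse h \<in> M \<longrightarrow>
    \<kappa> ^ L * conj_iter h k x \<in> M \<and> \<kappa> ^ L * inverse (conj_iter h k x) \<in> M"
proof (induction k)
  case 0
  show ?case by (intro exI[of _ 1]) simp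
next
  case (Suc k)
  then obtain L where L: "\<And>x \<kappa>. x \<in> S \<Longrightarrow> \<kappa> \<in> B \<Longrightarrow> \<kappa> \<noteq> 0 \<Longrightarrow> \<kappa> * x \<in> M \<Longrightarrow> \<kappa> * inverse x \<in> M \<Longrightarrow> \<kappa> * h \<in> M \<Longrightarrow>
     \<kappa> * inverse h \<in> M \<Longrightarrow> \<kappa> ^ L * conj_iter h k x \<in> M \<and> \<kappa> ^ L * inverse (conj_iter h k x) \<in> M"
    by blast
  \<comment> \<open>The exponent adds up over \<open>y\<close>, the single letter in the middle, and
    \<open>inverse y\<close>.\<close>
  have "\<kappa> ^ (L + (1 + L)) * conj_iter h (Suc k) x \<in> M \<and> \<kappa> ^ (L + (1 + L)) * inverse (conj_iter h (Suc k) x) \<in> M"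
    if xS: "x \<in> S" and k: "\<kappa> \<in> B" "\<kappa> \<noteq> 0" "\<kappa> * x \<in> M" "\<kappa> * inverse x \<in> M" "\<kappa> * h \<in> M" "\<kappa> * inverse h \<in> M" for x \<kappa>
  proof -
    define y where "y = conj_iter h k x"
    have y: "\<kappa> ^ L * y \<in> M" "\<kappa> ^ L * inverse y \<in> M" using L[OF xS k] y_def by auto
    have kB: "\<kappa> ^ i \<in> B" for i using sring_power[OF B k(1)] .
    have yD: "y \<in> Dq" using DqI[OF kB _ y(1)] k(2) by simp
    have w: "\<kappa> ^ (L + (1 + L)) * (y * g * inverse y) \<in> M" if g: "\<kappa> * g \<in> M" for g
    proof -
      have gD: "g \<in> Dq" using DqI[OF k(1,2) g] .
      have "\<kappa> ^ (L + (1 + L)) * (y * g * inverse y) = \<kappa> ^ L * (\<kappa> * (\<kappa> ^ L * (y * (g * inverse y))))"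
        by (simp only: power_add power_one_right mult.assoc)
      also have "\<kappa> ^ L * (y * (g * inverse y)) = y * (g * (\<kappa> ^ L * inverse y))"
        using Dq_central[OF kB yD] Dq_central[OF kB gD] by (metis mult.assoc)
      also have "\<kappa> * (y * (g * (\<kappa> ^ L * inverse y))) = y * (\<kappa> * g * (\<kappa> ^ L * inverse y))"
        using Dq_central[OF k(1) yD] by (metis mult.assoc)
      also have "\<kappa> ^ L * (y * (\<kappa> * g * (\<kappa> ^ L * inverse y))) = (\<kappa> ^ L * y) * ((\<kappa> * g) * (\<kappa> ^ L * inverse y))"
        by (simp add: mult.assoc)
      finally show ?thesis using M_mult[OF y(1) M_mult[OF g y(2)]] by simp
    qed
    show ?thesis
      using w[OF k(5)] w[OF k(6)] unfolding inverse_conj_iter_Suc[OF assms(1) assms(2)[OF xS]] y_def by simp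
  qed
  then show ?case by (intro exI[of _ "L + (1 + L)"]) auto
qed

text \<open>Congruence modulo \<open>e\<close> makes \<open>w\<close> comaximal with every power of \<open>e\<close>.\<close>

lemma comaximal_cancel:
  assumes e: "e \<in> B" "r \<in> B" and w: "w = 1 + e * r" and m: "w ^ L * m \<in> M" "e ^ j * m \<in> M"
  shows "m \<in> M"
proof -
  have wB: "w \<in> B" unfolding w using sringD(2-4)[OF B] e by simp
  have "\<exists>q\<in>B. w ^ L = 1 + e * q"
  proof (induction L)
    case 0
    show ?case by (intro bexI[of _ 0]) (simp_all add: sringD(1)[OF B])
  next
    case (Suc L)
    then obtain q where q: "q \<in> B" "w ^ L = 1 + e * q" by blast
    have "w ^ Suc L = 1 + e * (r + q + r * (e * q))" using q(2) w by (simp add: algebra_simps)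
    moreover have "r + q + r * (e * q) \<in> B" using sringD(3,4)[OF B] e q by simp
    ultimately show ?case by blast
  qed
  then obtain q where q: "q \<in> B" "w ^ L = 1 + e * q" by blast
  have "e ^ i * m \<in> M \<Longrightarrow> m \<in> M" for i
  proof (induction i)
    case (Suc i)
    have eB: "e ^ i \<in> B" using sring_power[OF B e(1)] .
    have "e ^ i * (w ^ L * m) - q * (e ^ Suc i * m) \<in> M"
      using M_diff[OF M_scale[OF eB m(1)] M_scale[OF q(1) Suc.prems]] .
    moreover have "q * (e ^ Suc i * m) = e ^ i * (e * q * m)"
      using comm[OF q(1) sring_power[OF B e(1)], of "Suc i"] by (simp add: power_Suc2 mult.assoc[symmetric] del: power_Suc)
    moreover have "e ^ i * (w ^ L * m) - e ^ i * (e * q * m) = e ^ i * m"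
      by (simp add: q(2) algebra_simps)
    ultimately show ?case using Suc.IH by simp
  qed simp
  then show ?thesis using m(2) by blast
qed

text \<open>Two bounds on the denominator of an iterate are compared: one from its form as a word,
  one from membership in \<open>H\<close>. \<open>Hgen\<close> covers every \<open>e\<close> that
  clears the generators because the proof chooses \<open>e\<close> depending on \<open>a\<close> and
  \<open>h\<close>.\<close>

lemma conj_iter_rigid:
  assumes S: "finite S" "S \<subseteq> Dq" and one: "1 \<in> Dq"
    and a: "a \<in> Dq" "inverse a \<in> Dq" "alg_over B (inverse a)"
    and h: "h \<in> Dq" "inverse h \<in> Dq" "h \<noteq> 0"
    and unb: "\<exists>b\<in>B. N b > 1"
    and nz: "\<And>t. t \<in> B \<Longrightarrow> a + t \<noteq> 0"
    and Hgen: "\<And>e x. e \<in> B \<Longrightarrow> (\<And>g. g \<in> S \<Longrightarrow> e * g \<in> M) \<Longrightarrow> x \<in> H \<Longrightarrow> \<exists>j. e ^ j * x \<in> M"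
    and mem: "\<And>t. t \<in> B \<Longrightarrow> conj_iter h (Suc k) (a + t) \<in> H"
  shows "(\<exists>t\<in>B. conj_iter h (Suc k) (a + t) = h) \<and> (ad h ^^ Suc k) a = 0"
proof -
  have a0: "a \<noteq> 0" using nz[of 0] sringD(1)[OF B] by simp
  \<comment> \<open>The scalar makes \<open>\<beta> = c * inverse a\<close> integral; then
    \<open>a + c * s = a * (1 + s * \<beta>)\<close>, and \<open>one_plus_factor\<close> controls
    the denominator of the inverse.\<close>
  obtain c where c: "c \<in> B" "c \<noteq> 0" "int_over B (c * inverse a)"
    by (rule alg_int[OF B comm Dq_central[OF _ a(2)] a(3)])
  define \<beta> where "\<beta> = c * inverse a"
  have \<beta>D: "\<beta> \<in> Dq" unfolding \<beta>_def using Dq_B c a by blast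
  have \<beta>c: "b * \<beta> = \<beta> * b" if "b \<in> B" for b using Dq_central[OF that \<beta>D] .
  obtain d bi where d: "\<And>i. i < d \<Longrightarrow> bi i \<in> B" "\<beta> ^ d = (\<Sum>i<d. bi i * \<beta> ^ i)"
    using c(3) unfolding int_over_def \<beta>_def[symmetric] by blast
  have \<beta>pow: "\<beta> ^ j \<in> Dq" for j
    by (induction j) (use one Dq_mult \<beta>D in auto)
  define G where "G = S \<union> {1, a, inverse a, h, inverse h} \<union> (\<lambda>j. \<beta> ^ j) ` {..<d}"
  have G: "finite G" "\<And>g. g \<in> G \<Longrightarrow> \<exists>b\<in>B. b \<noteq> 0 \<and> b * g \<in> M"
    unfolding G_def using S one a h \<beta>pow by (auto elim!: DqE)
  obtain e0 where e0: "e0 \<in> B" "e0 \<noteq> 0" "\<forall>g\<in>G. e0 * g \<in> M"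
    using common_multiplier[OF B comm G] M_scale by blast
  obtain b0 where b0: "b0 \<in> B" "N b0 > 1" using unb by blast
  \<comment> \<open>The factor \<open>b0\<close> forces \<open>N e > 1\<close>, so that the powers
    of \<open>e\<close> are unbounded and \<open>e\<close> is not a unit of
    \<open>B\<close>.\<close>
  define e where "e = b0 * e0"
  have b00: "b0 \<noteq> 0" using b0 N_zero by auto
  have e: "e \<in> B" "e \<noteq> 0" unfolding e_def using e0 b0 b00 sringD(4)[OF B] by auto
  have eG: "e * g \<in> M" if "g \<in> G" for g
    using M_scale[OF b0(1)] e0 that by (simp add: e_def mult.assoc)
  have Ne: "N e > 1"
  proof -
    have "N b0 * 1 \<le> N b0 * N e0" using N_ge1[OF e0(1,2)] b0 by (intro mult_left_mono) auto
    then show ?thesis unfolding e_def N_mult[OF b0(1) e0(1)] using b0(2) by linarith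
  qed
  \<comment> \<open>The exponent \<open>Suc n\<close> keeps \<open>s n\<close> divisible by
    \<open>e\<close> for every \<open>n\<close>, so that \<open>w n\<close> below is
    \<open>1\<close> modulo \<open>e\<close>.\<close>
  define s where "s n = e ^ Suc n" for n
  define t where "t n = c * s n" for n
  have sB: "s n \<in> B" for n unfolding s_def using sring_power[OF B e(1)] .
  have tB: "t n \<in> B" for n unfolding t_def using sringD(4)[OF B c(1) sB] .
  have xnz: "a + t n \<noteq> 0" for n using nz tB by blast
  have xeq: "a + t n = a * (1 + s n * \<beta>)" for n
  proof -
    have "a * (s n * \<beta>) = s n * (a * (c * inverse a))"
      using Dq_central[OF sB[of n] a(1)] unfolding \<beta>_def by (simp add: mult.assoc[symmetric])
    also have "a * (c * inverse a) = c * (a * inverse a)"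
      by (simp only: mult.assoc[symmetric] Dq_central[OF c(1) a(1)])
    also have "\<dots> = c" using a0 by simp
    also have "s n * c = t n" unfolding t_def using comm[OF sB c(1)] by simp
    finally show ?thesis by (simp add: distrib_left)
  qed
  have "\<exists>r f. r \<in> B \<and> (\<forall>j<d. f j \<in> B) \<and> (1 + s n * \<beta>) * (\<Sum>j<d. f j * \<beta> ^ j) = 1 + s n * r" for n
    by (rule one_plus_factor[OF B comm d sB[of n] \<beta>c]) blast+
  then obtain r f where rf: "\<And>n. r n \<in> B" "\<And>n j. j < d \<Longrightarrow> f n j \<in> B"
    "\<And>n. (1 + s n * \<beta>) * (\<Sum>j<d. f n j * \<beta> ^ j) = 1 + s n * r n" by metis
  define u where "u n = (\<Sum>j<d. f n j * \<beta> ^ j)" for n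
  define w where "w n = 1 + s n * r n" for n
  have uM: "e * u n \<in> M" for n
  proof -
    have "e * u n = (\<Sum>j<d. f n j * (e * \<beta> ^ j))"
      unfolding u_def sum_distrib_left
      by (rule sum.cong) (use comm[OF e(1) rf(2)] in \<open>auto simp: mult.assoc[symmetric]\<close>)
    moreover have "sum g {..<i} \<in> M" if "\<And>j. j < i \<Longrightarrow> g j \<in> M" for g :: "nat \<Rightarrow> 'a" and i
      using that by (induction i) (auto intro: M_zero M_add)
    ultimately show ?thesis using M_scale[OF rf(2)] eG unfolding G_def by simp
  qed
  have weq: "w n = 1 + e * (e ^ n * r n)" for n unfolding w_def s_def by (simp add: mult.assoc)
  have er: "e ^ n * r n \<in> B" for n using sringD(4)[OF B sring_power[OF B e(1)] rf(1)] .
  have wB: "w n \<in> B" for n unfolding weq using sringD(2-4)[OF B] e(1) er by simp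
  \<comment> \<open>If \<open>w n\<close> vanished, \<open>e\<close> would be invertible in
    \<open>B\<close>, contradicting \<open>N e > 1\<close>.\<close>
  have w0: "w n \<noteq> 0" for n
  proof
    assume "w n = 0"
    then have eq: "e * - (e ^ n * r n) = 1" unfolding weq by (metis add_eq_0_iff mult_minus_right minus_minus)
    have mB: "- (e ^ n * r n) \<in> B" using sringD(5)[OF B er] .
    have "- (e ^ n * r n) \<noteq> 0" using eq by auto
    then have "N (- (e ^ n * r n)) \<ge> 1" using N_ge1 mB by blast
    then have "N e * 1 \<le> N e * N (- (e ^ n * r n))" using Ne by (intro mult_left_mono) auto
    then have "1 < N e * N (- (e ^ n * r n))" using Ne by linarith
    then show False using N_mult[OF e(1) mB] N_one unfolding eq by linarith
  qed
  have eM: "e * e \<in> B" using sringD(4)[OF B e(1) e(1)] .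
  \<comment> \<open>Up to \<open>w n\<close>, the inverse of \<open>a + t n\<close> is
    \<open>u n * inverse a\<close>, a product of two elements that each need one factor
    \<open>e\<close>.\<close>
  define \<kappa> where "\<kappa> n = e * e * w n" for n
  have \<kappa>: "\<kappa> n \<in> B" "\<kappa> n \<noteq> 0" for n
    unfolding \<kappa>_def using sringD(4)[OF B eM wB] e w0 by auto
  have inv: "w n * inverse (a + t n) = u n * inverse a" for n
  proof -
    have "(a + t n) * (u n * inverse a) = a * ((1 + s n * \<beta>) * u n) * inverse a" by (simp add: xeq mult.assoc)
    also have "(1 + s n * \<beta>) * u n = w n" unfolding u_def w_def rf(3) ..
    also have "a * w n = w n * a" using Dq_central[OF wB a(1)] by simp
    finally have 1: "(a + t n) * (u n * inverse a) = w n" using a0 by (simp add: mult.assoc)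
    have "w n * (a + t n) = (a + t n) * w n"
      using Dq_central[OF wB a(1)] comm[OF wB tB] by (simp add: algebra_simps)
    then have "w n * inverse (a + t n) = inverse (a + t n) * w n" by (rule commute_inverse)
    also have "\<dots> = inverse (a + t n) * (a + t n) * (u n * inverse a)"
      by (subst 1[symmetric]) (simp add: mult.assoc)
    finally show ?thesis using xnz by simp
  qed
  have reorder: "\<kappa> n * g = w n * (e * (e * g))" for n g
  proof -
    have "e * e * w n = w n * (e * e)" using comm[OF eM wB] .
    then show ?thesis unfolding \<kappa>_def by (simp add: mult.assoc)
  qed
  have \<kappa>G: "\<kappa> n * g \<in> M" if "g \<in> G" for n g
    unfolding reorder using M_scale wB e eG that by blast
  have \<kappa>x: "\<kappa> n * (a + t n) \<in> M" for n
  proof -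
    have "\<kappa> n * (t n * 1) = t n * (\<kappa> n * 1)" using comm[OF \<kappa>(1) tB] by simp
    then have "\<kappa> n * t n \<in> M" using M_scale[OF tB \<kappa>G[of 1]] by (simp add: G_def)
    then show ?thesis using M_add \<kappa>G[of a] by (simp add: distrib_left G_def)
  qed
  have \<kappa>x': "\<kappa> n * inverse (a + t n) \<in> M" for n
  proof -
    have "\<kappa> n * inverse (a + t n) = e * (e * (u n * inverse a))"
      unfolding \<kappa>_def using inv by (simp add: mult.assoc)
    also have "e * (u n * inverse a) = e * u n * inverse a" by (simp add: mult.assoc)
    also have "e * (e * u n * inverse a) = (e * u n) * (e * inverse a)"
      using M_central[OF e(1) uM] by (simp add: mult.assoc[symmetric])
    finally show ?thesis using M_mult[OF uM eG[of "inverse a"]] by (simp add: G_def)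
  qed
  have x'D: "inverse (a + t n) \<in> Dq" for n using DqI[OF \<kappa> \<kappa>x'] .
  let ?m = "Suc k"
  define y where "y n = conj_iter h ?m (a + t n)" for n
  have "\<exists>L\<ge>1. \<forall>x\<in>range (\<lambda>n. a + t n). \<forall>\<kappa>\<in>B. \<kappa> \<noteq> 0 \<longrightarrow> \<kappa> * x \<in> M \<longrightarrow> \<kappa> * inverse x \<in> M \<longrightarrow> \<kappa> * h \<in> M \<longrightarrow> \<kappa> * inverse h \<in> M \<longrightarrow>
    \<kappa> ^ L * conj_iter h ?m x \<in> M \<and> \<kappa> ^ L * inverse (conj_iter h ?m x) \<in> M"
    by (rule conj_iter_word[OF h(3)]) (use xnz in auto)
  then obtain L where L1: "L \<ge> 1" and L2: "\<forall>x\<in>range (\<lambda>n. a + t n). \<forall>\<kappa>\<in>B. \<kappa> \<noteq> 0 \<longrightarrow> \<kappa> * x \<in> M \<longrightarrow> \<kappa> * inverse x \<in> M \<longrightarrow> \<kappa> * h \<in> M \<longrightarrow> \<kappa> * inverse h \<in> M \<longrightarrow>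
    \<kappa> ^ L * conj_iter h ?m x \<in> M \<and> \<kappa> ^ L * inverse (conj_iter h ?m x) \<in> M"
    by (elim exE conjE)
  have hG: "h \<in> G" "inverse h \<in> G" unfolding G_def by auto
  have L: "\<kappa> n ^ L * y n \<in> M" for n
    using L2[rule_format, OF rangeI \<kappa> \<kappa>x \<kappa>x' \<kappa>G[OF hG(1)] \<kappa>G[OF hG(2)]] unfolding y_def by blast
  \<comment> \<open>As a word, \<open>y n\<close> has denominator \<open>(e * e * w n) ^ L\<close>;
    as an element of \<open>H\<close>, it has a power of \<open>e\<close>. Since \<open>w n\<close>
    is \<open>1\<close> modulo \<open>e\<close>, the fixed power \<open>e ^ (2 * L)\<close> suffices
    for all \<open>n\<close>.\<close>
  have yM: "e ^ (2 * L) * y n \<in> M" for n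
  proof -
    obtain j where j: "e ^ j * y n \<in> M"
      using Hgen[OF e(1) _ mem[OF tB]] eG unfolding G_def y_def by blast
    have "e ^ j * (e ^ (2 * L) * y n) = e ^ (2 * L) * (e ^ j * y n)"
      by (simp add: mult.assoc[symmetric] power_add[symmetric] add.commute)
    then have j': "e ^ j * (e ^ (2 * L) * y n) \<in> M" using M_scale[OF sring_power[OF B e(1)] j] by simp
    have "\<kappa> n ^ L = w n ^ L * e ^ (2 * L)"
    proof -
      have "\<kappa> n = w n * (e * e)" using reorder[of n 1] by simp
      moreover have "(w n * (e * e)) ^ i = w n ^ i * (e * e) ^ i" for i
      proof (induction i)
        case (Suc i)
        have "e * e * w n ^ i = w n ^ i * (e * e)" using comm[OF eM sring_power[OF B wB]] .
        then show ?case using Suc by (simp add: mult.assoc[symmetric]) (simp add: mult.assoc)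
      qed simp
      ultimately show ?thesis by (simp add: power_mult power2_eq_square)
    qed
    then have "w n ^ L * (e ^ (2 * L) * y n) \<in> M" using L[of n] by (simp add: mult.assoc)
    then show ?thesis using comaximal_cancel[OF e(1) er weq _ j'] by blast
  qed
  have hM: "e ^ (2 * L) * h \<in> M"
  proof -
    have "e ^ (2 * L) * h = e ^ (2 * L - 1) * (e * h)"
      using L1 by (simp add: mult.assoc[symmetric] power_Suc2[symmetric] del: power_Suc)
    then show ?thesis using M_scale[OF sring_power[OF B e(1)] eG[of h]] by (simp add: G_def)
  qed
  have Nt: "filterlim (\<lambda>n. N (t n)) at_top sequentially"
  proof (rule filterlim_at_top_mono)
    show "filterlim (\<lambda>n. N e ^ n) at_top sequentially"
      unfolding filterlim_at_top
    proof
      fix Z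
      obtain n0 where n0: "Z < N e ^ n0" using real_arch_pow[OF Ne] by blast
      have "Z \<le> N e ^ n" if "n0 \<le> n" for n
        using power_increasing[OF that, of "N e"] Ne n0 by linarith
      then show "\<forall>\<^sub>F n in sequentially. Z \<le> N e ^ n" unfolding eventually_sequentially by blast
    qed
    show "\<forall>\<^sub>F n in sequentially. N e ^ n \<le> N (t n)"
    proof (rule always_eventually, rule allI)
      fix n
      have "1 * N e ^ n \<le> N c * N e ^ Suc n"
        using N_ge1[OF c(1,2)] Ne by (intro mult_mono power_increasing) auto
      then show "N e ^ n \<le> N (t n)"
        unfolding t_def s_def N_mult[OF c(1) sring_power[OF B e(1)]] N_power[OF e(1)] by simp
    qed
  qed
  note lims = conv_inverse_shift[OF a(1) one tB xnz x'D Nt]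
  note cv = conv_conj_iter[OF a(1) h tB xnz lims, of k, folded y_def]
  have "\<forall>\<^sub>F n in sequentially. y n = h"
  proof -
    let ?E = "N (e ^ (2 * L))"
    have "(\<lambda>n. nm (y n - h)) \<longlonglongrightarrow> 0" using cv unfolding conv_def by blast
    then have "(\<lambda>n. ?E * nm (y n - h)) \<longlonglongrightarrow> 0" by (rule tendsto_mult_right_zero)
    then have "\<forall>\<^sub>F n in sequentially. ?E * nm (y n - h) < 1" by (rule order_tendstoD) simp
    then show ?thesis
    proof eventually_elim
      case (elim n)
      have eB: "e ^ (2 * L) \<in> B" "e ^ (2 * L) \<noteq> 0" using sring_power[OF B e(1)] e by auto
      have m: "e ^ (2 * L) * (y n - h) \<in> M" using M_diff[OF yM hM] by (simp add: right_diff_distrib)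
      have yD: "y n - h \<in> Dq" using DqI[OF eB m] .
      \<comment> \<open>Cleared by the fixed denominator, the difference lies in \<open>M\<close>
        and has norm below \<open>1\<close>, so it vanishes.\<close>
      have "nu (e ^ (2 * L) * (y n - h)) < 1" using elim nm_scale[OF eB(1) yD] nm_M[OF m] by simp
      then have "e ^ (2 * L) * (y n - h) = 0" using nu_ge1[OF m] by fastforce
      then show ?case using e(2) by simp
    qed
  qed
  then have ev: "\<forall>\<^sub>F n in sequentially. t n * (y n - h) = 0" by eventually_elim simp
  have "(ad h ^^ ?m) a * inverse h ^ k = 0"
    using conv_eventually_const[OF _ ev] cv by metis
  then have "(ad h ^^ ?m) a = 0" using h(3) by simp
  moreover have "\<exists>n. y n = h"
    using \<open>\<forall>\<^sub>F n in sequentially. y n = h\<close> unfolding eventually_sequentially by blast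
  ultimately show ?thesis using tB unfolding y_def by blast
qed

end

subsection \<open>Nilpotent inner derivations\<close>

lemma binomial_one_plus:
  fixes d :: "'a::ring_1"
  shows "(1 + d) ^ n = (\<Sum>k\<le>n. of_nat (n choose k) * d ^ k)"
proof (induction n)
  case (Suc n)
  have "(1 + d) ^ Suc n = (1 + d) ^ n + (1 + d) ^ n * d"
    by (simp only: power_Suc2 distrib_left mult_1_right)
  also have "\<dots> = (\<Sum>k\<le>n. of_nat (n choose k) * d ^ k) + (\<Sum>k\<le>n. of_nat (n choose k) * d ^ Suc k)"
    unfolding Suc sum_distrib_right by (simp only: mult.assoc power_Suc2)
  also have "(\<Sum>k\<le>n. of_nat (n choose k) * d ^ k) = (\<Sum>k\<le>Suc n. of_nat (n choose k) * d ^ k)"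
    by (simp add: binomial_eq_0)
  also have "\<dots> = 1 + (\<Sum>k\<le>n. of_nat (n choose Suc k) * d ^ Suc k)"
    by (subst sum.atMost_Suc_shift) simp
  also have "\<dots> + (\<Sum>k\<le>n. of_nat (n choose k) * d ^ Suc k) = 1 + (\<Sum>k\<le>n. of_nat (Suc n choose Suc k) * d ^ Suc k)"
    by (simp add: sum.distrib distrib_right add.assoc add.commute del: power_Suc)
  also have "\<dots> = (\<Sum>k\<le>Suc n. of_nat (Suc n choose k) * d ^ k)"
    unfolding sum.atMost_Suc_shift[of "\<lambda>k. of_nat (Suc n choose k) * d ^ k"] by simp
  finally show ?case .
qed simp

text \<open>The inner binomial coefficients vanish, so \<open>(1 + d) ^ p = 1 + d ^ p\<close> for
  \<open>d = r - 1\<close>, and \<open>d ^ p = 0\<close> forces \<open>d = 0\<close>.\<close>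

lemma root_of_unity_char:
  fixes r :: "'a::division_ring"
  assumes p: "Factorial_Ring.prime p" "of_nat p = (0::'a)" and r: "r ^ p = 1"
  shows "r = 1"
proof -
  define d where "d = r - 1"
  have p0: "p > 0" using p(1) prime_gt_0_nat by blast
  have "of_nat (p choose k) * d ^ k = (if k = 0 then 1 else 0) + (if k = p then d ^ p else 0)" if "k \<le> p" for k
  proof (cases "k = 0 \<or> k = p")
    case True
    then show ?thesis using p0 by auto
  next
    case False
    then have "p dvd (p choose k)" using that p(1) by (intro dvd_choose_prime) auto
    then obtain m where "p choose k = p * m" by blast
    then show ?thesis using False p(2) by simp
  qed
  then have "(\<Sum>k\<le>p. of_nat (p choose k) * d ^ k) = (\<Sum>k\<le>p. (if k = 0 then 1 else 0) + (if k = p then d ^ p else 0))"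
    by (intro sum.cong) auto
  also have "\<dots> = 1 + d ^ p" by (simp add: sum.distrib)
  finally have "(1 + d) ^ p = 1 + d ^ p" using binomial_one_plus[of d p] by simp
  then have "d ^ p = 0" using r by (simp add: d_def)
  then show ?thesis by (simp add: d_def)
qed

text \<open>Let \<sigma> be conjugation by \<open>h\<close>; it lowers \<open>x\<close> by
  \<open>1\<close>, so its \<open>p\<close>-th power fixes every \<open>s k\<close>. The iterates
  are \<open>h * s (Suc k)\<close>, where \<open>s (Suc k)\<close> is \<open>s k\<close> divided by
  its image under \<sigma>. If \<open>s (Suc (Suc k)) = 1\<close>, then \<open>r = s (Suc k)\<close>
  is fixed by \<sigma>, whence \<open>r ^ p = 1\<close> and \<open>r = 1\<close>. The descent ends
  at \<open>s 1 = 1 + inverse x\<close>, which is not \<open>1\<close>.\<close>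

lemma conj_iter_shift:
  fixes h x :: "'a::division_ring"
  assumes p: "Factorial_Ring.prime p" "of_nat p = (0::'a)" and h: "h \<noteq> 0" and x: "x * h = h * (x + 1)" "x \<noteq> 0"
  shows "conj_iter h (Suc k) x \<noteq> h"
proof -
  define s where "s = rec_nat (x + 1) (\<lambda>_ r. r * inverse (h * r * inverse h))"
  have s0: "s 0 = x + 1" and sS: "s (Suc k) = s k * inverse (h * s k * inverse h)" for k
    unfolding s_def by simp_all
  have x1: "x + 1 \<noteq> 0" using x h by auto
  have hx: "h * (x + 1) * inverse h = x" using x(1) h by (metis mult.assoc mult_1_right right_inverse)
  have snz: "s k \<noteq> 0" for k by (induction k) (use s0 sS x1 h in auto)
  have xh: "x * h ^ n = h ^ n * (x + of_nat n)" for n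
  proof (induction n)
    case (Suc n)
    have "x * h ^ Suc n = h ^ n * (x + of_nat n) * h" using Suc by (simp add: power_Suc2 mult.assoc[symmetric] del: power_Suc)
    also have "\<dots> = h ^ n * (x * h + of_nat n * h)" by (simp add: mult.assoc distrib_right)
    also have "\<dots> = h ^ n * (h * (x + 1) + h * of_nat n)" using x(1) by (simp add: mult_of_nat_commute)
    also have "\<dots> = h ^ Suc n * (x + of_nat (Suc n))"
      by (simp only: power_Suc2 mult.assoc) (simp add: distrib_left add.assoc)
    finally show ?case .
  qed simp
  have hp: "h ^ p * s k = s k * h ^ p" for k
  proof (induction k)
    case 0
    show ?case using xh[of p] p(2) by (simp add: s0 distrib_left distrib_right)
  next
    case (Suc k)
    have "h ^ p * (h * s k * inverse h) = (h * s k * inverse h) * h ^ p"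
    proof -
      have 1: "h ^ p * h = h * h ^ p" by (simp add: power_commutes)
      have 2: "h ^ p * inverse h = inverse h * h ^ p" by (rule commute_inverse[OF 1])
      show ?thesis using 1 2 Suc by (metis mult.assoc)
    qed
    then have "h ^ p * inverse (h * s k * inverse h) = inverse (h * s k * inverse h) * h ^ p"
      by (rule commute_inverse)
    then show ?case using Suc unfolding sS by (metis mult.assoc)
  qed
  have y: "conj_iter h (Suc k) x = h * s (Suc k)" for k
  proof (induction k)
    case 0
    have "s (Suc 0) = (x + 1) * inverse x" by (simp only: sS s0 hx)
    then show ?case using x(1) by (simp add: mult.assoc[symmetric])
  next
    case (Suc k)
    have "conj_iter h (Suc (Suc k)) x = h * s (Suc k) * h * inverse (h * s (Suc k))" using Suc by simp
    also have "\<dots> = h * (s (Suc k) * (h * inverse (s (Suc k)) * inverse h))"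
      using snz h by (simp add: nonzero_inverse_mult_distrib mult.assoc)
    also have "h * inverse (s (Suc k)) * inverse h = inverse (h * s (Suc k) * inverse h)"
      using snz h by (simp add: nonzero_inverse_mult_distrib mult.assoc)
    finally show ?case by (simp only: sS[of "Suc k"])
  qed
  have "s (Suc k) \<noteq> 1"
  proof (induction k)
    case 0
    have "s (Suc 0) = (x + 1) * inverse x" by (simp only: sS s0 hx)
    then have "s (Suc 0) = 1 + inverse x" using x(2) by (simp add: distrib_right)
    then show ?case using x(2) by simp
  next
    case (Suc k)
    show ?case
    proof
      assume 1: "s (Suc (Suc k)) = 1"
      define r where "r = s (Suc k)"
      have "r = h * r * inverse h" using 1 snz[of "Suc k"] h unfolding sS[of "Suc k"] r_def[symmetric]
        by (metis inverse_inverse_eq inverse_unique)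
      then have rh: "r * h = h * r" using h by (metis mult.assoc left_inverse mult_1_right)
      have rhs: "r * (h * s k) = s k * h"
      proof -
        define w where "w = h * s k * inverse h"
        have "w \<noteq> 0" unfolding w_def using snz h by simp
        moreover have "r = s k * inverse w" unfolding r_def sS[of k] w_def ..
        ultimately have "r * (h * s k * inverse h) = s k" unfolding w_def[symmetric] by (simp add: mult.assoc)
        then have "r * (h * s k * inverse h) * h = s k * h" by simp
        then show ?thesis using h by (simp add: mult.assoc)
      qed
      \<comment> \<open>The equation for \<open>r\<close> iterated \<open>n\<close> times, with the
        inverse powers of \<open>h\<close> cleared; at \<open>n = p\<close> the power of
        \<open>h\<close> commutes with \<open>s k\<close>.\<close>
      have "r ^ n * (h ^ n * s k) = s k * h ^ n" for n
      proof (induction n)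
        case (Suc n)
        have rhn: "r * h ^ n = h ^ n * r" using power_commuting_commutes[of h r n] rh by simp
        have "r ^ Suc n * (h ^ Suc n * s k) = r ^ n * (r * h ^ n) * (h * s k)"
          by (simp only: power_Suc2 mult.assoc)
        also have "\<dots> = r ^ n * h ^ n * (r * (h * s k))" by (simp only: rhn mult.assoc)
        also have "\<dots> = (r ^ n * (h ^ n * s k)) * h" by (simp only: rhs mult.assoc)
        also have "\<dots> = s k * h ^ Suc n" by (simp only: Suc power_Suc2 mult.assoc)
        finally show ?case .
      qed simp
      from this[of p] have "r ^ p * (h ^ p * s k) = h ^ p * s k" using hp by simp
      then have "r ^ p = 1" using snz[of k] h by simp
      then have "r = 1" by (rule root_of_unity_char[OF p])
      then show False using Suc r_def by simp
    qed
  qed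
  then show ?thesis unfolding y using h by simp
qed

section \<open>Inner derivations and their nilpotency\<close>

lemma ad_mult: "ad h (x * y) = ad h x * y + x * ad h y"
  unfolding ad_def by (simp add: algebra_simps)

lemma ad_of_nat: "ad h (of_nat m * y) = of_nat m * ad h y"
proof -
  have "h * (of_nat m * y) = of_nat m * (h * y)" by (metis mult.assoc mult_of_nat_commute)
  then show ?thesis unfolding ad_def by (simp add: right_diff_distrib mult.assoc)
qed

text \<open>The relation \<open>ad h b = 1\<close> makes \<open>ad h\<close> act on powers of
  \<open>b\<close> as differentiation.\<close>

lemma ad_pow_fact:
  fixes b h :: "'a::division_ring"
  assumes "ad h b = 1"
  shows "(ad h ^^ n) (b ^ n) = of_nat (fact n)"
proof -
  have pw: "ad h (b ^ Suc n) = of_nat (Suc n) * b ^ n" for n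
  proof (induction n)
    case (Suc n)
    have "ad h (b ^ Suc (Suc n)) = ad h (b ^ Suc n) * b + b ^ Suc n * ad h b"
      by (subst power_Suc2) (rule ad_mult)
    also have "\<dots> = of_nat (Suc n) * b ^ Suc n + b ^ Suc n"
      by (simp only: Suc assms mult.assoc power_Suc2[symmetric] mult_1_right)
    also have "\<dots> = of_nat (Suc (Suc n)) * b ^ Suc n" by (simp add: distrib_right add.commute)
    finally show ?case .
  qed (simp add: assms)
  have lin: "(ad h ^^ n) (of_nat m * y) = of_nat m * (ad h ^^ n) y" for n m and y
    by (induction n) (simp_all add: ad_of_nat)
  show ?thesis
  proof (induction n)
    case (Suc n)
    have "(ad h ^^ Suc n) (b ^ Suc n) = (ad h ^^ n) (of_nat (Suc n) * b ^ n)"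
      by (simp only: funpow_Suc_right o_apply pw)
    also have "\<dots> = of_nat (Suc n) * of_nat (fact n)" by (simp only: lin Suc)
    finally show ?case by (simp only: fact_Suc of_nat_mult of_nat_id)
  qed simp
qed

text \<open>The least positive integer that vanishes is prime, since a division ring has no zero
  divisors.\<close>

lemma exists_prime_char:
  assumes "\<exists>n>0. of_nat n = (0::'a::division_ring)"
  shows "\<exists>p. Factorial_Ring.prime p \<and> of_nat p = (0::'a)"
proof -
  define p where "p = (LEAST n. n > 0 \<and> of_nat n = (0::'a))"
  have p: "p > 0 \<and> of_nat p = (0::'a)" unfolding p_def using assms by (rule LeastI_ex)
  have least: "p \<le> n" if "n > 0" "of_nat n = (0::'a)" for n
    unfolding p_def using that by (intro Least_le) simp
  have "p \<noteq> 1" using p by auto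
  moreover have "m = 1 \<or> m = p" if m: "m dvd p" for m
  proof -
    obtain q where q: "p = m * q" using m by (rule dvdE)
    then have "of_nat m = (0::'a) \<or> of_nat q = (0::'a)" using p by (metis mult_eq_0_iff of_nat_mult)
    moreover have "m > 0" "q > 0" using p q by auto
    ultimately have "p \<le> m \<or> p \<le> q" using least by blast
    then show ?thesis using q \<open>m > 0\<close> \<open>q > 0\<close> by (auto simp: order_antisym)
  qed
  ultimately have "Factorial_Ring.prime p" using p by (simp add: prime_nat_iff)
  then show ?thesis using p by blast
qed

text \<open>Dividing the penultimate nonzero iterate of \<open>ad h\<close> on \<open>a\<close> by
  the last one gives \<open>b\<close> with \<open>ad h b = 1\<close>. In characteristic
  \<open>0\<close> this contradicts \<open>nil\<close>, in characteristic \<open>p\<close> it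
  contradicts \<open>rigid\<close>.\<close>

lemma ad_not_nilpotent:
  fixes h :: "'a::division_ring"
  assumes D: "is_division_subring D" and h: "h \<in> D" and a: "a \<in> D" "a * h \<noteq> h * a"
    and nil: "\<And>x. x \<in> D \<Longrightarrow> (ad h ^^ Suc k) x = 0"
    and rigid: "\<And>x. x \<in> D \<Longrightarrow> x * h \<noteq> h * x \<Longrightarrow> \<exists>t\<in>center_of D. conj_iter h (Suc k) (x + t) = h"
  shows False
proof -
  have sD: "sring D" using D by (rule division_subring_sring)
  have h0: "h \<noteq> 0" using a by auto
  have adD: "(ad h ^^ n) x \<in> D" if "x \<in> D" for x n
    by (induction n) (use that h in \<open>auto simp: ad_def intro!: sringD(4,6)[OF sD]\<close>)
  define i where "i = (LEAST i. (ad h ^^ i) a = 0)"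
  have i: "(ad h ^^ i) a = 0" unfolding i_def using nil[OF a(1)] by (rule LeastI)
  have imin: "(ad h ^^ j) a \<noteq> 0" if "j < i" for j using that not_less_Least unfolding i_def by blast
  have "i \<noteq> 0"
  proof
    assume "i = 0" then show False using i a by simp
  qed
  moreover have "i \<noteq> 1"
  proof
    assume "i = 1" then show False using i a by (simp add: ad_def)
  qed
  \<comment> \<open>Both \<open>a\<close> and \<open>ad h a\<close> are nonzero, so there is an
    iterate two steps before the first zero.\<close>
  ultimately obtain j where j: "i = Suc (Suc j)" by (metis One_nat_def not0_implies_Suc)
  define a0 where "a0 = (ad h ^^ j) a"
  define c where "c = ad h a0"
  have c: "c \<noteq> 0" "ad h c = 0" using i imin[of "Suc j"] unfolding c_def a0_def j by auto
  have cD: "c \<in> D" using adD[OF a(1), of "Suc j"] unfolding c_def a0_def by simp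
  have hc: "h * c = c * h" using c(2) by (simp add: ad_def)
  define b where "b = a0 * inverse c"
  have bD: "b \<in> D"
  proof -
    have "inverse c \<in> D" using D cD unfolding is_division_subring_def by blast
    then show ?thesis unfolding b_def a0_def using sringD(4)[OF sD adD[OF a(1)]] by blast
  qed
  have "ad h (inverse c) = 0" using commute_inverse[OF hc] by (simp add: ad_def)
  then have b: "ad h b = 1" unfolding b_def ad_mult using c(1) by (simp add: c_def)
  show False
  proof (cases "\<exists>n>0. of_nat n = (0::'a)")
    case False
    have "b ^ Suc k \<in> D" using sring_power[OF sD bD] .
    then have "of_nat (fact (Suc k)) = (0::'a)" using nil ad_pow_fact[OF b] by metis
    then show False using False fact_gt_zero by blast
  next
    case True
    then obtain p where p: "Factorial_Ring.prime p" "of_nat p = (0::'a)" using exists_prime_char by blast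
    have bh: "b * h = 1 + h * b" using b by (simp add: ad_def algebra_simps)
    have "b * h * h = h * (b * h + 1)"
    proof -
      have "b * h * h = (1 + h * b) * h" by (simp only: bh)
      then show ?thesis by (simp add: algebra_simps)
    qed
    then have sh: "(b * h) * h = h * (b * h) + h" by (simp add: distrib_left)
    then have "(b * h) * h \<noteq> h * (b * h)" using h0 by simp
    then obtain t where t: "t \<in> center_of D" "conj_iter h (Suc k) (b * h + t) = h"
      using rigid[OF sringD(4)[OF sD bD h]] by blast
    \<comment> \<open>Translation by a central \<open>t\<close> preserves the relation
      \<open>x * h = h * (x + 1)\<close>.\<close>
    have th: "t * h = h * t" using center_commute[OF t(1) h] .
    have x: "(b * h + t) * h = h * (b * h + t + 1)" using sh th by (simp add: algebra_simps)
    moreover have "b * h + t \<noteq> 0"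
    proof
      assume "b * h + t = 0" then show False using x h0 by simp
    qed
    ultimately show False using conj_iter_shift[OF p h0] t(2) by blast
  qed
qed

subsection \<open>Subrings with an absolute value\<close>

text \<open>Values at \<open>x\<close> of polynomials of degree less than \<open>n\<close>; thus
  \<open>polys k x 0\<close> contains only \<open>0\<close>.\<close>

definition polys :: "'a::division_ring set \<Rightarrow> 'a \<Rightarrow> nat \<Rightarrow> 'a set" where
  "polys k x n = lspan k ((\<lambda>i. x ^ i) ` {..<n})"

lemma polys_mono: "m \<le> n \<Longrightarrow> polys k x m \<subseteq> polys k x n"
  unfolding polys_def by (intro lspan_mono) auto

lemma polys_SucE:
  assumes "sring k" "b \<in> polys k x (Suc n)"
  obtains c r where "c \<in> k" "r \<in> polys k x n" "b = c * x ^ n + r"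
  using lspan_insertE[OF assms(1), of b "x ^ n" "(\<lambda>i. x ^ i) ` {..<n}"] assms(2)
  unfolding polys_def lessThan_Suc by auto

lemma polys_SucI:
  assumes "c \<in> k" "r \<in> polys k x n"
  shows "c * x ^ n + r \<in> polys k x (Suc n)"
proof -
  have "r \<in> polys k x (Suc n)" using assms(2) polys_mono[of n "Suc n"] by auto
  then have "r + c * x ^ n \<in> polys k x (Suc n)"
    unfolding polys_def by (rule lspan.step) (use assms(1) in auto)
  then show ?thesis by (simp add: add.commute)
qed

lemma polys_repr:
  assumes k: "sring k" and "b \<in> polys k x n"
  shows "\<exists>c. (\<forall>i. c i \<in> k) \<and> b = (\<Sum>i<n. c i * x ^ i)"
  using assms(2)
proof (induction n arbitrary: b)
  case 0
  have "polys k x 0 \<subseteq> {0}" unfolding polys_def by (rule lspan_least) auto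
  then show ?case using 0 sringD(1)[OF k] by (intro exI[of _ "\<lambda>_. 0"]) auto
next
  case (Suc n)
  obtain c r where c: "c \<in> k" "r \<in> polys k x n" "b = c * x ^ n + r" using polys_SucE[OF k Suc.prems] .
  obtain f where f: "\<forall>i. f i \<in> k" "r = (\<Sum>i<n. f i * x ^ i)" using Suc.IH[OF c(2)] by blast
  have "b = (\<Sum>i<Suc n. (f(n := c)) i * x ^ i)" using c f by (simp add: add.commute)
  moreover have "\<forall>i. (f(n := c)) i \<in> k" using c f by simp
  ultimately show ?case by blast
qed

lemma polys_sumI: "sring k \<Longrightarrow> (\<And>i. i < n \<Longrightarrow> c i \<in> k) \<Longrightarrow> (\<Sum>i<n. c i * x ^ i) \<in> polys k x n"
proof (induction n)
  case 0
  then show ?case unfolding polys_def by (simp add: lspan.zero)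
next
  case (Suc n)
  then show ?case using polys_SucI[of "c n" k "\<Sum>i<n. c i * x ^ i" x n] by (simp add: add.commute)
qed

lemma polys_mult:
  assumes k: "sring k" and kx: "\<And>c. c \<in> k \<Longrightarrow> c * x = x * c"
    and "b \<in> polys k x m" "b' \<in> polys k x n"
  shows "b * b' \<in> polys k x (m + n)"
proof -
  obtain c where c: "\<forall>i. c i \<in> k" "b = (\<Sum>i<m. c i * x ^ i)" using polys_repr[OF k assms(3)] by blast
  obtain d where d: "\<forall>i. d i \<in> k" "b' = (\<Sum>i<n. d i * x ^ i)" using polys_repr[OF k assms(4)] by blast
  have "b * b' = (\<Sum>i<m. \<Sum>j<n. (c i * x ^ i) * (d j * x ^ j))" unfolding c(2) d(2) by (rule sum_product)
  also have "\<dots> = (\<Sum>i<m. \<Sum>j<n. (c i * d j) * x ^ (i + j))"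
  proof (intro sum.cong refl)
    fix i j
    have "x ^ i * d j = d j * x ^ i" using power_commuting_commutes[of x "d j" i] kx d(1) by metis
    then show "(c i * x ^ i) * (d j * x ^ j) = (c i * d j) * x ^ (i + j)"
      by (simp add: power_add mult.assoc) (metis mult.assoc)
  qed
  also have "\<dots> \<in> polys k x (m + n)"
    unfolding polys_def
  proof (intro lspan_sum)
    fix i j assume ij: "i \<in> {..<m}" "j \<in> {..<n}"
    have "0 + (c i * d j) * x ^ (i + j) \<in> lspan k ((\<lambda>i. x ^ i) ` {..<m + n})"
      by (rule lspan.step[OF lspan.zero]) (use ij c d sringD(4)[OF k] in auto)
    then show "(c i * d j) * x ^ (i + j) \<in> lspan k ((\<lambda>i. x ^ i) ` {..<m + n})" by simp
  qed
  finally show ?thesis .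
qed

text \<open>Sharper by one than applying \<open>polys_mult\<close> to \<open>x ^ m\<close> as an
  element of \<open>polys k x (Suc m)\<close>; the degree computation needs the exact bound.\<close>

lemma polys_shift:
  assumes k: "sring k" and kx: "\<And>c. c \<in> k \<Longrightarrow> c * x = x * c" and r: "r \<in> polys k x n"
  shows "x ^ m * r \<in> polys k x (m + n)"
  using r unfolding polys_def
proof (induction r rule: lspan.induct)
  case (step r c t)
  then obtain i where i: "i < n" "t = x ^ i" by auto
  have "x ^ m * c = c * x ^ m" using power_commuting_commutes[of x c m] kx[OF step(2)] by simp
  then have "x ^ m * (r + c * t) = x ^ m * r + c * x ^ (m + i)"
    by (simp add: i distrib_left power_add mult.assoc[symmetric])
  moreover have "x ^ m * r + c * x ^ (m + i) \<in> lspan k ((\<lambda>i. x ^ i) ` {..<m + n})"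
    by (rule lspan.step[OF step(4,2)]) (use i in auto)
  ultimately show ?case by simp
qed (simp add: lspan.zero)

lemma polys_add: "b \<in> polys k x n \<Longrightarrow> b' \<in> polys k x n \<Longrightarrow> b + b' \<in> polys k x n"
  unfolding polys_def by (rule lspan_add)

definition adjoin :: "'a::division_ring set \<Rightarrow> 'a \<Rightarrow> 'a set" where
  "adjoin k x = (\<Union>n. polys k x n)"

lemma adjoinE2:
  assumes "b \<in> adjoin k x" "b' \<in> adjoin k x"
  obtains n where "b \<in> polys k x n" "b' \<in> polys k x n"
proof -
  obtain m n where "b \<in> polys k x m" "b' \<in> polys k x n" using assms unfolding adjoin_def by blast
  then have "b \<in> polys k x (max m n)" "b' \<in> polys k x (max m n)"
    using polys_mono[of m "max m n" k x] polys_mono[of n "max m n" k x] by auto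
  then show ?thesis using that by blast
qed

lemma adjoin_base: assumes "sring k" "c \<in> k" shows "c \<in> adjoin k x"
  using polys_sumI[OF assms(1), of 1 "\<lambda>_. c" x] assms(2) unfolding adjoin_def by auto

lemma adjoin_gen: assumes "sring k" shows "x \<in> adjoin k x"
proof -
  have "(\<Sum>i<2. (if i = 1 then 1 else 0) * x ^ i) \<in> polys k x 2"
    by (rule polys_sumI[OF assms]) (auto simp: sringD(1,2)[OF assms])
  moreover have "(\<Sum>i<2. (if i = 1 then 1 else 0) * x ^ i) = x" by (simp add: numeral_2_eq_2)
  ultimately show ?thesis unfolding adjoin_def by auto
qed

lemma sring_adjoin:
  assumes k: "sring k" and kx: "\<And>c. c \<in> k \<Longrightarrow> c * x = x * c"
  shows "sring (adjoin k x)"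
  unfolding sring_def
proof (intro conjI ballI)
  show "0 \<in> adjoin k x" "1 \<in> adjoin k x" using adjoin_base[OF k] sringD(1,2)[OF k] by auto
next
  fix b assume "b \<in> adjoin k x"
  then show "- b \<in> adjoin k x" unfolding adjoin_def polys_def using lspan_minus[OF k] by blast
  fix b' assume "b' \<in> adjoin k x"
  with \<open>b \<in> adjoin k x\<close> obtain n where n: "b \<in> polys k x n" "b' \<in> polys k x n" by (rule adjoinE2)
  show "b + b' \<in> adjoin k x" using polys_add[OF n] unfolding adjoin_def by blast
  show "b * b' \<in> adjoin k x" using polys_mult[OF k kx n] unfolding adjoin_def by blast
qed

lemma adjoin_commute:
  assumes k: "sring k" and kc: "\<And>x y. x \<in> k \<Longrightarrow> y \<in> k \<Longrightarrow> x * y = y * x"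
    and kx: "\<And>c. c \<in> k \<Longrightarrow> c * x = x * c" and bb: "b \<in> adjoin k x" "b' \<in> adjoin k x"
  shows "b * b' = b' * b"
proof -
  obtain m c where c: "b = (\<Sum>i<m. c i * x ^ i)" "\<forall>i. c i \<in> k"
    using bb polys_repr[OF k] unfolding adjoin_def by blast
  obtain n d where d: "b' = (\<Sum>i<n. d i * x ^ i)" "\<forall>i. d i \<in> k"
    using bb polys_repr[OF k] unfolding adjoin_def by blast
  have "(c i * x ^ i) * (d j * x ^ j) = (d j * x ^ j) * (c i * x ^ i)" for i j
  proof -
    have p: "x ^ i * e = e * x ^ i" if "e \<in> k" for e i
      using power_commuting_commutes[of x e i] kx[OF that] by simp
    have "(c i * x ^ i) * (d j * x ^ j) = c i * (x ^ i * d j) * x ^ j" by (simp only: mult.assoc)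
    also have "\<dots> = (c i * d j) * (x ^ i * x ^ j)" using p d(2) by (simp only: mult.assoc)
    also have "\<dots> = (d j * c i) * (x ^ j * x ^ i)" using kc c(2) d(2) by (metis power_add add.commute)
    also have "\<dots> = d j * (c i * x ^ j) * x ^ i" by (simp only: mult.assoc)
    also have "c i * x ^ j = x ^ j * c i" using p c(2) by simp
    finally show ?thesis by (simp only: mult.assoc)
  qed
  then show ?thesis unfolding c(1) d(1) sum_product by (subst sum.swap) simp
qed

lemma adjoin_subset:
  assumes K: "sring K" "k \<subseteq> K" "x \<in> K" shows "adjoin k x \<subseteq> K"
proof -
  have "polys k x n \<subseteq> K" for n unfolding polys_def
    by (rule lspan_least) (use assms sringD[OF K(1)] sring_power[OF K(1)] in auto)
  then show ?thesis unfolding adjoin_def by blast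
qed

lemma not_alg_zero:
  assumes "\<not> alg_over k x" "\<And>i. i \<le> n \<Longrightarrow> c i \<in> k" "(\<Sum>i\<le>n. c i * x ^ i) = 0" "i \<le> n"
  shows "c i = 0"
  using alg_overI[of n c k i x] assms by blast

text \<open>Transcendence of \<open>x\<close> makes the leading term unique, so degrees add under
  multiplication and \<open>N b = 2 ^ deg b\<close> is multiplicative.\<close>

lemma valued_ring_adjoin:
  assumes k: "sring k" and kc: "\<And>x y. x \<in> k \<Longrightarrow> y \<in> k \<Longrightarrow> x * y = y * x"
    and kx: "\<And>c. c \<in> k \<Longrightarrow> c * x = x * c" and tr: "\<not> alg_over k x"
  shows "\<exists>N. valued_ring (adjoin k x) N \<and> N x > 1"
proof -
  let ?B = "adjoin k x" and ?V = "polys k x"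
  \<comment> \<open>\<open>Suc\<close> turns the strict bound of \<open>polys\<close> into the
    degree. The element \<open>0\<close> also gets degree \<open>0\<close>, so \<open>N\<close>
    treats it separately.\<close>
  define deg where "deg b = (LEAST n. b \<in> ?V (Suc n))" for b
  define N where "N b = (if b = 0 then 0 else 2 ^ deg b :: real)" for b
  have sB: "sring ?B" using sring_adjoin[OF k kx] .
  have lead: "c * x ^ n \<notin> ?V n" if "c \<in> k" "c \<noteq> 0" for c n
  proof
    assume "c * x ^ n \<in> ?V n"
    then obtain f where f: "\<forall>i. f i \<in> k" "c * x ^ n = (\<Sum>i<n. f i * x ^ i)" using polys_repr[OF k] by blast
    define g where "g = f(n := - c)"
    have "(\<Sum>i\<le>n. g i * x ^ i) = (\<Sum>i<n. f i * x ^ i) + g n * x ^ n"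
      unfolding lessThan_Suc_atMost[symmetric] by (simp add: g_def)
    then have "(\<Sum>i\<le>n. g i * x ^ i) = 0" unfolding f(2)[symmetric] by (simp add: g_def)
    moreover have "g i \<in> k" for i using f(1) sringD(5)[OF k that(1)] by (simp add: g_def)
    ultimately have "g n = 0" using not_alg_zero[OF tr, of n g n] by simp
    then show False using that by (simp add: g_def)
  qed
  have degeq: "deg b = n \<and> b \<noteq> 0" if "c \<in> k" "c \<noteq> 0" "r \<in> ?V n" "b = c * x ^ n + r" for b c r n
  proof -
    have nb: "b \<notin> ?V n"
    proof
      assume "b \<in> ?V n"
      then have "b - r \<in> ?V n" using that(3) lspan_diff[OF k] unfolding polys_def by blast
      then show False using lead[OF that(1,2), of n] that(4) by simp
    qed
    have "deg b = n" unfolding deg_def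
    proof (rule Least_equality)
      show "b \<in> ?V (Suc n)" using polys_SucI that by blast
      fix m assume m: "b \<in> ?V (Suc m)"
      show "n \<le> m"
      proof (rule ccontr)
        assume "\<not> n \<le> m"
        then have "b \<in> ?V n" using m polys_mono[of "Suc m" n k x] by auto
        then show False using nb by blast
      qed
    qed
    moreover have "b \<noteq> 0" using nb lspan.zero unfolding polys_def by metis
    ultimately show ?thesis by blast
  qed
  have dec: "\<exists>m c r. c \<in> k \<and> c \<noteq> 0 \<and> r \<in> ?V m \<and> b = c * x ^ m + r" if "b \<in> ?V n" "b \<noteq> 0" for b n
    using that
  proof (induction n arbitrary: b)
    case 0
    have "?V 0 \<subseteq> {0}" unfolding polys_def by (rule lspan_least) auto
    then show ?case using 0 by blast
  next
    case (Suc n)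
    obtain c r where c: "c \<in> k" "r \<in> ?V n" "b = c * x ^ n + r" using polys_SucE[OF k Suc.prems(1)] .
    show ?case
    proof (cases "c = 0")
      case True
      then show ?thesis using Suc.IH[of b] c Suc.prems by simp
    next
      case False
      then show ?thesis using c by blast
    qed
  qed
  have decB: "\<exists>m c r. c \<in> k \<and> c \<noteq> 0 \<and> r \<in> ?V m \<and> b = c * x ^ m + r" if "b \<in> ?B" "b \<noteq> 0" for b
    using dec that unfolding adjoin_def by blast
  have V_deg: "b \<in> ?V (Suc (deg b))" if "b \<in> ?B" "b \<noteq> 0" for b
    using decB[OF that] degeq polys_SucI by metis
  have V0: "0 \<in> ?V n" for n unfolding polys_def by (rule lspan.zero)
  have "valued_ring ?B N"
  proof
    show "sring ?B" by (rule sB)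
  next
    fix b b' assume bb: "b \<in> ?B" "b' \<in> ?B"
    show "b * b' = b' * b" using adjoin_commute[OF k kc kx bb] .
    show "N (b * b') = N b * N b'"
    proof (cases "b = 0 \<or> b' = 0")
      case True then show ?thesis by (auto simp: N_def)
    next
      case False
      obtain m c r where 1: "c \<in> k" "c \<noteq> 0" "r \<in> ?V m" "b = c * x ^ m + r" using decB[OF bb(1)] False by blast
      obtain n c' r' where 2: "c' \<in> k" "c' \<noteq> 0" "r' \<in> ?V n" "b' = c' * x ^ n + r'" using decB[OF bb(2)] False by blast
      have pw: "x ^ m * c' = c' * x ^ m" using power_commuting_commutes[of x c' m] kx[OF 2(1)] by simp
      \<comment> \<open>All terms other than the product of the leading terms; they have degree
        below \<open>m + n\<close>.\<close>
      define q where "q = c * x ^ m * r' + r * (c' * x ^ n) + r * r'"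
      have "b * b' = (c * x ^ m) * (c' * x ^ n) + q"
        unfolding 1(4) 2(4) q_def by (simp only: distrib_left distrib_right add_ac)
      also have "(c * x ^ m) * (c' * x ^ n) = (c * c') * x ^ (m + n)"
        using pw by (simp add: power_add mult.assoc) (metis mult.assoc)
      finally have eq: "b * b' = (c * c') * x ^ (m + n) + q" .
      have "q \<in> ?V (m + n)"
      proof -
        have "c * (x ^ m * r') \<in> ?V (m + n)"
          using polys_shift[OF k kx 2(3), of m] lspan_scale[OF k 1(1)] unfolding polys_def by blast
        moreover have "r * (c' * x ^ n) \<in> ?V (m + n)"
        proof -
          have "r * (c' * x ^ n) = c' * (x ^ n * r)"
            using adjoin_commute[OF k kc kx, of r "c' * x ^ n"] 1(3) adjoin_base[OF k 2(1), of x]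
              sringD(4)[OF sB] sring_power[OF sB adjoin_gen[OF k]] unfolding adjoin_def[of k x]
            by (metis UN_I UNIV_I mult.assoc)
          then show ?thesis
            using polys_shift[OF k kx 1(3), of n] lspan_scale[OF k 2(1)] unfolding polys_def by (simp add: add.commute)
        qed
        moreover have "r * r' \<in> ?V (m + n)" using polys_mult[OF k kx 1(3) 2(3)] .
        ultimately show ?thesis unfolding q_def mult.assoc[of c] by (intro polys_add)
      qed
      moreover have "c * c' \<in> k" "c * c' \<noteq> 0" using 1 2 sringD(4)[OF k] by auto
      ultimately have "deg (b * b') = m + n" using degeq eq by blast
      moreover have "deg b = m" "deg b' = n" using degeq 1 2 by blast+
      ultimately show ?thesis using False by (simp add: N_def power_add)
    qed
    show "N (b + b') \<le> N b + N b'"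
    proof (cases "b = 0 \<or> b' = 0 \<or> b + b' = 0")
      case True then show ?thesis by (auto simp: N_def)
    next
      case False
      have "b \<in> ?V (Suc (max (deg b) (deg b')))" "b' \<in> ?V (Suc (max (deg b) (deg b')))"
        using V_deg[OF bb(1)] V_deg[OF bb(2)] False
          polys_mono[of "Suc (deg b)" "Suc (max (deg b) (deg b'))" k x]
          polys_mono[of "Suc (deg b')" "Suc (max (deg b) (deg b'))" k x] by auto
      then have "b + b' \<in> ?V (Suc (max (deg b) (deg b')))" by (rule polys_add)
      then have "deg (b + b') \<le> max (deg b) (deg b')" unfolding deg_def[of "b + b'"] by (rule Least_le)
      then have "(2::real) ^ deg (b + b') \<le> 2 ^ max (deg b) (deg b')" by (rule power_increasing) simp
      also have "\<dots> \<le> 2 ^ deg b + 2 ^ deg b'" by (cases "deg b \<le> deg b'") (auto simp: max_def)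
      finally show ?thesis using False by (simp add: N_def)
    qed
  next
    show "N 0 = 0" by (simp add: N_def)
    show "1 \<le> N b" if "b \<in> ?B" "b \<noteq> 0" for b using that by (simp add: N_def)
  qed
  moreover have "deg x = 1 \<and> x \<noteq> 0"
    by (rule degeq[of 1 0]) (auto simp: sringD(2)[OF k] V0)
  then have "N x > 1" by (simp add: N_def)
  ultimately show ?thesis by blast
qed

section \<open>The prime subring\<close>

lemma sring_range_of_int: "sring (range of_int :: 'a::division_ring set)"
  unfolding sring_def
  by (auto simp flip: of_int_add of_int_mult of_int_minus intro: range_eqI[of _ _ 0] range_eqI[of _ _ 1])

lemma range_of_int_subset:
  assumes K: "sring K" shows "range of_int \<subseteq> K"
proof -
  have nat: "of_nat m \<in> K" for m by (induction m) (auto intro: sringD(1-3)[OF K])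
  have "of_int n \<in> K" for n
    by (cases n) (auto simp: nat sringD(5)[OF K] simp flip: of_nat_Suc simp del: of_nat_Suc)
  then show ?thesis by blast
qed

lemma of_int_eq_0_char:
  assumes "\<not> (\<exists>n>0. of_nat n = (0::'a::division_ring))" "of_int m = (0::'a)"
  shows "m = 0"
proof (rule ccontr)
  assume "m \<noteq> 0"
  then have "nat \<bar>m\<bar> > 0" by simp
  moreover have "of_nat (nat \<bar>m\<bar>) = (0::'a)"
    using assms(2) by (cases "m \<ge> 0") (auto simp: of_nat_nat)
  ultimately show False using assms(1) by blast
qed

text \<open>In characteristic \<open>0\<close> the map \<open>of_int\<close> is injective, so
  \<open>SOME\<close> picks the only preimage and \<open>N\<close> is the usual absolute
  value.\<close>

lemma valued_ring_int:
  assumes char: "\<not> (\<exists>n>0. of_nat n = (0::'a::division_ring))"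
  shows "\<exists>N. valued_ring (range of_int :: 'a set) N \<and> N 2 > 1"
proof -
  define N where "N b = real_of_int \<bar>SOME n. of_int n = b\<bar>" for b :: 'a
  have inj: "m = n" if "of_int m = (of_int n :: 'a)" for m n
    using of_int_eq_0_char[OF char, of "m - n"] that by simp
  have N: "N (of_int n) = \<bar>of_int n\<bar>" for n
  proof -
    have "(SOME m. of_int m = (of_int n :: 'a)) = n" by (rule some_equality) (auto dest: inj)
    then show ?thesis unfolding N_def by simp
  qed
  have N0: "N 0 = 0" using N[of 0] by simp
  have "valued_ring (range of_int :: 'a set) N"
  proof
    show "sring (range of_int :: 'a set)" by (rule sring_range_of_int)
    show "N 0 = 0" by (rule N0)
    show "1 \<le> N x" if "x \<in> range of_int" "x \<noteq> 0" for x
    proof -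
      obtain n where n: "x = of_int n" using \<open>x \<in> range of_int\<close> by blast
      then have "n \<noteq> 0" using \<open>x \<noteq> 0\<close> by auto
      then show ?thesis unfolding n N by simp
    qed
    fix x y :: 'a assume "x \<in> range of_int" "y \<in> range of_int"
    then obtain m n where mn: "x = of_int m" "y = of_int n" by blast
    show "x * y = y * x" unfolding mn by (simp flip: of_int_mult add: mult.commute)
    show "N (x * y) = N x * N y" unfolding mn of_int_mult[symmetric] N by (simp add: abs_mult)
    show "N (x + y) \<le> N x + N y" unfolding mn of_int_add[symmetric] N by simp
  qed
  moreover have "N 2 > 1" using N[of 2] by simp
  ultimately show ?thesis by blast
qed

text \<open>A relation has finitely many coefficients, so they all lie in one member of the
  chain.\<close>

lemma not_alg_Union_chain:
  assumes "subset.chain \<A> \<C>" "\<C> \<noteq> {}" "\<And>k. k \<in> \<C> \<Longrightarrow> \<not> alg_over k x"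
  shows "\<not> alg_over (\<Union>\<C>) x"
proof
  assume "alg_over (\<Union>\<C>) x"
  then obtain n c where c: "\<forall>i\<le>n. c i \<in> \<Union>\<C>" "c n \<noteq> 0" "(\<Sum>i\<le>n. c i * x ^ i) = 0"
    unfolding alg_over_def by blast
  have "finite (c ` {..n})" "c ` {..n} \<subseteq> \<Union>\<C>" using c(1) by auto
  then obtain k where "k \<in> \<C>" "c ` {..n} \<subseteq> k"
    using finite_subset_Union_chain[OF _ _ assms(2,1)] by metis
  then have "alg_over k x" unfolding alg_over_def using c by (intro exI[of _ n] exI[of _ c]) auto
  then show False using assms(3) \<open>k \<in> \<C>\<close> by blast
qed

lemma sring_Union_chain:
  assumes "subset.chain \<A> \<C>" "\<C> \<noteq> {}" "\<And>k. k \<in> \<C> \<Longrightarrow> sring k"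
  shows "sring (\<Union>\<C>)"
proof -
  have two: "\<exists>k\<in>\<C>. x \<in> k \<and> y \<in> k" if xy: "x \<in> \<Union>\<C>" "y \<in> \<Union>\<C>" for x y
  proof -
    have "finite {x, y}" "{x, y} \<subseteq> \<Union>\<C>" using xy by auto
    then obtain k where "k \<in> \<C>" "{x, y} \<subseteq> k"
      using finite_subset_Union_chain[OF _ _ assms(2,1)] by metis
    then show ?thesis by auto
  qed
  obtain k where k: "k \<in> \<C>" using assms(2) by blast
  show ?thesis unfolding sring_def
  proof (intro conjI ballI)
    show "0 \<in> \<Union>\<C>" "1 \<in> \<Union>\<C>" using sringD(1,2)[OF assms(3)[OF k]] k by auto
    fix x assume x: "x \<in> \<Union>\<C>"
    then show "- x \<in> \<Union>\<C>" using sringD(5)[OF assms(3)] by blast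
    fix y assume "y \<in> \<Union>\<C>"
    then obtain l where l: "l \<in> \<C>" "x \<in> l" "y \<in> l" using two[OF x] by blast
    then show "x + y \<in> \<Union>\<C>" "x * y \<in> \<Union>\<C>" using sringD(3,4)[OF assms(3)[OF l(1)] l(2,3)] by blast+
  qed
qed

text \<open>Exchange: if \<open>x\<close> were algebraic over \<open>k[z]\<close>, then \<open>z\<close> would be algebraic over \<open>k[x]\<close>.\<close>

lemma transcendental_exchange:
  assumes k: "sring k" and zx: "z * x = x * z" and kz: "\<And>c. c \<in> k \<Longrightarrow> c * z = z * c"
    and tr: "\<not> alg_over k x" and z: "\<not> alg_over (adjoin k x) z"
  shows "\<not> alg_over (adjoin k z) x"
proof
  assume "alg_over (adjoin k z) x"
  then obtain n p where p: "\<And>i. i \<le> n \<Longrightarrow> p i \<in> adjoin k z" "p n \<noteq> 0" "(\<Sum>i\<le>n. p i * x ^ i) = 0"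
    unfolding alg_over_def by blast
  \<comment> \<open>A common degree bound in \<open>z\<close> turns the relation into a finite
    double sum.\<close>
  have "\<exists>m. \<forall>i\<le>n. p i \<in> polys k z m"
  proof -
    have "\<forall>i\<in>{..n}. \<exists>m. p i \<in> polys k z m" using p(1) unfolding adjoin_def by auto
    then obtain f where f: "\<And>i. i \<le> n \<Longrightarrow> p i \<in> polys k z (f i)" by (metis atMost_iff)
    have "p i \<in> polys k z (Max (f ` {..n}))" if "i \<le> n" for i
      using f[OF that] polys_mono[of "f i" "Max (f ` {..n})" k z] that by auto
    then show ?thesis by blast
  qed
  then obtain m where "\<And>i. i \<le> n \<Longrightarrow> p i \<in> polys k z m" by blast
  then have "\<forall>i\<in>{..n}. \<exists>c. (\<forall>j. c j \<in> k) \<and> p i = (\<Sum>j<m. c j * z ^ j)" using polys_repr[OF k] by auto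
  then obtain c where c: "\<And>i j. i \<le> n \<Longrightarrow> c i j \<in> k" "\<And>i. i \<le> n \<Longrightarrow> p i = (\<Sum>j<m. c i j * z ^ j)"
    by (metis atMost_iff)
  \<comment> \<open>After exchanging the summations, \<open>q j\<close> is the coefficient of
    \<open>z ^ j\<close>, a polynomial in \<open>x\<close>.\<close>
  define q where "q j = (\<Sum>i\<le>n. c i j * x ^ i)" for j
  have qB: "q j \<in> adjoin k x" for j
    unfolding q_def adjoin_def lessThan_Suc_atMost[symmetric]
    using polys_sumI[OF k, of "Suc n" "\<lambda>i. c i j" x] c(1) by auto
  have zxp: "z ^ j * x ^ i = x ^ i * z ^ j" for i j
    using power_commuting_commutes[OF power_commuting_commutes[OF zx, of j, symmetric], of i] by simp
  have m0: "m \<noteq> 0" using p(2) c(2)[of n] by (intro notI) simp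
  have "(\<Sum>j<m. q j * z ^ j) = (\<Sum>j<m. \<Sum>i\<le>n. c i j * z ^ j * x ^ i)"
    unfolding q_def sum_distrib_right by (simp add: mult.assoc zxp)
  also have "\<dots> = (\<Sum>i\<le>n. \<Sum>j<m. c i j * z ^ j * x ^ i)" by (rule sum.swap)
  also have "\<dots> = (\<Sum>i\<le>n. p i * x ^ i)" by (intro sum.cong refl) (simp add: c(2) sum_distrib_right)
  finally have "(\<Sum>j\<le>m - 1. q j * z ^ j) = 0" using p(3) m0 by (simp add: lessThan_Suc_atMost[symmetric])
  then have q0: "q j = 0" if "j < m" for j
    using not_alg_zero[OF z, of "m - 1" q j] qB that by simp
  \<comment> \<open>Transcendence of \<open>z\<close> kills every \<open>q j\<close>; transcendence
    of \<open>x\<close> then kills its coefficients, among them those of \<open>p n\<close>.\<close>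
  have "c n j = 0" if "j < m" for j
    using not_alg_zero[OF tr, of n "\<lambda>i. c i j" n] c(1) q0[OF that] unfolding q_def by simp
  then show False using c(2)[of n] p(2) by simp
qed

text \<open>If some \<open>x\<close> in \<open>K\<close> is transcendental over the prime subring,
  Zorn's lemma gives a subring \<open>k\<close> maximal among those over which \<open>x\<close>
  stays transcendental, and \<open>adjoin k x\<close> is the valued subring. Otherwise the prime
  subring serves in characteristic \<open>0\<close>, and positive characteristic is the second
  alternative.\<close>

lemma exists_valued_subring:
  fixes K :: "'a::division_ring set"
  assumes K: "sring K" and comm: "\<And>x y. x \<in> K \<Longrightarrow> y \<in> K \<Longrightarrow> x * y = y * x"
  shows "(\<exists>B N. valued_ring B N \<and> B \<subseteq> K \<and> (\<exists>b\<in>B. N b > 1) \<and> (\<forall>z\<in>K. alg_over B z)) \<or>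
    ((\<exists>n>0. of_nat n = (0::'a)) \<and> (\<forall>z\<in>K. alg_over (range of_int) z))"
proof -
  let ?P = "range of_int :: 'a set"
  have PK: "?P \<subseteq> K" by (rule range_of_int_subset[OF K])
  show ?thesis
  proof (cases "\<forall>z\<in>K. alg_over ?P z")
    case True
    show ?thesis
    proof (cases "\<exists>n>0. of_nat n = (0::'a)")
      case False
      obtain N where N: "valued_ring ?P N" "N 2 > 1" using valued_ring_int[OF False] by blast
      have "2 \<in> ?P" by (rule range_eqI[of _ _ 2]) simp
      then show ?thesis using N PK True by blast
    qed (use True in blast)
  next
    case False
    then obtain x where x: "x \<in> K" "\<not> alg_over ?P x" by blast
    define \<A> where "\<A> = {k. sring k \<and> k \<subseteq> K \<and> \<not> alg_over k x}"
    have "?P \<in> \<A>" unfolding \<A>_def using sring_range_of_int PK x by simp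
    then have "\<A> \<noteq> {}" by blast
    moreover have "\<Union>\<C> \<in> \<A>" if C: "\<C> \<noteq> {}" "subset.chain \<A> \<C>" for \<C>
    proof -
      have CA: "\<C> \<subseteq> \<A>" using C(2) unfolding subset.chain_def by blast
      have "sring (\<Union>\<C>)" by (rule sring_Union_chain[OF C(2,1)]) (use CA \<A>_def in auto)
      moreover have "\<not> alg_over (\<Union>\<C>) x" by (rule not_alg_Union_chain[OF C(2,1)]) (use CA \<A>_def in auto)
      moreover have "\<Union>\<C> \<subseteq> K" using CA \<A>_def by blast
      ultimately show ?thesis unfolding \<A>_def by simp
    qed
    ultimately obtain k where kA: "k \<in> \<A>" and max: "\<forall>l\<in>\<A>. k \<subseteq> l \<longrightarrow> l = k"
      using subset_Zorn_nonempty[of \<A>] by metis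
    then have k: "sring k" "k \<subseteq> K" "\<not> alg_over k x" unfolding \<A>_def by auto
    have kc: "c * y = y * c" if "c \<in> k" "y \<in> K" for c y using comm k(2) that by blast
    obtain N where N: "valued_ring (adjoin k x) N" "N x > 1"
      using valued_ring_adjoin[OF k(1) _ _ k(3)] kc k(2) x(1) by (metis subsetD)
    have "alg_over (adjoin k x) z" if z: "z \<in> K" for z
    proof (rule ccontr)
      assume na: "\<not> alg_over (adjoin k x) z"
      \<comment> \<open>By exchange, \<open>adjoin k z\<close> competes with the maximal
        \<open>k\<close>, so \<open>z\<close> lies in \<open>k\<close>. But then \<open>z\<close>
        satisfies a linear equation over \<open>adjoin k x\<close>.\<close>
      have "\<not> alg_over (adjoin k z) x"
        by (rule transcendental_exchange[OF k(1) comm[OF z x(1)] kc[OF _ z] k(3) na])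
      then have "adjoin k z \<in> \<A>"
        unfolding \<A>_def using sring_adjoin[OF k(1) kc[OF _ z]] adjoin_subset[OF K k(2) z] by simp
      moreover have "k \<subseteq> adjoin k z" using adjoin_base[OF k(1)] by blast
      ultimately have "adjoin k z = k" using max by blast
      then have zk: "z \<in> k" using adjoin_gen[OF k(1)] by blast
      have sx: "sring (adjoin k x)" using sring_adjoin[OF k(1) kc[OF _ x(1)]] .
      have "alg_over (adjoin k x) z"
      proof (rule alg_overI[of 1 "\<lambda>i. if i = 0 then - z else 1" _ 1])
        show "(if i = 0 then - z else 1) \<in> adjoin k x" for i :: nat
          using sringD(2,5)[OF sx] adjoin_base[OF k(1) zk] by auto
      qed auto
      then show False using na by blast
    qed
    moreover have "adjoin k x \<subseteq> K" using adjoin_subset[OF K k(2) x(1)] .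
    ultimately show ?thesis using N adjoin_gen[OF k(1)] by blast
  qed
qed

subsection \<open>Wedderburn's little theorem\<close>

lemma finite_order:
  assumes "finite D" "sring D" "x \<in> D" "x \<noteq> (0::'a::division_ring)"
  shows "\<exists>n>0. x ^ n = 1"
proof -
  have "range (\<lambda>n. x ^ n) \<subseteq> D" using sring_power[OF assms(2,3)] by blast
  then have "\<not> inj (\<lambda>n::nat. x ^ n)" using assms(1) finite_subset finite_imageD by blast
  then obtain i j :: nat where "i < j" "x ^ i = x ^ j" unfolding inj_def by (metis linorder_neqE_nat)
  moreover from \<open>i < j\<close> have "x ^ j = x ^ i * x ^ (j - i)" by (simp flip: power_add)
  ultimately have "x ^ i * x ^ (j - i) = x ^ i * 1" by simp
  then have "x ^ (j - i) = 1" using assms(4) by (simp only: mult_cancel_left) simp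
  then show ?thesis using \<open>i < j\<close> by (intro exI[of _ "j - i"]) simp
qed

lemma finite_sring_inverse:
  assumes "finite D" "sring D" "x \<in> D" shows "inverse x \<in> D"
proof (cases "x = 0")
  case False
  then obtain n where n: "n > 0" "x ^ n = 1" using finite_order assms by blast
  then have "x * x ^ (n - 1) = 1" by (simp flip: power_Suc)
  then have "inverse x = x ^ (n - 1)" by (rule inverse_unique)
  then show ?thesis using sring_power[OF assms(2,3)] by simp
qed (use assms in simp)

lemma common_exponent:
  assumes "finite A" "\<And>x. x \<in> A \<Longrightarrow> \<exists>n>0. x ^ n = (1::'a::division_ring)"
  shows "\<exists>m>0. \<forall>x\<in>A. x ^ m = 1"
  using assms
proof (induction A rule: finite_induct)
  case empty
  show ?case by (intro exI[of _ 1]) simp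
next
  case (insert x A)
  then obtain m where m: "m > 0" "\<forall>x\<in>A. x ^ m = 1" by auto
  obtain n where n: "n > 0" "x ^ n = 1" using insert.prems[of x] by auto
  have "y ^ (m * n) = 1" if "y \<in> insert x A" for y
  proof (cases "y = x")
    case True
    then show ?thesis using n by (simp add: power_mult mult.commute[of m])
  next
    case False
    then show ?thesis using that m by (simp add: power_mult)
  qed
  then show ?case using m n by (intro exI[of _ "m * n"]) simp
qed

text \<open>Discrete Fourier transform of \<open>y \<mapsto> y * a\<close>: the components are eigenvectors, and they add up to \<open>- d\<close>.\<close>

lemma exists_normalizing:
  fixes L :: "'a::division_ring set"
  assumes L: "finite L" "sring L" and comm: "\<And>x y. x \<in> L \<Longrightarrow> y \<in> L \<Longrightarrow> x * y = y * x"
    and a: "a \<in> L" and d: "d * a \<noteq> a * d"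
    and D: "sring D" "L \<subseteq> D" "d \<in> D"
  obtains w l where "w \<in> D" "w \<noteq> 0" "l \<in> L" "l \<noteq> a" "w * a = l * w"
proof -
  define U where "U = L - {0}"
  have U: "finite U" unfolding U_def using L by simp
  have a0: "a \<noteq> 0" using d by auto
  \<comment> \<open>The least common exponent of \<open>U\<close>: minimality provides, for each
    \<open>0 < i < m\<close>, some \<open>x\<close> with \<open>x ^ i \<noteq> 1\<close>, which
    replaces a cyclic generator.\<close>
  define m where "m = (LEAST m. m > 0 \<and> (\<forall>x\<in>U. x ^ m = 1))"
  have m: "m > 0 \<and> (\<forall>x\<in>U. x ^ m = 1)"
  proof -
    have "\<exists>m>0. \<forall>x\<in>U. x ^ m = 1"
      by (rule common_exponent[OF U]) (use finite_order[OF L] U_def in blast)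
    then show ?thesis unfolding m_def by (rule LeastI_ex)
  qed
  have mmin: "\<exists>x\<in>U. x ^ i \<noteq> 1" if "0 < i" "i < m" for i
    using that not_less_Least[of i "\<lambda>m. m > 0 \<and> (\<forall>x\<in>U. x ^ m = 1)"] unfolding m_def[symmetric] by blast
  have invU: "inverse x \<in> U" if "x \<in> U" for x
    using finite_sring_inverse[OF L] that unfolding U_def by simp
  define v where "v l = (\<Sum>i<m. inverse l ^ i * d * a ^ i)" for l
  have eig: "v l * a = l * v l" if l: "l \<in> U" for l
  proof -
    have l0: "l \<noteq> 0" using l U_def by simp
    define g where "g i = inverse l ^ i * d * a ^ i" for i
    have g: "g i * a = l * g (Suc i)" for i
      using l0 unfolding g_def by (simp add: mult.assoc[symmetric] power_commutes) (simp add: mult.assoc power_commutes)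
    \<comment> \<open>As \<open>m\<close> is an exponent of \<open>U\<close>, shifting the index
      cyclically leaves the sum unchanged.\<close>
    have "g m = g 0" using m invU[OF l] a a0 unfolding g_def U_def by simp
    moreover have "(\<Sum>i<m. g (Suc i)) + g 0 = (\<Sum>i<m. g i) + g m"
      using sum.lessThan_Suc_shift[of g m] by (simp add: add.commute)
    ultimately have "(\<Sum>i<m. g (Suc i)) = (\<Sum>i<m. g i)" by simp
    then show ?thesis unfolding v_def g_def[symmetric] sum_distrib_right g
      by (simp add: sum_distrib_left[symmetric])
  qed
  have sumU: "(\<Sum>l\<in>U. inverse l ^ i) = (if i = 0 then - 1 else 0)" if i: "i < m" for i
  proof (cases "i = 0")
    case True
    \<comment> \<open>Translation by \<open>1\<close> permutes \<open>L\<close>, so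
      \<open>card L\<close> vanishes in the ring and \<open>card U\<close> becomes
      \<open>- 1\<close>.\<close>
    have "(\<Sum>x\<in>L. x) = (\<Sum>x\<in>L. x + 1)"
      by (rule sum.reindex_bij_witness[of _ "\<lambda>x. x + 1" "\<lambda>x. x - 1"])
        (use sringD(2,3,6)[OF L(2)] in auto)
    then have "of_nat (card L) = (0::'a)" by (simp add: sum.distrib)
    moreover have "card L = Suc (card U)" unfolding U_def using L sringD(1)[OF L(2)] card_Suc_Diff1 by metis
    ultimately show ?thesis using True by (simp add: add_eq_0_iff)
  next
    case False
    then obtain x where x: "x \<in> U" "x ^ i \<noteq> 1" using mmin i by blast
    have x0: "x \<noteq> 0" using x U_def by simp
    have cl: "l * inverse x = inverse x * l" if "l \<in> U" for l
      using comm that x invU unfolding U_def by blast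
    \<comment> \<open>Multiplication by \<open>inverse x\<close> permutes \<open>U\<close> and
      scales the power sum by \<open>x ^ i \<noteq> 1\<close>, so the sum is zero.\<close>
    have "(\<Sum>l\<in>U. inverse l ^ i) = (\<Sum>l\<in>U. inverse (inverse x * l) ^ i)"
      by (rule sum.reindex_bij_witness[of _ "\<lambda>l. inverse x * l" "\<lambda>l. x * l"])
        (use x0 x invU[OF x(1)] sringD(4)[OF L(2)] in \<open>auto simp: U_def mult.assoc[symmetric]\<close>)
    also have "\<dots> = (\<Sum>l\<in>U. x ^ i * inverse l ^ i)"
    proof (rule sum.cong)
      fix l assume l: "l \<in> U"
      have "inverse (inverse x * l) = x * inverse l"
        using l x0 cl[OF l, symmetric] unfolding U_def by (simp add: nonzero_inverse_mult_distrib)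
      moreover have "(x * inverse l) ^ j = x ^ j * inverse l ^ j" for j
      proof (induction j)
        case (Suc j)
        have "inverse l * x ^ j = x ^ j * inverse l"
          using comm invU[OF l] sring_power[OF L(2)] x unfolding U_def by blast
        then show ?case using Suc by (simp add: mult.assoc[symmetric]) (simp add: mult.assoc)
      qed simp
      ultimately show "inverse (inverse x * l) ^ i = x ^ i * inverse l ^ i" by simp
    qed simp
    also have "\<dots> = x ^ i * (\<Sum>l\<in>U. inverse l ^ i)" by (simp add: sum_distrib_left)
    finally have "(x ^ i - 1) * (\<Sum>l\<in>U. inverse l ^ i) = 0" by (simp add: left_diff_distrib)
    then show ?thesis using x(2) False by simp
  qed
  have "(\<Sum>l\<in>U. v l) = (\<Sum>i<m. (\<Sum>l\<in>U. inverse l ^ i) * d * a ^ i)"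
    unfolding v_def sum_distrib_right by (rule sum.swap)
  also have "\<dots> = (\<Sum>i<m. if i = 0 then - d else 0)"
    by (rule sum.cong) (auto simp: sumU)
  also have "\<dots> = - d" using m by simp
  finally have sv: "(\<Sum>l\<in>U. v l) = - d" .
  have aU: "a \<in> U" using a a0 U_def by simp
  \<comment> \<open>If only the component with eigenvalue \<open>a\<close> survived,
    \<open>d = - v a\<close> would commute with \<open>a\<close>.\<close>
  have "\<exists>l\<in>U. l \<noteq> a \<and> v l \<noteq> 0"
  proof (rule ccontr)
    assume "\<not> ?thesis"
    then have "sum v (U - {a}) = 0" by (intro sum.neutral) blast
    then have "(\<Sum>l\<in>U. v l) = v a" using sum.remove[OF U aU, of v] by simp
    then have "d = - v a" using sv by (metis minus_minus)
    then have "d * a = a * d" using eig[OF aU] by simp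
    then show False using d by blast
  qed
  then obtain l where l: "l \<in> U" "l \<noteq> a" "v l \<noteq> 0" by blast
  have "v l \<in> D" unfolding v_def
  proof (rule sring_sum[OF D(1)])
    fix i
    have "inverse l \<in> D" "a \<in> D" using invU[OF l(1)] a D(2) U_def by auto
    then show "inverse l ^ i * d * a ^ i \<in> D"
      by (intro sringD(4)[OF D(1)] sring_power[OF D(1)] D(3))
  qed
  then show ?thesis using that[of "v l" l] l eig[OF l(1)] U_def by simp
qed

text \<open>Dedekind's independence argument: evaluating the relation at \<open>a * z\<close> and
  subtracting \<open>e k\<close> times the original removes the index \<open>k\<close> and
  multiplies the other coefficients by \<open>e i - e k\<close>, which is nonzero. The maps are left
  general to cover both conjugation and left multiplication by powers of \<open>d\<close>.\<close>

lemma eigen_independent: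
  fixes \<phi> :: "nat \<Rightarrow> 'a::division_ring \<Rightarrow> 'a"
  assumes "finite I" "\<And>z. z \<in> Z \<Longrightarrow> a * z \<in> Z"
    and "\<And>i z. i \<in> I \<Longrightarrow> z \<in> Z \<Longrightarrow> \<phi> i (a * z) = e i * \<phi> i z"
    and "inj_on e I" "\<And>i j. i \<in> I \<Longrightarrow> j \<in> I \<Longrightarrow> e i * e j = e j * e i"
    and "\<And>i j. i \<in> I \<Longrightarrow> j \<in> I \<Longrightarrow> e j * m i = m i * e j"
    and "\<And>z. z \<in> Z \<Longrightarrow> (\<Sum>i\<in>I. m i * \<phi> i z) = 0"
  shows "\<forall>i\<in>I. \<forall>z\<in>Z. m i * \<phi> i z = 0"
  using assms(1,3-)
proof (induction I arbitrary: m rule: finite_induct)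
  case (insert k I)
  define m' where "m' i = m i * (e i - e k)" for i
  have "(\<Sum>i\<in>I. m' i * \<phi> i z) = 0" if z: "z \<in> Z" for z
  proof -
    have "0 = (\<Sum>i\<in>insert k I. m i * \<phi> i (a * z)) - e k * (\<Sum>i\<in>insert k I. m i * \<phi> i z)"
      using insert.prems(5) assms(2) z by simp
    also have "\<dots> = (\<Sum>i\<in>insert k I. m i * \<phi> i (a * z) - e k * (m i * \<phi> i z))"
      by (simp only: sum_distrib_left sum_subtractf)
    also have "\<dots> = (\<Sum>i\<in>insert k I. m' i * \<phi> i z)"
    proof (rule sum.cong)
      fix i assume i: "i \<in> insert k I"
      have "e k * (m i * \<phi> i z) = m i * (e k * \<phi> i z)"
        using insert.prems(4)[OF i, of k] by (simp add: mult.assoc[symmetric])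
      then show "m i * \<phi> i (a * z) - e k * (m i * \<phi> i z) = m' i * \<phi> i z"
        using insert.prems(1)[OF i z] by (simp add: m'_def left_diff_distrib right_diff_distrib mult.assoc)
    qed simp
    also have "\<dots> = (\<Sum>i\<in>I. m' i * \<phi> i z)" using insert.hyps by (simp add: m'_def)
    finally show ?thesis by simp
  qed
  moreover have "e j * m' i = m' i * e j" if "i \<in> I" "j \<in> I" for i j
  proof -
    have 1: "e j * m i = m i * e j" "e j * e i = e i * e j" "e j * e k = e k * e j"
      using insert.prems(3,4) that by auto
    have "e j * m' i = m i * e j * (e i - e k)" unfolding m'_def using 1(1) by (simp add: mult.assoc[symmetric])
    also have "\<dots> = m i * (e j * (e i - e k))" by (simp add: mult.assoc)
    also have "e j * (e i - e k) = (e i - e k) * e j" using 1 by (simp add: left_diff_distrib right_diff_distrib)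
    finally show ?thesis by (simp add: m'_def mult.assoc)
  qed
  ultimately have IH: "\<forall>i\<in>I. \<forall>z\<in>Z. m' i * \<phi> i z = 0"
    using insert.IH[of m'] insert.prems(1-3) by (simp add: inj_on_insert)
  have I: "m i * \<phi> i z = 0" if "i \<in> I" "z \<in> Z" for i z
  proof -
    have "e i \<noteq> e k" using inj_onD[OF insert.prems(2), of i k] insert.hyps(2) that(1) by auto
    then show ?thesis using IH that unfolding m'_def by auto
  qed
  have "m k * \<phi> k z = 0" if "z \<in> Z" for z
    using insert.prems(5)[OF that] I[OF _ that] insert.hyps by simp
  then show ?case using I by blast
qed simp

lemma card_eq_sum_fibers: "finite A \<Longrightarrow> card A = (\<Sum>y\<in>f ` A. card {x\<in>A. f x = y})"
  using sum.image_gen[of A "\<lambda>_. 1::nat" f] by simp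

text \<open>Counting: the fibers of the norm \<open>u \<mapsto> (u * d) ^ r\<close> are controlled by Hilbert 90, so the norm
  is onto the fixed field and some \<open>(u * d) ^ r\<close> equals \<open>1\<close>.\<close>

lemma no_finite_cyclic_algebra:
  fixes A :: "'a::division_ring set"
  assumes A: "finite A" "sring A" and comm: "\<And>x y. x \<in> A \<Longrightarrow> y \<in> A \<Longrightarrow> x * y = y * x"
    and a: "a \<in> A" and d: "d \<noteq> 0" "\<And>z. z \<in> A \<Longrightarrow> d * z * inverse d \<in> A"
    and r: "r > 1" "d ^ r \<in> A" "\<And>i. 0 < i \<Longrightarrow> i < r \<Longrightarrow> d ^ i * a \<noteq> a * d ^ i"
  shows False
proof -
  define U where "U = A - {0}"
  define \<phi> where "\<phi> i z = d ^ i * z * inverse (d ^ i)" for i z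
  have invA: "inverse x \<in> A" if "x \<in> A" for x using finite_sring_inverse[OF A that] .
  have UA: "x \<in> A" "x \<noteq> 0" if "x \<in> U" for x using that U_def by auto
  have Um: "x * y \<in> U" if "x \<in> U" "y \<in> U" for x y using that sringD(4)[OF A(2)] unfolding U_def by simp
  have Ui: "inverse x \<in> U" if "x \<in> U" for x using that invA unfolding U_def by simp
  have dphi: "d ^ i * z = \<phi> i z * d ^ i" for i z unfolding \<phi>_def using d(1) by (simp add: mult.assoc)
  have \<phi>0: "\<phi> 0 z = z" for z unfolding \<phi>_def by simp
  have \<phi>Suc: "\<phi> (Suc i) z = d * \<phi> i z * inverse d" for i z
    unfolding \<phi>_def using d(1) by (simp add: nonzero_inverse_mult_distrib power_commutes mult.assoc)
  have \<phi>A: "\<phi> i z \<in> A" if "z \<in> A" for i z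
    by (induction i) (use that \<phi>0 \<phi>Suc d(2) in auto)
  have \<phi>U: "\<phi> i z \<in> U" if "z \<in> U" for i z
    using \<phi>A[of z i] UA[OF that] d(1) unfolding U_def \<phi>_def by simp
  have \<phi>mult: "\<phi> i (x * y) = \<phi> i x * \<phi> i y" for i x y
    unfolding \<phi>_def using d(1) by (simp add: mult.assoc) (simp add: mult.assoc[symmetric])
  define e where "e i = \<phi> i a" for i
  have eA: "e i \<in> A" for i unfolding e_def using \<phi>A a by blast
  \<comment> \<open>Equality of \<open>e i\<close> and \<open>e j\<close> would make
    \<open>d ^ (j - i)\<close> commute with \<open>a\<close>, against the hypothesis on
    \<open>r\<close>.\<close>
  have inj: "inj_on e {..<r}"
  proof -
    have "e i \<noteq> e j" if ij: "i < j" "j < r" for i j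
    proof
      assume eq: "e i = e j"
      define n where "n = j - i"
      have "d ^ j = d ^ i * d ^ n" using ij by (simp add: n_def flip: power_add)
      then have "d ^ i * (d ^ n * a) = \<phi> j a * (d ^ i * d ^ n)" using dphi[of j a] by (simp add: mult.assoc)
      also have "\<dots> = d ^ i * (a * d ^ n)" using eq dphi[of i a] unfolding e_def by (simp add: mult.assoc[symmetric])
      finally have "d ^ n * a = a * d ^ n" using d(1) by simp
      moreover have "0 < n" "n < r" using ij unfolding n_def by linarith+
      ultimately show False using r(3) by blast
    qed
    then show ?thesis unfolding inj_on_def by (metis lessThan_iff linorder_neqE_nat)
  qed
  \<comment> \<open>The partial norm: the product of \<open>\<phi> j u\<close> over
    \<open>j < i\<close>. Hence \<open>F u\<close> below is the full norm of \<open>u\<close> times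
    \<open>d ^ r\<close>.\<close>
  define co where "co u i = (u * d) ^ i * inverse (d ^ i)" for u i
  have pw: "(u * d) ^ i = co u i * d ^ i" for u i unfolding co_def using d(1) by (simp add: mult.assoc)
  have co0: "co u 0 = 1" for u unfolding co_def by simp
  have coSuc: "co u (Suc i) = co u i * \<phi> i u" for u i
  proof -
    have "(u * d) ^ Suc i = co u i * (d ^ i * u) * d" by (simp only: power_Suc2 pw mult.assoc)
    also have "\<dots> = co u i * \<phi> i u * d ^ Suc i" by (simp only: dphi power_Suc2 mult.assoc)
    finally show ?thesis unfolding co_def[of u "Suc i"] using d(1) by (simp add: mult.assoc del: power_Suc)
  qed
  have U1: "1 \<in> U" unfolding U_def using sringD(2)[OF A(2)] by simp
  have coU: "co u i \<in> U" if "u \<in> U" for u i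
    by (induction i) (use U1 co0 coSuc Um \<phi>U[OF that] in auto)
  define F where "F u = (u * d) ^ r" for u
  define Kf where "Kf = {z \<in> U. d * z = z * d}"
  have FK: "F u \<in> Kf" if u: "u \<in> U" for u
  proof -
    have "d ^ r \<in> U" using r(2) d(1) unfolding U_def by simp
    then have FU: "F u \<in> U" unfolding F_def pw by (rule Um[OF coU[OF u]])
    have "F u * (u * d) = (u * d) * F u" unfolding F_def by (rule power_commutes)
    moreover have "F u * u = u * F u" using comm UA FU u by blast
    ultimately have "u * (F u * d) = u * (d * F u)" by (metis mult.assoc)
    then have "d * F u = F u * d" using UA(2)[OF u] by simp
    then show ?thesis using FU unfolding Kf_def by simp
  qed
  have hilbert90: "\<exists>v\<in>U. u' = u * v * inverse (\<phi> 1 v)" if u: "u \<in> U" "u' \<in> U" "F u = F u'" for u u'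
  proof -
    define c where "c = u * d"
    define c' where "c' = u' * d"
    have c0: "c \<noteq> 0" "c' \<noteq> 0" unfolding c_def c'_def using UA(2) u d(1) by auto
    \<comment> \<open>The Hilbert 90 sum: since \<open>c ^ r = c' ^ r\<close> commutes with
      \<open>z\<close> in \<open>A\<close>, it satisfies \<open>c' * V z = V z * c\<close>.
      Independence of the \<open>\<phi> i\<close> makes some \<open>V z\<close> nonzero.\<close>
    define V where "V z = (\<Sum>i<r. c' ^ i * z * inverse (c ^ i))" for z
    define m where "m i = co u' i * inverse (co u i)" for i
    have mU: "m i \<in> U" for i unfolding m_def using Um coU Ui u by blast
    have Vterm: "c' ^ i * z * inverse (c ^ i) = m i * \<phi> i z" if "z \<in> A" for i z
    proof -
      have "c' ^ i * z * inverse (c ^ i) = co u' i * (d ^ i * z * inverse (d ^ i)) * inverse (co u i)"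
        unfolding c_def c'_def pw using d(1) UA(2)[OF coU[OF u(1)]]
        by (simp add: nonzero_inverse_mult_distrib mult.assoc)
      also have "\<dots> = co u' i * (\<phi> i z * inverse (co u i))" by (simp add: \<phi>_def mult.assoc)
      also have "\<phi> i z * inverse (co u i) = inverse (co u i) * \<phi> i z"
        using comm \<phi>A[OF that] UA(1)[OF Ui[OF coU[OF u(1)]]] by blast
      finally show ?thesis by (simp add: m_def mult.assoc)
    qed
    have VA: "V z \<in> A" if "z \<in> A" for z unfolding V_def
      by (rule sring_sum[OF A(2)]) (use Vterm[OF that] sringD(4)[OF A(2)] UA(1)[OF mU] \<phi>A[OF that] in auto)
    have "\<exists>z\<in>A. V z \<noteq> 0"
    proof (rule ccontr)
      assume no: "\<not> ?thesis"
      have "\<forall>i\<in>{..<r}. \<forall>z\<in>A. m i * \<phi> i z = 0"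
      proof (rule eigen_independent[of _ A a \<phi> e])
        show "(\<Sum>i\<in>{..<r}. m i * \<phi> i z) = 0" if "z \<in> A" for z
          using no that unfolding V_def by (simp add: Vterm)
        show "\<phi> i (a * z) = e i * \<phi> i z" for i z by (simp only: \<phi>mult e_def)
        show "a * z \<in> A" if "z \<in> A" for z using sringD(4)[OF A(2) a that] .
        show "e i * e j = e j * e i" for i j using comm[OF eA eA] .
        show "e j * m i = m i * e j" for i j using comm[OF eA UA(1)[OF mU]] .
      qed (use inj in auto)
      moreover have "0 \<in> {..<r}" using r(1) by simp
      ultimately have "m 0 * \<phi> 0 1 = 0" using sringD(2)[OF A(2)] by blast
      then show False using UA(2)[OF mU] \<phi>0 by simp
    qed
    then obtain z where z: "z \<in> A" "V z \<noteq> 0" by blast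
    define v where "v = V z"
    have vU: "v \<in> U" using z VA unfolding v_def U_def by simp
    have "c' * v = v * c"
    proof -
      define g where "g i = c' ^ i * z * inverse (c ^ i)" for i
      have "c' * g i * inverse c = g (Suc i)" for i
        unfolding g_def using c0 by (simp add: nonzero_inverse_mult_distrib power_commutes mult.assoc)
      then have "c' * v * inverse c = (\<Sum>i<r. g (Suc i))"
        unfolding v_def V_def g_def[symmetric] by (simp add: sum_distrib_left sum_distrib_right)
      also have "\<dots> = (\<Sum>i<r. g i)"
      proof -
        have "c ^ r = F u" "c' ^ r = F u" using u(3) unfolding F_def c_def c'_def by auto
        moreover have "F u * z = z * F u" using comm z(1) UA(1) FK[OF u(1)] unfolding Kf_def by blast
        ultimately have "g r = z" unfolding g_def using c0(1) by (simp add: mult.assoc) (metis mult.right_neutral right_inverse power_not_zero)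
        then have "g r = g 0" unfolding g_def by simp
        then show ?thesis using sum.lessThan_Suc_shift[of g r] by (simp add: add.commute)
      qed
      also have "\<dots> = v" unfolding v_def V_def g_def ..
      finally have "c' * v * inverse c * c = v * c" by simp
      then show ?thesis using c0(1) by (simp add: mult.assoc)
    qed
    then have eq: "u' * (d * v) = v * u * d" unfolding c_def c'_def by (simp add: mult.assoc)
    have "d * v = \<phi> 1 v * d" using dphi[of 1 v] by simp
    then have "u' * \<phi> 1 v = v * u" using eq d(1) by (simp add: mult.assoc[symmetric])
    also have "v * u = u * v" using comm UA(1) vU u(1) by blast
    finally have "u' * \<phi> 1 v * inverse (\<phi> 1 v) = u * v * inverse (\<phi> 1 v)" by simp
    then have "u' = u * v * inverse (\<phi> 1 v)" using UA(2)[OF \<phi>U[OF vU]] by (simp add: mult.assoc)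
    then show ?thesis using vU by blast
  qed
  have fU: "finite U" unfolding U_def using A by simp
  have KU: "Kf \<subseteq> U" "1 \<in> Kf" unfolding Kf_def using U1 by auto
  have fK: "finite Kf" using KU(1) fU finite_subset by blast
  \<comment> \<open>Hilbert 90 covers the fiber by the image of a map \<open>\<psi>\<close> on
    \<open>U\<close>, each of whose fibers contains a set \<open>v * Kf\<close>.\<close>
  have fib: "card {u'\<in>U. F u' = y} * card Kf \<le> card U" if y: "y \<in> F ` U" for y
  proof -
    obtain u where u: "u \<in> U" "F u = y" using y by blast
    define \<psi> where "\<psi> v = u * v * inverse (\<phi> 1 v)" for v
    have "{u'\<in>U. F u' = y} \<subseteq> \<psi> ` U" using hilbert90[OF u(1)] u(2) unfolding \<psi>_def by blast
    then have "card {u'\<in>U. F u' = y} \<le> card (\<psi> ` U)" using fU by (intro card_mono) auto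
    moreover have "card (\<psi> ` U) * card Kf \<le> card U"
    proof -
      have "card Kf \<le> card {v\<in>U. \<psi> v = w}" if w: "w \<in> \<psi> ` U" for w
      proof -
        obtain v where v: "v \<in> U" "\<psi> v = w" using w by blast
        have "\<psi> (v * k) = w" if k: "k \<in> Kf" for k
        proof -
          have kU: "k \<in> U" using k KU by blast
          have "\<phi> 1 k = k" unfolding \<phi>_def using k d(1) unfolding Kf_def by (simp add: mult.assoc)
          then have "inverse (\<phi> 1 (v * k)) = inverse k * inverse (\<phi> 1 v)"
            unfolding \<phi>mult using UA(2)[OF \<phi>U[OF v(1)]] UA(2)[OF kU] by (simp add: nonzero_inverse_mult_distrib)
          then have "\<psi> (v * k) = u * v * (k * inverse k) * inverse (\<phi> 1 v)"
            unfolding \<psi>_def by (simp only: mult.assoc)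
          also have "\<dots> = w" using UA(2)[OF kU] v(2) unfolding \<psi>_def by simp
          finally show ?thesis .
        qed
        then have "(\<lambda>k. v * k) ` Kf \<subseteq> {v\<in>U. \<psi> v = w}" using Um v(1) KU(1) by blast
        moreover have "inj_on (\<lambda>k. v * k) Kf" using UA(2)[OF v(1)] by (auto simp: inj_on_def)
        ultimately show ?thesis using fU card_inj_on_le[of "\<lambda>k. v * k" Kf "{v\<in>U. \<psi> v = w}"] by simp
      qed
      then have "(\<Sum>w\<in>\<psi> ` U. card Kf) \<le> (\<Sum>w\<in>\<psi> ` U. card {v\<in>U. \<psi> v = w})" by (rule sum_mono)
      then show ?thesis using card_eq_sum_fibers[OF fU, of \<psi>] by simp
    qed
    ultimately show ?thesis using mult_le_mono1 order_trans by blast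
  qed
  \<comment> \<open>Summing the fiber bounds shows that the image of \<open>F\<close> has at least
    \<open>card Kf\<close> elements; as it lies in \<open>Kf\<close>, it contains
    \<open>1\<close>.\<close>
  have "card U * card Kf = (\<Sum>y\<in>F ` U. card {u'\<in>U. F u' = y} * card Kf)"
    using card_eq_sum_fibers[OF fU, of F] by (simp add: sum_distrib_right)
  also have "\<dots> \<le> (\<Sum>y\<in>F ` U. card U)" by (rule sum_mono) (rule fib)
  finally have "card U * card Kf \<le> card U * card (F ` U)" by (simp add: mult.commute)
  moreover have "card U > 0" using fU U1 card_gt_0_iff by blast
  ultimately have "card Kf \<le> card (F ` U)" by simp
  then have "F ` U = Kf" using FK fK by (intro card_seteq) auto
  then obtain u where u: "u \<in> U" "F u = 1" using KU(2) by (metis imageE)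
  \<comment> \<open>Since \<open>c ^ r = 1\<close> and \<open>c \<noteq> 1\<close>, the sum of
    \<open>c ^ i\<close> over \<open>i < r\<close> vanishes. Through \<open>co\<close>, this is a
    left relation over \<open>A\<close> between powers of \<open>d\<close>.\<close>
  define c where "c = u * d"
  have geo: "(c - 1) * (\<Sum>i<n. c ^ i) = c ^ n - 1" for n
  proof (induction n)
    case (Suc n)
    have "(c - 1) * (\<Sum>i<Suc n. c ^ i) = (c - 1) * (\<Sum>i<n. c ^ i) + (c - 1) * c ^ n"
      by (simp add: distrib_left)
    also have "\<dots> = c ^ Suc n - 1" by (simp only: Suc) (simp add: left_diff_distrib)
    finally show ?case .
  qed simp
  have "(c - 1) * (\<Sum>i<r. c ^ i) = 0" unfolding geo using u(2) by (simp add: F_def c_def)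
  moreover have "c \<noteq> 1"
  proof
    assume "c = 1"
    then have "inverse u = d" unfolding c_def by (rule inverse_unique)
    then have "d \<in> A" using UA(1)[OF Ui[OF u(1)]] by simp
    then have "d ^ 1 * a = a * d ^ 1" using comm a by simp
    then show False using r(3)[of 1] r(1) by simp
  qed
  ultimately have sum0: "(\<Sum>i<r. c ^ i) = 0" by simp
  \<comment> \<open>Independence is now applied to left multiplication by \<open>d ^ i\<close>; it
    contradicts the coefficient \<open>co u 0 = 1\<close>.\<close>
  have "\<forall>i\<in>{..<r}. \<forall>z\<in>UNIV. co u i * (d ^ i * z) = 0"
  proof (rule eigen_independent[of _ UNIV a "\<lambda>i z. d ^ i * z" e])
    show "d ^ i * (a * z) = e i * (d ^ i * z)" for i z
      using dphi[of i a] by (simp add: e_def mult.assoc[symmetric])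
    show "(\<Sum>i<r. co u i * (d ^ i * z)) = 0" for z
      using sum0 unfolding c_def pw by (simp add: mult.assoc[symmetric] sum_distrib_right[symmetric])
    show "e i * e j = e j * e i" for i j using comm[OF eA eA] .
    show "e j * co u i = co u i * e j" for i j using comm[OF eA UA(1)[OF coU[OF u(1)]]] .
  qed (use inj in auto)
  moreover have "0 \<in> {..<r}" using r(1) by simp
  ultimately have "co u 0 * (d ^ 0 * 1) = 0" by blast
  then show False by (simp add: co0)
qed

text \<open>If \<open>a\<close> and \<open>b\<close> did not commute, some \<open>d\<close> would
  satisfy \<open>d * a = l * d\<close> with \<open>l \<noteq> a\<close> in the ring generated by
  \<open>a\<close>. With \<open>r\<close> the least positive exponent for which \<open>d ^ r\<close>
  commutes with \<open>a\<close>, the ring generated by \<open>a\<close> and \<open>d ^ r\<close> is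
  commutative and stable under conjugation by \<open>d\<close>, which
  \<open>no_finite_cyclic_algebra\<close> excludes.\<close>

theorem wedderburn:
  fixes D :: "'a::division_ring set"
  assumes D: "finite D" "sring D" and xy: "a \<in> D" "b \<in> D"
  shows "a * b = b * a"
proof (rule ccontr)
  assume "a * b \<noteq> b * a"
  then have ba: "b * a \<noteq> a * b" by metis
  let ?P = "range of_int :: 'a set"
  define L where "L = adjoin ?P a"
  have P: "sring ?P" by (rule sring_range_of_int)
  have Pc: "c * x = x * c" if "c \<in> ?P" for c x using that by (auto simp: mult_of_int_commute)
  have PD: "?P \<subseteq> D" by (rule range_of_int_subset[OF D(2)])
  have L: "sring L" "L \<subseteq> D" "a \<in> L" unfolding L_def
    using sring_adjoin[OF P Pc] adjoin_subset[OF D(2) PD xy(1)] adjoin_gen[OF P] by auto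
  have fL: "finite L" using L(2) D(1) finite_subset by blast
  have Lcomm: "x * y = y * x" if "x \<in> L" "y \<in> L" for x y
    using adjoin_commute[OF P Pc Pc] that unfolding L_def by blast
  obtain d l where d: "d \<in> D" "d \<noteq> 0" "l \<in> L" "l \<noteq> a" "d * a = l * d"
    using exists_normalizing[OF fL L(1) Lcomm L(3) ba D(2) L(2) xy(2)] by metis
  define r where "r = (LEAST r. r > 0 \<and> d ^ r * a = a * d ^ r)"
  have "\<exists>r>0. d ^ r * a = a * d ^ r" using finite_order[OF D d(1,2)] by (metis mult_1_left mult_1_right)
  then have r: "r > 0 \<and> d ^ r * a = a * d ^ r" unfolding r_def by (rule LeastI_ex)
  have rmin: "d ^ i * a \<noteq> a * d ^ i" if "0 < i" "i < r" for i
    using that not_less_Least[of i "\<lambda>r. r > 0 \<and> d ^ r * a = a * d ^ r"] unfolding r_def[symmetric] by blast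
  have "r \<noteq> 1"
  proof
    assume "r = 1"
    then have "l * d = a * d" using r d(5) by simp
    then show False using d(2,4) by simp
  qed
  then have r1: "r > 1" using r by simp
  have \<beta>D: "d ^ r \<in> D" using sring_power[OF D(2) d(1)] .
  have L\<beta>: "x * d ^ r = d ^ r * x" if "x \<in> L" for x
  proof -
    have "sring {x. x * d ^ r = d ^ r * x}"
      unfolding sring_def by (auto simp: distrib_left distrib_right) (metis mult.assoc)
    moreover have "?P \<subseteq> {x. x * d ^ r = d ^ r * x}" using Pc by blast
    ultimately have "L \<subseteq> {x. x * d ^ r = d ^ r * x}"
      unfolding L_def by (rule adjoin_subset) (use r in simp)
    then show ?thesis using that by blast
  qed
  define A where "A = adjoin L (d ^ r)"
  have A: "sring A" "A \<subseteq> D" "L \<subseteq> A" "d ^ r \<in> A"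
    unfolding A_def using sring_adjoin[OF L(1) L\<beta>] adjoin_subset[OF D(2) L(2) \<beta>D] adjoin_base[OF L(1)] adjoin_gen[OF L(1)] by auto
  have fA: "finite A" using A(2) D(1) finite_subset by blast
  have Acomm: "x * y = y * x" if "x \<in> A" "y \<in> A" for x y
    using adjoin_commute[OF L(1) Lcomm L\<beta>] that unfolding A_def by blast
  \<comment> \<open>The elements that \<open>d\<close> conjugates into \<open>A\<close> form a
    subring, so stability of \<open>A\<close> is checked only on the prime subring, \<open>a\<close>
    and \<open>d ^ r\<close>.\<close>
  define S where "S = {z. d * z * inverse d \<in> A}"
  have S: "sring S"
    unfolding sring_def
  proof (intro conjI ballI)
    show "0 \<in> S" "1 \<in> S" unfolding S_def using sringD(1,2)[OF A(1)] d(2) by auto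
    fix x assume x: "x \<in> S"
    then show "- x \<in> S" unfolding S_def using sringD(5)[OF A(1)] by simp
    fix y assume y: "y \<in> S"
    show "x + y \<in> S" using x y sringD(3)[OF A(1)] unfolding S_def by (simp add: distrib_left distrib_right)
    have "d * (x * y) * inverse d = (d * x * inverse d) * (d * y * inverse d)"
      using d(2) by (simp add: mult.assoc) (simp add: mult.assoc[symmetric])
    then show "x * y \<in> S" using x y sringD(4)[OF A(1)] unfolding S_def by simp
  qed
  have "?P \<subseteq> S"
  proof
    fix x assume x: "x \<in> ?P"
    have "d * x * inverse d = x" using Pc[OF x, of d] d(2) by (simp add: mult.assoc)
      (metis mult.assoc mult_1_right right_inverse)
    then show "x \<in> S" using x A(3) adjoin_base[OF P x] unfolding S_def L_def by auto
  qed
  moreover have "a \<in> S"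
  proof -
    have "d * a * inverse d = l" using d(2,5) by (simp add: mult.assoc)
    then show ?thesis using d(3) A(3) unfolding S_def by auto
  qed
  ultimately have LS: "L \<subseteq> S" unfolding L_def by (intro adjoin_subset[OF S])
  have "d * d ^ r * inverse d = d ^ r" using d(2) by (simp add: power_commutes[symmetric] mult.assoc)
  then have "d ^ r \<in> S" using A(4) unfolding S_def by simp
  then have AS: "A \<subseteq> S" unfolding A_def by (rule adjoin_subset[OF S LS])
  show False
    by (rule no_finite_cyclic_algebra[OF fA A(1) Acomm _ d(2) _ r1 A(4) rmin])
      (use A(3) L(3) AS S_def in auto)
qed

subsection \<open>Finitely generated subnormal subgroups\<close>

lemma group_units_grp: "group (units_grp :: 'a::division_ring monoid)"
  by (rule groupI) (auto simp: units_grp_def mult.assoc intro: exI[of _ "inverse _"] left_inverse)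

lemma inv_units_grp: "x \<noteq> 0 \<Longrightarrow> inv\<^bsub>units_grp\<^esub> x = inverse (x::'a::division_ring)"
  by (rule group.inv_equality[OF group_units_grp]) (auto simp: units_grp_def)

lemma is_division_subring_gen: "is_division_subring (div_subring_gen S)"
  unfolding div_subring_gen_def is_division_subring_def by blast

lemma div_subring_gen_incl: "S \<subseteq> div_subring_gen S"
  unfolding div_subring_gen_def by blast

text \<open>Each conjugation moves one step down the chain, because \<open>h\<close> lies in every
  term. The step beyond \<open>n\<close> stays in the subgroup \<open>H\<close> and makes the index
  positive, as \<open>conj_iter_rigid\<close> expects.\<close>

lemma subnormal_conj_iter:
  fixes H :: "'a::division_ring set"
  assumes "subnormal units_grp H" and H: "subgroup H units_grp" and h: "h \<in> H"
  obtains n where "\<And>x. x \<noteq> 0 \<Longrightarrow> conj_iter h (Suc n) x \<in> H"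
proof -
  let ?G = "units_grp :: 'a monoid"
  obtain N n where N: "N 0 = H" "N n = carrier ?G"
    "\<And>i. i < n \<Longrightarrow> subgroup (N (Suc i)) ?G" "\<And>i. i < n \<Longrightarrow> normal (N i) (?G\<lparr>carrier := N (Suc i)\<rparr>)"
    using assms(1) unfolding subnormal_def by blast
  have nz: "x \<noteq> 0" if "subgroup K ?G" "x \<in> K" for K x
    using subgroup.subset[OF that(1)] that(2) by (auto simp: units_grp_def)
  have conj: "y * g * inverse y \<in> N i" if i: "i < n" and y: "y \<in> N (Suc i)" and g: "g \<in> N i" for i y g
  proof -
    have "y \<otimes>\<^bsub>?G\<lparr>carrier := N (Suc i)\<rparr>\<^esub> g \<otimes>\<^bsub>?G\<lparr>carrier := N (Suc i)\<rparr>\<^esub> inv\<^bsub>?G\<lparr>carrier := N (Suc i)\<rparr>\<^esub> y \<in> N i"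
      using normal.inv_op_closed2[OF N(4)[OF i]] y g by simp
    moreover have "inv\<^bsub>?G\<lparr>carrier := N (Suc i)\<rparr>\<^esub> y = inverse y"
      using group.m_inv_consistent[OF group_units_grp N(3)[OF i] y] inv_units_grp[OF nz[OF N(3)[OF i] y]] by simp
    ultimately show ?thesis by (simp add: units_grp_def)
  qed
  have hN: "h \<in> N i" if "i \<le> n" for i
    using that
  proof (induction i)
    case 0
    show ?case using N(1) h by simp
  next
    case (Suc i)
    have "N i \<subseteq> N (Suc i)"
      using normal.axioms(1)[OF N(4)] subgroup.subset[of "N i" "?G\<lparr>carrier := N (Suc i)\<rparr>"] Suc.prems by simp
    then show ?case using Suc by auto
  qed
  have "conj_iter h (Suc n) x \<in> H" if x: "x \<noteq> 0" for x
  proof -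
    have "k \<le> n \<Longrightarrow> conj_iter h k x \<in> N (n - k)" for k
    proof (induction k)
      case 0
      show ?case using N(2) x by (simp add: units_grp_def)
    next
      case (Suc k)
      define i where "i = n - Suc k"
      have i: "i < n" "n - k = Suc i" using Suc.prems unfolding i_def by linarith+
      then show ?case using conj[OF i(1) _ hN] Suc unfolding i_def[symmetric] by simp
    qed
    then have y: "conj_iter h n x \<in> H" using N(1) by (metis diff_self_eq_0 order_refl)
    have "inverse (conj_iter h n x) \<in> H"
      using subgroup.m_inv_closed[OF H y] inv_units_grp[OF nz[OF H y]] by simp
    then show ?thesis
      using subgroup.m_closed[OF H] y h by (simp add: units_grp_def)
  qed
  then show ?thesis using that by blast
qed

text \<open>Generators, their inverses and \<open>1\<close> each cost one factor \<open>e\<close>;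
  products add the exponents because \<open>e\<close> commutes with \<open>H\<close>.\<close>

lemma generate_power_mem:
  fixes H :: "'a::division_ring set"
  assumes H: "H = generate units_grp S" "S \<subseteq> carrier units_grp"
    and D: "sring D" "H \<subseteq> D" and e: "e \<in> center_of D"
    and M: "\<And>x y. x \<in> M \<Longrightarrow> y \<in> M \<Longrightarrow> x * y \<in> M"
    and g: "e * 1 \<in> M" "\<And>g. g \<in> S \<Longrightarrow> e * g \<in> M" "\<And>g. g \<in> S \<Longrightarrow> e * inverse g \<in> M"
    and x: "x \<in> H"
  shows "\<exists>j. e ^ j * x \<in> M"
  using x unfolding H(1)
proof (induction x rule: generate.induct)
  case one
  show ?case using g(1) by (intro exI[of _ 1]) (simp add: units_grp_def)
next
  case (incl x)
  show ?case using g(2)[OF incl] by (intro exI[of _ 1]) simp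
next
  case (inv x)
  then have "x \<noteq> 0" using H(2) by (auto simp: units_grp_def)
  then have "inv\<^bsub>units_grp\<^esub> x = inverse x" by (rule inv_units_grp)
  then show ?case using g(3)[OF inv] by (intro exI[of _ 1]) simp
next
  case (eng x y)
  then obtain i j where ij: "e ^ i * x \<in> M" "e ^ j * y \<in> M" by blast
  have "x \<in> D" using eng.hyps D(2) H(1) by blast
  then have "e * x = x * e" using center_commute[OF e] by blast
  then have "e ^ j * x = x * e ^ j" by (rule power_commuting_commutes)
  then have "e ^ (i + j) * (x * y) = (e ^ i * x) * (e ^ j * y)"
    by (simp add: power_add mult.assoc) (metis mult.assoc)
  then show ?case using M[OF ij] by (intro exI[of _ "i + j"]) (simp add: units_grp_def)
qed

text \<open>Any \<open>card T + 1\<close> powers of \<open>e * \<alpha>\<close> in a lattice with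
  \<open>card T\<close> generators are linearly dependent over \<open>B\<close>.\<close>

lemma alg_over_lattice:
  assumes B: "sring B" and comm: "\<And>x y. x \<in> B \<Longrightarrow> y \<in> B \<Longrightarrow> x * y = y * x"
    and T: "finite T" "\<And>x y. x \<in> lspan B T \<Longrightarrow> y \<in> lspan B T \<Longrightarrow> x * y \<in> lspan B T"
    and e: "e \<in> B" "e \<noteq> 0" "e * \<alpha> \<in> lspan B T" "e * \<alpha> = \<alpha> * e" "\<alpha> \<noteq> 0"
  shows "alg_over B \<alpha>"
proof -
  define g where "g = e * \<alpha>"
  \<comment> \<open>Powers start at exponent \<open>1\<close> because \<open>1\<close> need not lie
    in the lattice; one factor \<open>g\<close> is cancelled afterwards.\<close>
  have gp: "g ^ Suc i \<in> lspan B T" for i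
    by (induction i) (use e(3) T(2) g_def in auto)
  obtain d where d: "\<forall>i\<in>{..card T}. d i \<in> B" "\<exists>i\<in>{..card T}. d i \<noteq> 0"
    "(\<Sum>i\<in>{..card T}. d i * g ^ Suc i) = 0"
    using steinitz[OF B comm T(1), of "{..card T}" "\<lambda>i. g ^ Suc i"] gp by auto
  obtain k where k: "k \<le> card T" "d k \<noteq> 0" using d(2) by auto
  have "(\<Sum>i\<le>card T. d i * g ^ i) * g = 0"
    using d(3) by (simp only: sum_distrib_right power_Suc2 mult.assoc)
  moreover have "g \<noteq> 0" unfolding g_def using e by simp
  ultimately have s: "(\<Sum>i\<le>card T. d i * g ^ i) = 0" by simp
  have gi: "g ^ i = e ^ i * \<alpha> ^ i" for i
  proof (induction i)
    case (Suc i)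
    have "\<alpha> * e ^ i = e ^ i * \<alpha>" using power_commuting_commutes[OF e(4), of i] by simp
    then show ?case using Suc unfolding g_def by (simp add: mult.assoc) (metis mult.assoc)
  qed simp
  show ?thesis
  proof (rule alg_overI[of "card T" "\<lambda>i. d i * e ^ i" B k])
    show "d i * e ^ i \<in> B" if "i \<le> card T" for i
      using sringD(4)[OF B] d(1) sring_power[OF B e(1)] that by simp
    show "(\<Sum>i\<le>card T. d i * e ^ i * \<alpha> ^ i) = 0" using s unfolding gi by (simp add: mult.assoc)
  qed (use k e in auto)
qed

theorem theorem5p6:
  fixes H :: "'a::division_ring set"
  assumes "weakly_locally_finite TYPE('a)"
    and "subnormal units_grp H"
    and "finitely_generated_subgroup units_grp H"
  shows "H \<subseteq> center_of (UNIV :: 'a set)"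
proof (rule ccontr)
  assume "\<not> H \<subseteq> center_of (UNIV :: 'a set)"
  then obtain h a0 where h: "h \<in> H" and ha0: "a0 * h \<noteq> h * a0" unfolding center_of_def by force
  obtain S where S: "finite S" "S \<subseteq> carrier units_grp" "H = generate units_grp S" and H: "subgroup H units_grp"
    using assms(3) unfolding finitely_generated_subgroup_def by blast
  \<comment> \<open>Including \<open>a0\<close> keeps the failure of commutativity visible inside
    the finite dimensional subring.\<close>
  define D where "D = div_subring_gen (insert a0 S)"
  have D: "is_division_subring D" unfolding D_def by (rule is_division_subring_gen)
  have sD: "sring D" using D by (rule division_subring_sring)
  have invD: "inverse x \<in> D" if "x \<in> D" for x using D that unfolding is_division_subring_def by blast
  have SD: "S \<subseteq> D" "a0 \<in> D" using div_subring_gen_incl[of "insert a0 S"] unfolding D_def by auto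
  have HD: "H \<subseteq> D"
  proof
    fix x assume "x \<in> H"
    then show "x \<in> D" unfolding S(3)
    proof (induction x rule: generate.induct)
      case (inv x)
      then have "x \<noteq> 0" using S(2) by (auto simp: units_grp_def)
      then have "inv\<^bsub>units_grp\<^esub> x = inverse x" by (rule inv_units_grp)
      then show ?case using invD SD(1) inv by auto
    qed (use SD sringD(2,4)[OF sD] in \<open>auto simp: units_grp_def\<close>)
  qed
  have hD: "h \<in> D" using h HD by blast
  have h0: "h \<noteq> 0" using ha0 by auto
  obtain Bas where Bas: "finite Bas" "Bas \<subseteq> D"
    "D = {\<Sum>b\<in>Bas. c b * b | c. \<forall>b\<in>Bas. c b \<in> center_of D}"
    using assms(1) S(1) unfolding weakly_locally_finite_def fin_dim_over_center_def D_def by (meson finite_insert)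
  let ?Z = "center_of D"
  have sZ: "sring ?Z" using sring_center[OF sD] .
  have ZD: "?Z \<subseteq> D" unfolding center_of_def by blast
  have Zcomm: "x * y = y * x" if "x \<in> ?Z" "y \<in> ?Z" for x y using center_commute[OF that(1)] that(2) ZD by blast
  obtain n where mem: "\<And>x. x \<noteq> 0 \<Longrightarrow> conj_iter h (Suc n) x \<in> H"
    using subnormal_conj_iter[OF assms(2) H h] by blast
  consider (val) B N where "valued_ring B N" "B \<subseteq> ?Z" "\<exists>b\<in>B. N b > 1" "\<forall>z\<in>?Z. alg_over B z"
    | (fin) "\<exists>n>0. of_nat n = (0::'a)" "\<forall>z\<in>?Z. alg_over (range of_int) z"
    using exists_valued_subring[OF sZ Zcomm] by blast
  then show False
  proof cases
    case fin
    let ?P = "range of_int :: 'a set"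
    have P: "sring ?P" "?P \<subseteq> ?Z" using sring_range_of_int range_of_int_subset[OF sZ] .
    obtain p where p: "p > 0" "of_nat p = (0::'a)" using fin(1) by blast
    \<comment> \<open>Remainders modulo \<open>p\<close> represent every integer, so the prime
      subring is finite.\<close>
    have "?P \<subseteq> of_int ` {0..<int p}"
    proof
      fix x :: 'a assume "x \<in> ?P"
      then obtain m where m: "x = of_int m" by blast
      have "x = of_int (int p * (m div int p) + m mod int p)" using m by simp
      also have "\<dots> = of_int (m mod int p)" using p(2) by (simp only: of_int_add of_int_mult of_int_of_nat_eq) simp
      finally show "x \<in> of_int ` {0..<int p}" using p(1) by simp
    qed
    then have fP: "finite ?P" using finite_subset by blast
    have "{1, a0, h} \<subseteq> D" using SD hD sringD(2)[OF sD] by blast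
    then obtain T e where T: "finite T" "T \<subseteq> D" "\<forall>x\<in>lspan ?P T. \<forall>y\<in>lspan ?P T. x * y \<in> lspan ?P T"
      and e: "e \<in> ?P" "e \<noteq> 0" "\<forall>g\<in>{1, a0, h}. e * g \<in> lspan ?P T"
      using exists_order[OF sD Bas P, of "{1, a0, h}"] fin(2) by blast
    let ?M = "lspan ?P T"
    \<comment> \<open>The denominator \<open>e\<close> is invertible in the finite prime subring, so
      the lattice contains \<open>1\<close>, \<open>a0\<close> and \<open>h\<close> themselves and
      is a finite ring.\<close>
    have G: "g \<in> ?M" if "g \<in> {1, a0, h}" for g
    proof -
      have "e * g \<in> ?M" using e(3) that by blast
      then have "inverse e * (e * g) \<in> ?M" by (rule lspan_scale[OF P(1) finite_sring_inverse[OF fP P(1) e(1)]])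
      then show ?thesis using e(2) by (simp add: mult.assoc[symmetric])
    qed
    have "sring ?M" unfolding sring_def
      using T(3) G lspan.zero[of ?P T] by (auto intro: lspan_add lspan_minus[OF P(1)])
    then have "a0 * h = h * a0" using G by (intro wedderburn[OF finite_lspan[OF P(1) fP T(1)]]) auto
    then show False using ha0 by blast
  next
    case val
    interpret valued_ring B N by (rule val(1))
    have BD: "B \<subseteq> D" using val(2) ZD by blast
    have alg: "alg_over B z" if "z \<in> ?Z" for z using val(4) that by blast
    \<comment> \<open>The lattice and its norm are built anew for each \<open>a\<close>, whose
      denominators must be cleared; \<open>B\<close> and \<open>n\<close> stay fixed.\<close>
    have rigid: "(\<exists>t\<in>B. conj_iter h (Suc n) (a + t) = h) \<and> (ad h ^^ Suc n) a = 0"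
      if a: "a \<in> D" "a * h \<noteq> h * a" for a
    proof -
      have a0: "a \<noteq> 0" using a by auto
      define S' where "S' = insert 1 (S \<union> inverse ` S)"
      define G where "G = S' \<union> {a, inverse a, h, inverse h}"
      have fS': "finite S'" unfolding S'_def using S(1) by simp
      have G: "finite G" "G \<subseteq> D" unfolding G_def S'_def using S(1) SD(1) a(1) hD invD sringD(2)[OF sD] by auto
      obtain T e where T: "finite T" "T \<subseteq> D" "\<forall>x\<in>lspan B T. \<forall>y\<in>lspan B T. x * y \<in> lspan B T"
        and e: "e \<in> B" "e \<noteq> 0" "\<forall>g\<in>G. e * g \<in> lspan B T"
        using exists_order[OF sD Bas B val(2) _ G] alg by (metis (no_types))
      define M where "M = lspan B T"
      have MD: "M \<subseteq> D" unfolding M_def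
        by (rule lspan_least) (use BD T(2) in \<open>auto intro!: sringD(1,3,4)[OF sD]\<close>)
      have cen: "b * x = x * b" if "b \<in> B" "x \<in> D" for b x using center_commute[of b D x] val(2) that by blast
      have Mm: "x * y \<in> M" if "x \<in> M" "y \<in> M" for x y using T(3) that M_def by blast
      have cenM: "b * x = x * b" if "b \<in> B" "x \<in> M" for b x using cen that MD by blast
      have "\<exists>nu C. (\<forall>x\<in>M. \<forall>y\<in>M. nu (x + y) \<le> nu x + nu y) \<and> (\<forall>b\<in>B. \<forall>x\<in>M. nu (b * x) = N b * nu x) \<and>
        (\<forall>x\<in>M. x \<noteq> 0 \<longrightarrow> nu x \<ge> 1) \<and> C > (0::real) \<and> (\<forall>x\<in>M. \<forall>y\<in>M. nu (x * y) \<le> C * nu x * nu y)"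
        by (rule exists_norm[OF T(1) M_def]) (fact Mm cenM)+
      then obtain nu C where nu: "\<forall>x\<in>M. \<forall>y\<in>M. nu (x + y) \<le> nu x + nu y" "\<forall>b\<in>B. \<forall>x\<in>M. nu (b * x) = N b * nu x"
        "\<forall>x\<in>M. x \<noteq> 0 \<longrightarrow> nu x \<ge> 1" "C > (0::real)" "\<forall>x\<in>M. \<forall>y\<in>M. nu (x * y) \<le> C * nu x * nu y"
        by (elim exE conjE)
      interpret normed_order B N M nu C
        by unfold_locales
          (use nu Mm cenM M_def lspan.zero[of B T] lspan_add[of _ B T] lspan_scale[OF B] in auto)
      have GD: "g \<in> Dq" if "g \<in> G" for g using DqI[OF e(1,2)] e(3) that M_def by blast
      show ?thesis
      proof (rule conj_iter_rigid[of S'])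
        show "S' \<subseteq> Dq" "1 \<in> Dq" "a \<in> Dq" "inverse a \<in> Dq" "h \<in> Dq" "inverse h \<in> Dq"
          using GD unfolding G_def S'_def by auto
        show "alg_over B (inverse a)"
          by (rule alg_over_lattice[OF B comm T(1) _ e(1,2)])
            (use T(3) e(3) G_def cen[OF e(1) invD[OF a(1)]] a0 in auto)
        show "a + t \<noteq> 0" if "t \<in> B" for t
        proof
          assume "a + t = 0"
          then have "a = - t" by (simp add: eq_neg_iff_add_eq_0)
          then show False using a(2) cen[OF that hD] by simp
        qed
        then show "conj_iter h (Suc n) (a + t) \<in> H" if "t \<in> B" for t using mem that by blast
        show "\<exists>j. e ^ j * x \<in> M" if "e \<in> B" "\<And>g. g \<in> S' \<Longrightarrow> e * g \<in> M" "x \<in> H" for e x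
        proof (rule generate_power_mem[OF S(3,2) sD HD _ Mm])
          show "e \<in> center_of D" using val(2) that(1) by blast
          show "e * 1 \<in> M" by (rule that(2)) (simp add: S'_def)
          show "e * g \<in> M" "e * inverse g \<in> M" if "g \<in> S" for g
            using \<open>\<And>g. g \<in> S' \<Longrightarrow> e * g \<in> M\<close> that unfolding S'_def by auto
        qed (use that(3) in auto)
      qed (use fS' h0 val(3) in auto)
    qed
    \<comment> \<open>Elements commuting with \<open>h\<close> are killed by the first bracket;
      \<open>rigid\<close> covers the others.\<close>
    have zero: "(ad h ^^ Suc n) x = 0" if "x \<in> D" for x
    proof (cases "x * h = h * x")
      case True
      then have "ad h x = 0" by (simp add: ad_def)
      moreover have "(ad h ^^ m) 0 = 0" for m by (induction m) (simp_all add: ad_def)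
      ultimately show ?thesis by (simp only: funpow_Suc_right o_apply)
    qed (use rigid that in blast)
    show False
      by (rule ad_not_nilpotent[OF D hD SD(2) ha0 zero]) (use rigid val(2) in blast)+
  qed
qed

end
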